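(* Let $r\in\mathbb{N}$ ($r\ge 1$). Let $\mathbb{T}$ be a time scale such that either $r=1$, or there are constants $a_1\in\mathbb{R}^+$ and $a_0\in\mathbb{R}$ with $\rho(t)=a_1t+a_0$ for every $t\in\mathbb{T}$. Let $a,b\in\mathbb{T}$, $a<b$, with $[a,b]\cap\mathbb{T}$ containing at least $2r+1$ points. Consider the variational problem $$\mathcal{L}[y(\cdot)]=\int_{\sigma^{r-1}(a)}^{b}L\bigl(t,y^{\rho^r}(t),y^{\rho^{r-1}\nabla}(t),\ldots,y^{\rho\nabla^{r-1}}(t),y^{\nabla^r}(t)\bigr)\nabla t\longrightarrow\mathrm{extr},$$ $$y^{\nabla^i}(\sigma^{r-1}(a))=\alpha_i,\qquad y^{\nabla^i}(b)=\beta_i,\qquad i=0,1,\ldots,r-1,$$ over $y\in C^{2r}([a,b],\mathbb{R})$, where $\alpha_i,\beta_i\in\mathbb{R}$ are given and the Lagrangian $L(t,u_0,u_1,\ldots,u_r)$ has (standard) continuous partial derivatives with respect to $u_0,\ldots,u_r$, and partial nabla derivative with respect to $t$ of order $r+1$. If $y_\ast$ is a weak local extremum (weak local minimizer or weak local maximizer) of this problem, then $y_\ast$ satisfies the Euler-Lagrange equation $$\sum_{i=0}^{r}(-1)^i\left(\frac{1}{a_1}\right)^{\frac{i(i-1)}{2}}L_{u_i}^{\nabla^i}\bigl(t,y_\ast^{\rho^r}(t),y_\ast^{\rho^{r-1}\nabla}(t),\ldots,y_\ast^{\rho\nabla^{r-1}}(t),y_\ast^{\nabla^r}(t)\bigr)=0$$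 for all $t\in[a,b]_{\kappa^{2r}}$.
   Context: A time scale $\mathbb{T}$ is a nonempty closed subset of $\mathbb{R}$, with the subspace topology. $\sigma(t)=\inf\{s\in\mathbb{T}:s>t\}$ if $t\ne\sup\mathbb{T}$, $\sigma(\sup\mathbb{T})=\sup\mathbb{T}$; $\rho(t)=\sup\{s\in\mathbb{T}:s<t\}$ if $t\neq\inf\mathbb{T}$, $\rho(\inf\mathbb{T})=\inf\mathbb{T}$; $\sigma^n,\rho^n$ denote $n$-fold composition ($\sigma^0=\rho^0=\mathrm{id}$). A point $t$ is right-scattered if $\sigma(t)>t$, right-dense if $\sigma(t)=t$. $\mathbb{T}_\kappa=\mathbb{T}\setminus\{m\}$ if $\mathbb{T}$ has a right-scattered minimum $m$, otherwise $\mathbb{T}_\kappa=\mathbb{T}$; $\mathbb{T}_{\kappa^r}=(\mathbb{T}_{\kappa^{r-1}})_\kappa$. $f:\mathbb{T}\to\mathbb{R}$ is nabla differentiable at $t\in\mathbb{T}_\kappa$ with derivative $f^\nabla(t)$ if for all $\varepsilon>0$ there is a neighborhood $U$ of $t$ in $\mathbb{T}$ with $|f(\rho(t))-f(s)-f^\nabla(t)(\rho(t)-s)|\le\varepsilon|\rho(t)-s|$ for all $s\in U$. The $r$-th nabla derivative $f^{\nabla^r}:\mathbb{T}_{\kappa^r}\to\mathbb{R}$ is defined by iteration, $f^{\nabla^0}=f$. If $F^\nabla=f$ on $\mathbb{T}_\kappa$, then $\int_a^b f(t)\nabla t:=F(b)-F(a)$. $[a,b]$ denotes $\{t\in\mathbb{T}:a\le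 t\le b\}$, itself regarded as a time scale when derivatives of functions on it and the sets $[a,b]_{\kappa^j}$ are formed; $[a,b]_\kappa=[a,b]$ if $a$ is right-dense and $[\sigma(a),b]$ if $a$ is right-scattered. Notation: $f^{\rho^j}=f\circ\rho^j$, and $f^{\rho^{j}\nabla^{i}}=(f\circ\rho^j)^{\nabla^i}$ (compose first, then differentiate). $C^{2r}([a,b],\mathbb{R})$ is the set of $y:[a,b]\to\mathbb{R}$ such that $y^{\nabla^{2r}}$ is continuous on $[a,b]_{\kappa^{2r}}$. $L_{u_i}$ is the partial derivative of $L$ with respect to $u_i$, and $L_{u_i}^{\nabla^i}(t,\ldots)$ denotes the $i$-th nabla derivative of the composite function $t\mapsto L_{u_i}(t,y_\ast^{\rho^r}(t),\ldots,y_\ast^{\nabla^r}(t))$, which is a function on $[a,b]_{\kappa^r}$. When $r=1$ the exponents $i(i-1)/2$ are $0$, so the factors involving $a_1$ equal $1$. $y_\ast\in C^{2r}([a,b],\mathbb{R})$ satisfying the boundary conditions is a weak local minimizer (resp. maximizer) if there is $\delta>0$ such that $\mathcal{L}[y_\ast]\le\mathcal{L}[y]$ (resp. $\ge$) for all $y\in C^{2r}([a,b],\mathbb{R})$ satisfying the boundary conditions and $\|y-y_\ast\|_{r,\infty}<\delta$, where $\|y\|_{r,\infty}=\sum_{i=0}^r\|y^{\rho^{r-i}\nabla^i}\|_\infty$ and $\|y\|_\infty=\sup_{t\in[a,b]_{\kappa^r}}|y(t)|$.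
   Formalization: The existence of L_{u_i}^{∇^i} along y_* for 1≤i<r is assumed, as it can fail; for i=r it is proved. Iterated nabla derivatives use ρ of [a,b] throughout, so if r=1, a is right-scattered and σ(a) right-dense, C^2 is empty (the claim can fail there). *)

theory Defs
  imports "HOL-Analysis.Analysis"
begin

definition time_scale :: "real set \<Rightarrow> bool" where
  "time_scale T \<longleftrightarrow> closed T \<and> T \<noteq> {}"

definition sigma :: "real set \<Rightarrow> real \<Rightarrow> real" where
  "sigma T t = (if \<exists>s\<in>T. t < s then Inf {s\<in>T. t < s} else t)"

definition rho :: "real set \<Rightarrow> real \<Rightarrow> real" where
  "rho T t = (if \<exists>s\<in>T. s < t then Sup {s\<in>T. s < t} else t)"

definition kappa :: "real set \<Rightarrow> real set" where
  "kappa T = {t\<in>T. \<not> ((\<forall>s\<in>T. t \<le> s) \<and> sigma T t > t)}"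

text \<open>
  \<open>f\<close> is a function on \<open>D \<subseteq> T\<close>, and \<open>\<rho>\<close> is always the backward jump operator of \<open>T\<close>. For
  \<open>D = T\<close> this is the usual nabla derivative at a point of \<open>kappa T\<close>; the smaller domains
  \<open>D\<close> are the sets obtained from \<open>T\<close> by iterating \<open>kappa\<close>, on which the higher derivatives live.
  Since \<open>f (\<rho> t)\<close> occurs in the defining inequality, \<open>\<rho> t\<close> has to lie in the domain of \<open>f\<close>.
  For \<open>t \<in> kappa D\<close> this fails only if \<open>t\<close> is a right-dense minimum of \<open>D\<close> that is left-scattered in \<open>T\<close>.
\<close>

definition has_nabla_derivative ::
    "real set \<Rightarrow> real set \<Rightarrow> (real \<Rightarrow> real) \<Rightarrow> real \<Rightarrow> real \<Rightarrow> bool" where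
  "has_nabla_derivative T D f d t \<longleftrightarrow>
     t \<in> D \<and> rho T t \<in> D \<and>
     (\<forall>\<epsilon>>0. \<exists>\<delta>>0. \<forall>s\<in>D. \<bar>s - t\<bar> < \<delta> \<longrightarrow>
        \<bar>f (rho T t) - f s - d * (rho T t - s)\<bar> \<le> \<epsilon> * \<bar>rho T t - s\<bar>)"

text \<open>
  The \<open>n\<close>-th derivative of \<open>f : D \<rightarrow> \<real>\<close> is meaningful on \<open>(kappa ^^ n) D\<close> if \<open>f\<close> satisfies
  \<open>nabla_differentiable T D n\<close>.
\<close>

primrec nabla_deriv ::
    "real set \<Rightarrow> real set \<Rightarrow> nat \<Rightarrow> (real \<Rightarrow> real) \<Rightarrow> real \<Rightarrow> real" where
  "nabla_deriv T D 0 f = f"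
| "nabla_deriv T D (Suc n) f =
     (\<lambda>t. THE d. has_nabla_derivative T ((kappa ^^ n) D) (nabla_deriv T D n f) d t)"

definition nabla_differentiable ::
    "real set \<Rightarrow> real set \<Rightarrow> nat \<Rightarrow> (real \<Rightarrow> real) \<Rightarrow> bool" where
  "nabla_differentiable T D n f \<longleftrightarrow>
     (\<forall>k<n. \<forall>t\<in>(kappa ^^ Suc k) D.
        \<exists>d. has_nabla_derivative T ((kappa ^^ k) D) (nabla_deriv T D k f) d t)"

definition nabla_integral ::
    "real set \<Rightarrow> real set \<Rightarrow> (real \<Rightarrow> real) \<Rightarrow> real \<Rightarrow> real \<Rightarrow> real" where
  "nabla_integral T D f c d =
     (THE I. \<exists>F. (\<forall>t\<in>kappa D. has_nabla_derivative T D F (f t) t) \<and> I = F d - F c)"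

definition ts_interval :: "real set \<Rightarrow> real \<Rightarrow> real \<Rightarrow> real set" where
  "ts_interval T a b = {t\<in>T. a \<le> t \<and> t \<le> b}"

text \<open>
  In the following, \<open>X\<close> is a time scale \<open>ts_interval T a b\<close>, with its own jump operators.
\<close>

definition C_nabla :: "nat \<Rightarrow> real set \<Rightarrow> (real \<Rightarrow> real) set" where
  "C_nabla n X =
     {y. nabla_differentiable X X n y \<and> continuous_on ((kappa ^^ n) X) (nabla_deriv X X n y)}"

text \<open>
  Compose first, then differentiate; since \<open>rho X a = a\<close>, the composition is a
  function on all of \<open>X\<close>.
\<close>

definition rho_nabla :: "real set \<Rightarrow> nat \<Rightarrow> nat \<Rightarrow> (real \<Rightarrow> real) \<Rightarrow> real \<Rightarrow> real" where
  "rho_nabla X j i y = nabla_deriv X X i (y \<circ> (rho X ^^ j))"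

text \<open>
  Points \<open>(u\<^sub>0, \<dots>, u\<^sub>r)\<close> are functions \<open>nat \<Rightarrow> real\<close> vanishing beyond \<open>r\<close>, that is, elements of
  \<open>topspace (Euclidean_space (Suc r))\<close>.
\<close>

definition jet :: "real set \<Rightarrow> nat \<Rightarrow> (real \<Rightarrow> real) \<Rightarrow> real \<Rightarrow> (nat \<Rightarrow> real)" where
  "jet X r y t = (\<lambda>i. if i \<le> r then rho_nabla X (r - i) i y t else 0)"

definition partial_u ::
    "(real \<Rightarrow> (nat \<Rightarrow> real) \<Rightarrow> real) \<Rightarrow> nat \<Rightarrow> real \<Rightarrow> (nat \<Rightarrow> real) \<Rightarrow> real" where
  "partial_u L i t u = deriv (\<lambda>x. L t (u(i := x))) (u i)"

text \<open>
  The integrand is a function on \<open>(kappa ^^ r) X\<close> and is integrated over the points from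
  \<open>\<sigma>\<^bsup>r-1\<^esup>(a)\<close> to \<open>b\<close>, so its antiderivative is a function on \<open>(kappa ^^ (r - 1)) X\<close>.
\<close>

definition variational_functional ::
    "real set \<Rightarrow> real \<Rightarrow> real \<Rightarrow> nat \<Rightarrow> (real \<Rightarrow> (nat \<Rightarrow> real) \<Rightarrow> real) \<Rightarrow> (real \<Rightarrow> real) \<Rightarrow> real" where
  "variational_functional T a b r L y =
     (let X = ts_interval T a b in
      nabla_integral X ((kappa ^^ (r - 1)) X) (\<lambda>t. L t (jet X r y t))
        ((sigma T ^^ (r - 1)) a) b)"

definition admissible ::
    "real set \<Rightarrow> real \<Rightarrow> real \<Rightarrow> nat \<Rightarrow> (nat \<Rightarrow> real) \<Rightarrow> (nat \<Rightarrow> real) \<Rightarrow> (real \<Rightarrow> real) \<Rightarrow> bool" where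
  "admissible T a b r \<alpha> \<beta> y \<longleftrightarrow>
     (let X = ts_interval T a b in
      y \<in> C_nabla (2 * r) X \<and>
      (\<forall>i<r. nabla_deriv X X i y ((sigma T ^^ (r - 1)) a) = \<alpha> i \<and> nabla_deriv X X i y b = \<beta> i))"

definition weak_norm :: "real set \<Rightarrow> nat \<Rightarrow> (real \<Rightarrow> real) \<Rightarrow> real" where
  "weak_norm X r y = (\<Sum>i\<le>r. SUP t\<in>(kappa ^^ r) X. \<bar>rho_nabla X (r - i) i y t\<bar>)"

definition weak_local_minimizer ::
    "real set \<Rightarrow> real \<Rightarrow> real \<Rightarrow> nat \<Rightarrow> (real \<Rightarrow> (nat \<Rightarrow> real) \<Rightarrow> real) \<Rightarrow>
     (nat \<Rightarrow> real) \<Rightarrow> (nat \<Rightarrow> real) \<Rightarrow> (real \<Rightarrow> real) \<Rightarrow> bool" where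
  "weak_local_minimizer T a b r L \<alpha> \<beta> y0 \<longleftrightarrow>
     admissible T a b r \<alpha> \<beta> y0 \<and>
     (\<exists>\<delta>>0. \<forall>y. admissible T a b r \<alpha> \<beta> y \<and>
        weak_norm (ts_interval T a b) r (\<lambda>t. y t - y0 t) < \<delta> \<longrightarrow>
        variational_functional T a b r L y0 \<le> variational_functional T a b r L y)"

definition weak_local_maximizer ::
    "real set \<Rightarrow> real \<Rightarrow> real \<Rightarrow> nat \<Rightarrow> (real \<Rightarrow> (nat \<Rightarrow> real) \<Rightarrow> real) \<Rightarrow>
     (nat \<Rightarrow> real) \<Rightarrow> (nat \<Rightarrow> real) \<Rightarrow> (real \<Rightarrow> real) \<Rightarrow> bool" where
  "weak_local_maximizer T a b r L \<alpha> \<beta> y0 \<longleftrightarrow>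
     admissible T a b r \<alpha> \<beta> y0 \<and>
     (\<exists>\<delta>>0. \<forall>y. admissible T a b r \<alpha> \<beta> y \<and>
        weak_norm (ts_interval T a b) r (\<lambda>t. y t - y0 t) < \<delta> \<longrightarrow>
        variational_functional T a b r L y0 \<ge> variational_functional T a b r L y)"

definition weak_local_extremum ::
    "real set \<Rightarrow> real \<Rightarrow> real \<Rightarrow> nat \<Rightarrow> (real \<Rightarrow> (nat \<Rightarrow> real) \<Rightarrow> real) \<Rightarrow>
     (nat \<Rightarrow> real) \<Rightarrow> (nat \<Rightarrow> real) \<Rightarrow> (real \<Rightarrow> real) \<Rightarrow> bool" where
  "weak_local_extremum T a b r L \<alpha> \<beta> y0 \<longleftrightarrow>
     weak_local_minimizer T a b r L \<alpha> \<beta> y0 \<or> weak_local_maximizer T a b r L \<alpha> \<beta> y0"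

end

theory Submission
  imports Defs
begin

text \<open>
  Let \<open>f\<^sub>i\<close> be \<open>L\<^bsub>u\<^sub>i\<^esub>\<close> along the extremal. Because \<open>\<rho>\<close> is affine, \<open>(\<eta> \<circ> \<rho>)\<^sup>\<nabla> = a\<^sub>1 (\<eta>\<^sup>\<nabla> \<circ> \<rho>)\<close>,
  so all components of the jet of a variation \<open>\<eta>\<close> are nabla derivatives of \<open>\<eta>\<close> composed with powers of \<open>\<rho>\<close>.
  Repeated integration by parts, always integrating the coefficient (so that no smoothness of \<open>f\<^sub>i\<close> is
  needed), turns the vanishing of the first variation into \<open>\<integral> B \<eta>\<^bsup>\<nabla>r\<^esup> = 0\<close>, where \<open>B\<close> is \<open>f\<^sub>r\<close> plus
  iterated integrals of the other \<open>f\<^sub>i\<close>. The du Bois-Reymond lemma makes \<open>B\<close> a polynomial of degree less than \<open>r\<close>;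
  hence \<open>f\<^sub>r\<close> is \<open>r\<close> times nabla differentiable, and differentiating \<open>r\<close> times gives the equation.

  Continuous functions composed with \<open>\<rho>\<close> need not be continuous, so integrands are functions
  \<open>t \<mapsto> \<Phi> (t, \<rho> t)\<close> with \<open>\<Phi>\<close> continuous. A nabla antiderivative of such an \<open>f\<close> is the ordinary integral of its
  extension to the reals that is constant on each gap \<open>(\<rho> t, t]\<close>.
\<close>

subsection \<open>Nabla derivatives\<close>

text \<open>Each derivative lives on a smaller set, and \<open>rho X t\<close> has to stay inside
  it. The locale \<open>nabla_chain\<close> isolates what the iterates of \<open>kappa\<close> must
  satisfy for this. It is used with N = 2 r: the integrand sits at level k = r - 1, and the du
  Bois-Reymond lemma consumes r further levels. The variations are r-fold integrals, from
  \<sigma>^(r-1)(a), of a free function w. The boundary conditions on the left then hold by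
  construction, and those at b are r linear conditions on w. These r conditions are the source of
  the r coefficients of the polynomial B. The weight i(i-1)/2 arises from two kinds of powers of a1:
  i(r-i) from differentiating i times through r-i jumps, and r-i from each integration by parts.
  Solving the resulting recurrence leaves one common power and this weight. That B is a polynomial
  says only that a combination of the coefficients is smooth. Since the f_i with 0 < i < r are
  differentiable by hypothesis, the relation can be solved for f_r.\<close>

lemma rho_le: "rho X t \<le> t"
  by (auto simp: rho_def intro!: cSup_least)

lemma rho_ge: "x \<in> X \<Longrightarrow> x < t \<Longrightarrow> x \<le> rho X t"
  unfolding rho_def by (auto intro!: cSup_upper bdd_aboveI[of _ t])

lemma rho_in:
  assumes "closed X" "t \<in> X" shows "rho X t \<in> X"
proof (cases "\<exists>s\<in>X. s < t")
  case True
  have "Sup {s\<in>X. s < t} \<in> closure {s\<in>X. s < t}"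
    using True by (intro closure_contains_Sup) (auto intro!: bdd_aboveI[of _ t])
  also have "\<dots> \<subseteq> X"
    using assms by (intro closure_minimal) auto
  finally show ?thesis using True by (simp add: rho_def)
qed (use assms in \<open>auto simp: rho_def\<close>)

lemma rho_mono: "t \<in> X \<Longrightarrow> t \<le> t' \<Longrightarrow> rho X t \<le> rho X t'"
  using rho_ge[of t X t'] rho_le[of X t] by (cases "t = t'") auto

lemma rho_pow_le: "(rho X ^^ j) t \<le> t"
  by (induction j) (use rho_le order_trans in \<open>fastforce+\<close>)

lemma left_dense_approx:
  assumes "rho X t = t" "x \<in> X" "x < t" "e > 0"
  shows "\<exists>z\<in>X. t - e < z \<and> z < t"
proof -
  have "Sup {s\<in>X. s < t} = t" using assms by (auto simp: rho_def split: if_splits)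
  then have "t - e < Sup {s\<in>X. s < t}" using assms by simp
  then show ?thesis using assms less_cSupD[of "{s\<in>X. s < t}" "t - e"] by auto
qed

text \<open>A point z of \<open>X\<close> just below t forces z \<le> \<open>rho X x\<close> for
  every x > z, so the jump cannot fall far behind x.\<close>

lemma rho_tendsto_left_dense:
  assumes "rho X t = t" "t \<in> X"
  shows "(rho X \<longlongrightarrow> t) (at t within X)"
  unfolding tendsto_iff eventually_at
proof (intro allI impI)
  fix e :: real assume e: "e > 0"
  show "\<exists>d>0. \<forall>x\<in>X. x \<noteq> t \<and> dist x t < d \<longrightarrow> dist (rho X x) t < e"
  proof (cases "\<exists>x\<in>X. x < t")
    case True
    then obtain z where z: "z \<in> X" "t - e < z" "z < t"
      using left_dense_approx[OF assms(1)] e by blast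
    show ?thesis
    proof (intro exI[of _ "min e (t - z)"] conjI ballI impI)
      fix x assume x: "x \<in> X" "x \<noteq> t \<and> dist x t < min e (t - z)"
      have "z \<le> rho X x" using x z by (intro rho_ge) (auto simp: dist_real_def)
      then show "dist (rho X x) t < e"
        using x z rho_le[of X x] by (auto simp: dist_real_def)
    qed (use z e in auto)
  next
    \<comment> \<open>No point of \<open>X\<close> lies to the left, so \<open>rho X t = t\<close>
      holds by convention; points x to the right satisfy t \<le> \<open>rho X x\<close> \<le>
      x.\<close>
    case False
    show ?thesis
    proof (intro exI[of _ e] conjI ballI impI)
      fix x assume x: "x \<in> X" "x \<noteq> t \<and> dist x t < e"
      then have "t \<le> rho X x" using assms False by (intro rho_ge) force+
      then show "dist (rho X x) t < e"
        using x rho_le[of X x] by (auto simp: dist_real_def)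
    qed (use e in auto)
  qed
qed

lemma has_nabla_dense:
  assumes "t \<in> X" "rho X t = t"
  shows "has_nabla_derivative X X f d t \<longleftrightarrow> (f has_field_derivative d) (at t within X)"
proof -
  have eq: "\<bar>f t - f s - d * (t - s)\<bar> = \<bar>f s - f t - d * (s - t)\<bar>" "\<bar>t - s\<bar> = \<bar>s - t\<bar>" for s
    by (simp_all add: algebra_simps abs_minus_commute)
  show ?thesis
    unfolding has_nabla_derivative_def has_field_derivative_def has_derivative_within_alt
    using assms by (simp add: eq bounded_linear_mult_right)
qed

lemma ex_pos_le_three: "0 < x \<Longrightarrow> 0 < y \<Longrightarrow> 0 < z \<Longrightarrow> \<exists>k>0. k \<le> x \<and> k \<le> y \<and> k \<le> (z::real)"
  by (rule exI[of _ "min x (min y z)"]) auto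

text \<open>Near t the factor \<open>\<bar>rho X t - s\<bar>\<close> stays close to the gap length m
  > 0. Taking s = t fixes the difference quotient; the other s only express continuity at t, a
  genuine condition when t is right-dense.\<close>

lemma has_nabla_scattered:
  assumes "t \<in> X" "rho X t \<in> X" "rho X t \<noteq> t"
  shows "has_nabla_derivative X X f d t \<longleftrightarrow>
    continuous (at t within X) f \<and> f t - f (rho X t) = d * (t - rho X t)" (is "?L \<longleftrightarrow> ?R")
proof -
  define m where "m = t - rho X t"
  have m: "m > 0" using rho_le[of X t] assms by (simp add: m_def)
  show ?thesis
  proof
    assume L: ?L
    have q: "f t - f (rho X t) = d * m"
    proof (rule ccontr)
      assume ne: "f t - f (rho X t) \<noteq> d * m"
      \<comment> \<open>With this e, the inequality at s = t would bound the defect by half of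
        itself.\<close>
      define e where "e = \<bar>f t - f (rho X t) - d * m\<bar> / (2 * m)"
      have e: "e > 0" using ne m by (simp add: e_def)
      then obtain \<delta> where "\<delta> > 0"
        "\<forall>s\<in>X. \<bar>s - t\<bar> < \<delta> \<longrightarrow> \<bar>f (rho X t) - f s - d * (rho X t - s)\<bar> \<le> e * \<bar>rho X t - s\<bar>"
        using L unfolding has_nabla_derivative_def by blast
      then have "\<bar>f (rho X t) - f t - d * (rho X t - t)\<bar> \<le> e * m"
        using assms(1) m by (auto simp: m_def)
      moreover have "\<bar>f (rho X t) - f t - d * (rho X t - t)\<bar> = \<bar>f t - f (rho X t) - d * m\<bar>"
        by (simp add: m_def algebra_simps abs_minus_commute)
      moreover have "e * m = \<bar>f t - f (rho X t) - d * m\<bar> / 2" using m by (simp add: e_def)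
      ultimately show False using ne by auto
    qed
    have "continuous (at t within X) f"
      unfolding continuous_within_eps_delta
    proof (intro allI impI)
      fix e :: real assume e: "e > 0"
      \<comment> \<open>Within distance 1 of t, \<open>\<bar>rho X t - s\<bar>\<close> is at most m
        + 1, so this error is at most e / 2; the other half pays for
        \<open>d * (s - t)\<close>.\<close>
      define e1 where "e1 = e / (2 * (m + 1))"
      have e1: "e1 > 0" using e m by (simp add: e1_def)
      then obtain \<delta> where \<delta>: "\<delta> > 0"
        "\<forall>s\<in>X. \<bar>s - t\<bar> < \<delta> \<longrightarrow> \<bar>f (rho X t) - f s - d * (rho X t - s)\<bar> \<le> e1 * \<bar>rho X t - s\<bar>"
        using L unfolding has_nabla_derivative_def by blast
      obtain k where k: "k > 0" "k \<le> \<delta>" "k \<le> 1" "k \<le> e / (2 * (\<bar>d\<bar> + 1))"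
        using ex_pos_le_three[of \<delta> 1 "e / (2 * (\<bar>d\<bar> + 1))"] \<delta> e by auto
      show "\<exists>k>0. \<forall>s\<in>X. dist s t < k \<longrightarrow> dist (f s) (f t) < e"
      proof (intro exI[of _ k] conjI ballI impI)
        fix s assume s: "s \<in> X" "dist s t < k"
        have "\<bar>f (rho X t) - f s - d * (rho X t - s)\<bar> \<le> e1 * \<bar>rho X t - s\<bar>"
          using \<delta>(2) s k by (auto simp: dist_real_def)
        also have "\<dots> \<le> e1 * (m + 1)"
          using e1 s k rho_le[of X t] unfolding m_def dist_real_def by (intro mult_left_mono) auto
        also have "\<dots> = e / 2" using m by (simp add: e1_def field_simps)
        finally have A: "\<bar>f (rho X t) - f s - d * (rho X t - s)\<bar> \<le> e / 2" .
        have "f s - f t = - (f (rho X t) - f s - d * (rho X t - s)) + d * (s - t)"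
          using q by (simp add: m_def algebra_simps)
        then have B: "\<bar>f s - f t\<bar> \<le> e / 2 + \<bar>d\<bar> * \<bar>s - t\<bar>"
          using A abs_mult[of d "s - t"] by linarith
        have "\<bar>d\<bar> * \<bar>s - t\<bar> \<le> \<bar>d\<bar> * (e / (2 * (\<bar>d\<bar> + 1)))"
          using s k by (intro mult_left_mono) (auto simp: dist_real_def)
        also have "\<dots> < e / 2" using e by (simp add: field_simps)
        finally show "dist (f s) (f t) < e" using B by (simp add: dist_real_def)
      qed (rule k)
    qed
    with q show ?R by (simp add: m_def)
  next
    assume R: ?R
    show ?L
      unfolding has_nabla_derivative_def
    proof (intro conjI allI impI)
      fix e :: real assume e: "e > 0"
      \<comment> \<open>For s within m / 2 of t, \<open>\<bar>rho X t - s\<bar>\<close> is at least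
        m / 2, which absorbs two errors of size e1.\<close>
      define e1 where "e1 = e * m / 4"
      have e1: "e1 > 0" using e m by (simp add: e1_def)
      then obtain \<delta> where \<delta>: "\<delta> > 0" "\<forall>s\<in>X. dist s t < \<delta> \<longrightarrow> dist (f s) (f t) < e1"
        using R unfolding continuous_within_eps_delta by blast
      obtain k where k: "k > 0" "k \<le> \<delta>" "k \<le> m / 2" "k \<le> e1 / (\<bar>d\<bar> + 1)"
        using ex_pos_le_three[of \<delta> "m / 2" "e1 / (\<bar>d\<bar> + 1)"] \<delta> m e1
        by (auto intro: add_nonneg_pos)
      show "\<exists>\<delta>>0. \<forall>s\<in>X. \<bar>s - t\<bar> < \<delta> \<longrightarrow>
        \<bar>f (rho X t) - f s - d * (rho X t - s)\<bar> \<le> e * \<bar>rho X t - s\<bar>"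
      proof (intro exI[of _ k] conjI ballI impI)
        fix s assume s: "s \<in> X" "\<bar>s - t\<bar> < k"
        have A: "\<bar>f s - f t\<bar> < e1" using \<delta>(2) s k by (auto simp: dist_real_def)
        have B: "\<bar>d\<bar> * \<bar>s - t\<bar> \<le> \<bar>d\<bar> * (e1 / (\<bar>d\<bar> + 1))"
          using s k by (intro mult_left_mono) auto
        also have "\<dots> \<le> e1" using e1 by (simp add: field_simps)
        finally have B: "\<bar>d * (s - t)\<bar> \<le> e1" by (simp add: abs_mult)
        have "f (rho X t) - f s - d * (rho X t - s) = f t - f s + d * (s - t)"
          using R by (simp add: algebra_simps)
        then have "\<bar>f (rho X t) - f s - d * (rho X t - s)\<bar> \<le> 2 * e1" using A B by linarith
        also have "\<dots> = e * (m / 2)" by (simp add: e1_def)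
        also have "\<dots> \<le> e * \<bar>rho X t - s\<bar>"
          using e s k by (intro mult_left_mono) (auto simp: m_def)
        finally show "\<bar>f (rho X t) - f s - d * (rho X t - s)\<bar> \<le> e * \<bar>rho X t - s\<bar>" .
      qed (rule k)
    qed (use assms in auto)
  qed
qed

lemma has_nabla_in: "has_nabla_derivative X Y f d t \<Longrightarrow> t \<in> Y \<and> rho X t \<in> Y"
  by (simp add: has_nabla_derivative_def)

lemma has_nabla_iff:
  assumes "closed X" "t \<in> X"
  shows "has_nabla_derivative X X f d t \<longleftrightarrow>
    (if rho X t = t then (f has_field_derivative d) (at t within X)
     else continuous (at t within X) f \<and> f t - f (rho X t) = d * (t - rho X t))"
  using has_nabla_dense has_nabla_scattered rho_in assms by (cases "rho X t = t") auto

lemma has_nabla_continuous: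
  assumes "has_nabla_derivative X X f d t"
  shows "continuous (at t within X) f"
proof (cases "rho X t = t")
  case True
  have "(f has_field_derivative d) (at t within X)"
    using has_nabla_in[OF assms] assms True by (simp add: has_nabla_dense)
  then show ?thesis by (rule DERIV_continuous)
next
  case False
  then show ?thesis using has_nabla_in[OF assms] assms by (simp add: has_nabla_scattered)
qed

lemma has_nabla_jump:
  assumes "has_nabla_derivative X X f d t"
  shows "f t - f (rho X t) = d * (t - rho X t)"
proof (cases "rho X t = t")
  case False
  then show ?thesis using has_nabla_in[OF assms] assms by (simp add: has_nabla_scattered)
qed auto

text \<open>At an isolated point with \<open>rho X t = t\<close> every d would be a derivative; the
  limit-point hypothesis excludes this.\<close>

lemma has_nabla_unique:
  assumes "has_nabla_derivative X X f d t" "has_nabla_derivative X X f d' t"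
    and "rho X t = t \<Longrightarrow> t islimpt X"
  shows "d = d'"
proof (cases "rho X t = t")
  case True
  have "t \<in> X" using has_nabla_in[OF assms(1)] by simp
  then have "((\<lambda>y. (f y - f t) / (y - t)) \<longlongrightarrow> d) (at t within X)"
    "((\<lambda>y. (f y - f t) / (y - t)) \<longlongrightarrow> d') (at t within X)"
    using assms(1,2) True by (simp_all add: has_nabla_dense has_field_derivative_iff)
  moreover have "at t within X \<noteq> bot" using assms(3)[OF True] by (simp add: trivial_limit_within)
  ultimately show ?thesis using tendsto_unique by blast
next
  case False
  then show ?thesis using has_nabla_jump[OF assms(1)] has_nabla_jump[OF assms(2)] by auto
qed

text \<open>Locality has two parts, because f is evaluated both near t and at
  \<open>rho X t\<close>, which may be far from t.\<close>

lemma has_nabla_local: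
  assumes "has_nabla_derivative X Y f d t" "t \<in> Z" "rho X t \<in> Z"
    and "\<delta> > 0" "\<And>x. x \<in> Z \<Longrightarrow> \<bar>x - t\<bar> < \<delta> \<Longrightarrow> x \<in> Y \<and> g x = f x"
    and "g (rho X t) = f (rho X t)"
  shows "has_nabla_derivative X Z g d t"
  unfolding has_nabla_derivative_def
proof (intro conjI allI impI)
  fix e :: real assume "e > 0"
  then obtain k where k: "k > 0" "\<forall>s\<in>Y. \<bar>s - t\<bar> < k \<longrightarrow>
      \<bar>f (rho X t) - f s - d * (rho X t - s)\<bar> \<le> e * \<bar>rho X t - s\<bar>"
    using assms(1) unfolding has_nabla_derivative_def by blast
  show "\<exists>\<delta>>0. \<forall>s\<in>Z. \<bar>s - t\<bar> < \<delta> \<longrightarrow>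
        \<bar>g (rho X t) - g s - d * (rho X t - s)\<bar> \<le> e * \<bar>rho X t - s\<bar>"
    using k assms by (intro exI[of _ "min k \<delta>"]) auto
qed (use assms in auto)

lemma has_nabla_const: "t \<in> X \<Longrightarrow> rho X t \<in> X \<Longrightarrow> has_nabla_derivative X X (\<lambda>_. c) 0 t"
  by (auto simp: has_nabla_derivative_def intro: exI[of _ 1])

lemma has_nabla_add_mult:
  assumes X: "closed X" and f: "has_nabla_derivative X X f d t" and g: "has_nabla_derivative X X g e t"
  shows "has_nabla_derivative X X (\<lambda>x. k * f x + l * g x) (k * d + l * e) t"
proof -
  have t: "t \<in> X" using has_nabla_in f by blast
  show ?thesis
  proof (cases "rho X t = t")
    case True
    then show ?thesis using f g t X
      by (auto simp: has_nabla_iff intro!: derivative_eq_intros)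
  next
    case False
    have "k * f t + l * g t - (k * f (rho X t) + l * g (rho X t)) = k * (f t - f (rho X t)) + l * (g t - g (rho X t))"
      by (simp add: algebra_simps)
    also have "\<dots> = (k * d + l * e) * (t - rho X t)"
      unfolding has_nabla_jump[OF f] has_nabla_jump[OF g] by (simp add: algebra_simps)
    finally show ?thesis using f g t X False
      by (auto simp: has_nabla_iff intro!: continuous_intros)
  qed
qed

lemma has_nabla_mult:
  assumes X: "closed X" and f: "has_nabla_derivative X X f d t" and g: "has_nabla_derivative X X g e t"
  shows "has_nabla_derivative X X (\<lambda>x. f x * g x) (d * g (rho X t) + f t * e) t"
proof -
  have t: "t \<in> X" using has_nabla_in f by blast
  show ?thesis
  proof (cases "rho X t = t")
    case True
    then show ?thesis using f g t X
      by (auto simp: has_nabla_iff intro!: derivative_eq_intros)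
  next
    case False
    have "f t * g t - f (rho X t) * g (rho X t) = (f t - f (rho X t)) * g (rho X t) + f t * (g t - g (rho X t))"
      by (simp add: algebra_simps)
    also have "\<dots> = (d * g (rho X t) + f t * e) * (t - rho X t)"
      unfolding has_nabla_jump[OF f] has_nabla_jump[OF g] by (simp add: algebra_simps)
    finally show ?thesis using f g t X False
      by (auto simp: has_nabla_iff intro!: continuous_intros)
  qed
qed

subsection \<open>Jump operators of an interval\<close>

text \<open>The last clause tests a lower bound only on points up to b. Since b is itself such a
  point, this already bounds the infimum over T, which makes the jump of T comparable with that of
  an interval.\<close>

lemma sigma_properties:
  assumes T: "closed T" and t: "t \<in> T" "t < b" "b \<in> T"
  shows "sigma T t \<in> T" "t \<le> sigma T t" "sigma T t \<le> b"
    and "\<And>x. x \<in> T \<Longrightarrow> t < x \<Longrightarrow> sigma T t \<le> x"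
    and "\<And>y. (\<And>x. x \<in> T \<Longrightarrow> t < x \<Longrightarrow> x \<le> b \<Longrightarrow> y \<le> x) \<Longrightarrow> y \<le> sigma T t"
proof -
  have eq: "sigma T t = Inf {s\<in>T. t < s}" using t by (auto simp: sigma_def)
  have bdd: "bdd_below {s\<in>T. t < s}" by (auto intro!: bdd_belowI[of _ t])
  show le: "sigma T t \<le> x" if "x \<in> T" "t < x" for x
    unfolding eq using bdd that by (intro cInf_lower) auto
  then show "sigma T t \<le> b" using t by auto
  show "t \<le> sigma T t" unfolding eq using t by (intro cInf_greatest) auto
  have "sigma T t \<in> closure {s\<in>T. t < s}"
    unfolding eq using bdd t by (intro closure_contains_Inf) auto
  also have "\<dots> \<subseteq> T" using T by (intro closure_minimal) auto
  finally show "sigma T t \<in> T" .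
  show "y \<le> sigma T t" if y: "\<And>x. x \<in> T \<Longrightarrow> t < x \<Longrightarrow> x \<le> b \<Longrightarrow> y \<le> x" for y
    unfolding eq
  proof (rule cInf_greatest)
    fix x assume x: "x \<in> {s\<in>T. t < s}"
    show "y \<le> x"
    proof (cases "x \<le> b")
      case True
      then show ?thesis using y x by auto
    next
      case False
      then show ?thesis using y[of b] t by auto
    qed
  qed (use t in auto)
qed

lemma sigma_interval:
  assumes T: "closed T" and X: "X = ts_interval T a b" and t: "t \<in> X" "t < b" "b \<in> T" and D: "D = {x\<in>X. t \<le> x}"
  shows "sigma D t = sigma T t"
proof -
  have tT: "t \<in> T" "a \<le> t" using t X by (auto simp: ts_interval_def)
  note sp = sigma_properties[OF T tT(1) t(2,3)]
  have bD: "b \<in> {s\<in>D. t < s}" using t tT X D by (auto simp: ts_interval_def)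
  have "Inf {s\<in>D. t < s} = sigma T t"
  proof (rule cInf_eq_non_empty)
    show "{s\<in>D. t < s} \<noteq> {}" using bD by blast
    show "sigma T t \<le> x" if "x \<in> {s\<in>D. t < s}" for x
      using that X D by (intro sp(4)) (auto simp: ts_interval_def)
    show "y \<le> sigma T t" if "\<And>x. x \<in> {s\<in>D. t < s} \<Longrightarrow> y \<le> x" for y
      using that tT X D by (intro sp(5)) (auto simp: ts_interval_def)
  qed
  then show ?thesis using bD unfolding sigma_def by auto
qed

lemma sigma_fixed_imp_islimpt:
  assumes T: "closed T" and X: "X = ts_interval T a b" and t: "t \<in> X" "t < b" "b \<in> T" and fix_t: "sigma T t = t"
  shows "t islimpt X"
  unfolding islimpt_approachable
proof (intro allI impI)
  have tT: "t \<in> T" "a \<le> t" using t X by (auto simp: ts_interval_def)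
  fix e :: real assume e: "e > 0"
  show "\<exists>x'\<in>X. x' \<noteq> t \<and> dist x' t < e"
  proof (rule ccontr)
    assume no: "\<not> ?thesis"
    have "t + e \<le> sigma T t"
    proof (rule sigma_properties(5)[OF T tT(1) t(2,3)])
      fix x assume "x \<in> T" "t < x" "x \<le> b"
      then have "x \<in> X" using tT X by (auto simp: ts_interval_def)
      then have "\<not> dist x t < e" using no \<open>t < x\<close> by auto
      then show "t + e \<le> x" using \<open>t < x\<close> by (simp add: dist_real_def)
    qed
    then show False using fix_t e by simp
  qed
qed

lemma kappa_min:
  assumes "m \<in> D" "\<And>t. t \<in> D \<Longrightarrow> m \<le> t"
  shows "kappa D = (if sigma D m > m then D - {m} else D)"
proof -
  have "(\<forall>s\<in>D. t \<le> s) \<longleftrightarrow> t = m" if "t \<in> D" for t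
    using assms that by (auto intro: antisym)
  then show ?thesis by (auto simp: kappa_def)
qed

lemma nabla_differentiable_mono:
  "nabla_differentiable T D n f \<Longrightarrow> m \<le> n \<Longrightarrow> nabla_differentiable T D m f"
  unfolding nabla_differentiable_def using less_le_trans by blast

text \<open>The left endpoint is excluded because \<open>rho X a = a\<close>, whereas the jump of T
  at a may go below a. For t > a the point a keeps \<open>rho X t\<close> at or above a, so whatever
  T has between \<open>rho X t\<close> and t already lies in \<open>X\<close>.\<close>

lemma rho_interval:
  assumes T: "closed T" and X: "X = ts_interval T a b" and "a \<in> T" and t: "t \<in> X" "a < t"
  shows "rho X t = rho T t"
proof (rule antisym)
  have XT: "X \<subseteq> T" and tb: "t \<in> T" "t \<le> b" and aX: "a \<in> X" using assms by (auto simp: X ts_interval_def)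
  have ne: "\<exists>x\<in>X. x < t" using aX t by auto
  have "Sup {x\<in>X. x < t} \<le> rho T t" using ne XT rho_ge[of _ T t] by (intro cSup_least) auto
  then show "rho X t \<le> rho T t" using ne by (simp add: rho_def[of X])
  show "rho T t \<le> rho X t"
  proof (rule ccontr)
    assume lt: "\<not> rho T t \<le> rho X t"
    have aT: "a \<le> rho X t" using rho_ge[OF aX t(2)] .
    show False
    proof (cases "rho T t = t")
      case True
      then obtain z where z: "z \<in> T" "t - (t - rho X t) < z" "z < t"
        using left_dense_approx[OF True assms(3) t(2), of "t - rho X t"] lt by auto
      then have "z \<in> X" using aT tb by (auto simp: X ts_interval_def)
      then show False using rho_ge[of z X t] z by simp
    next
      case False
      then have "rho T t < t" using rho_le[of T t] by simp
      moreover have "rho T t \<in> X" using rho_in[OF T tb(1)] lt aT tb calculation by (auto simp: X ts_interval_def)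
      ultimately show False using rho_ge[of "rho T t" X t] lt by simp
    qed
  qed
qed

subsection \<open>First-order expansion of the Lagrangian\<close>

lemma mean_value_symmetric:
  fixes f f' :: "real \<Rightarrow> real"
  assumes "\<And>x. (f has_field_derivative f' x) (at x)"
  shows "\<exists>\<xi>. \<bar>\<xi> - a\<bar> \<le> \<bar>b - a\<bar> \<and> f b - f a = (b - a) * f' \<xi>"
proof -
  consider "a < b" | "b < a" | "a = b" by linarith
  then show ?thesis
  proof cases
    case 1
    then obtain z where "a < z" "z < b" "f b - f a = (b - a) * f' z"
      using MVT2[of a b f f'] assms by blast
    then show ?thesis by (intro exI[of _ z]) auto
  next
    case 2
    then obtain z where "b < z" "z < a" "f a - f b = (a - b) * f' z"
      using MVT2[of b a f f'] assms by blast
    then show ?thesis by (intro exI[of _ z]) (auto simp: algebra_simps)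
  qed auto
qed

text \<open>The metric on functions weights the coordinate distances by \<open>(1/2) ^ n\<close>,
  and these weights sum to 2.\<close>

lemma dist_fun_le:
  fixes u v :: "nat \<Rightarrow> real"
  assumes "\<And>i. \<bar>u i - v i\<bar> \<le> e"
  shows "dist u v \<le> 2 * e"
proof -
  let ?m = "\<lambda>n. (1/2) ^ n * min (dist (u (from_nat n)) (v (from_nat n))) 1"
  have s: "summable (\<lambda>n. (1/2::real) ^ n)" by (simp add: summable_geometric_iff)
  have "summable ?m"
    by (rule summable_comparison_test'[OF s, of 0]) (auto simp: abs_mult)
  moreover have "summable (\<lambda>n. (1/2) ^ n * e)" using s by (rule summable_mult2)
  ultimately have "dist u v \<le> (\<Sum>n. (1/2) ^ n * e)"
    unfolding dist_fun_def using assms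
    by (intro suminf_le) (auto intro!: mult_left_mono simp: dist_real_def min_le_iff_disj)
  also have "\<dots> = 2 * e" using suminf_mult2[OF s, of e] suminf_geometric[of "1/2::real"] by simp
  finally show ?thesis .
qed

abbreviation (input) jet_space :: "nat \<Rightarrow> (nat \<Rightarrow> real) set" where
  "jet_space r \<equiv> topspace (Euclidean_space (Suc r))"

lemma in_jet_space: "u \<in> jet_space r \<longleftrightarrow> (\<forall>i>r. u i = 0)"
  by (auto simp: topspace_Euclidean_space Suc_le_eq)

lemma compact_jet_box: "compact {u \<in> jet_space r. \<forall>i. \<bar>u i\<bar> \<le> B i}"
proof -
  \<comment> \<open>Coordinates beyond r are pinned to 0; a negative bound there makes the factor,
    and so the box, empty.\<close>
  define S where "S i = (if i \<le> r then {- B i..B i} else if 0 \<le> B i then {0} else {})" for i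
  have "{u \<in> jet_space r. \<forall>i. \<bar>u i\<bar> \<le> B i} = PiE UNIV S"
  proof (intro set_eqI)
    fix u :: "nat \<Rightarrow> real"
    have "(i > r \<longrightarrow> u i = 0) \<and> \<bar>u i\<bar> \<le> B i \<longleftrightarrow> u i \<in> S i" for i by (auto simp: S_def)
    then show "u \<in> {u \<in> jet_space r. \<forall>i. \<bar>u i\<bar> \<le> B i} \<longleftrightarrow> u \<in> PiE UNIV S"
      unfolding in_jet_space PiE_UNIV_domain Pi_iff mem_Collect_eq by blast
  qed
  moreover have "compactin (product_topology (\<lambda>i. euclidean) UNIV) (PiE UNIV S)"
    unfolding compactin_PiE by (auto simp: S_def)
  ultimately show ?thesis by (simp add: euclidean_product_topology)
qed

text \<open>Continuity in t at fixed u is what nabla differentiability in t supplies. Joint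
  continuity of \<open>L\<close> is derived from it together with the partial derivatives.\<close>

locale lagrangian =
  fixes X :: "real set" and r :: nat and L :: "real \<Rightarrow> (nat \<Rightarrow> real) \<Rightarrow> real"
  assumes compact_domain: "compact X"
    and differentiable_u: "\<And>i t u. i \<le> r \<Longrightarrow> t \<in> X \<Longrightarrow> u \<in> jet_space r \<Longrightarrow>
           (\<lambda>x. L t (u(i := x))) differentiable (at (u i))"
    and continuous_partial: "\<And>i. i \<le> r \<Longrightarrow> continuous_on (X \<times> jet_space r) (\<lambda>(t, u). partial_u L i t u)"
    and continuous_t: "\<And>u. u \<in> jet_space r \<Longrightarrow> continuous_on X (\<lambda>t. L t u)"
begin

lemma has_partial:
  assumes "i \<le> r" "t \<in> X" "u \<in> jet_space r"
  shows "((\<lambda>x. L t (u(i := x))) has_field_derivative partial_u L i t (u(i := x0))) (at x0)"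
proof -
  have "u(i := x0) \<in> jet_space r" using assms by (auto simp: in_jet_space)
  from differentiable_u[OF assms(1,2) this]
  have "(\<lambda>x. L t (u(i := x))) differentiable (at x0)" by simp
  then show ?thesis by (simp add: partial_u_def DERIV_deriv_iff_real_differentiable)
qed

text \<open>The coordinates are changed one at a time, each by the mean value theorem, so every
  summand has its own intermediate point.\<close>

lemma telescope:
  assumes t: "t \<in> X" and u: "u \<in> jet_space r" and u': "u' \<in> jet_space r"
  shows "\<exists>\<zeta>. (\<forall>i\<le>r. \<zeta> i \<in> jet_space r \<and> (\<forall>j. \<bar>\<zeta> i j - u j\<bar> \<le> \<bar>u' j - u j\<bar>)) \<and>
    L t u' - L t u = (\<Sum>i\<le>r. (u' i - u i) * partial_u L i t (\<zeta> i))"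
proof -
  define z where "z m = (\<lambda>j. if j < m then u' j else u j)" for m
  have z: "z m \<in> jet_space r" for m using u u' by (auto simp: in_jet_space z_def)
  have z0: "z 0 = u" "z (Suc r) = u'" using u u' by (auto simp: in_jet_space z_def fun_eq_iff)
  have "\<exists>\<zeta>. \<zeta> \<in> jet_space r \<and> (\<forall>j. \<bar>\<zeta> j - u j\<bar> \<le> \<bar>u' j - u j\<bar>) \<and>
      L t (z (Suc i)) - L t (z i) = (u' i - u i) * partial_u L i t \<zeta>" if i: "i \<le> r" for i
  proof -
    obtain \<xi> where \<xi>: "\<bar>\<xi> - u i\<bar> \<le> \<bar>u' i - u i\<bar>"
      "L t ((z i)(i := u' i)) - L t ((z i)(i := u i)) = (u' i - u i) * partial_u L i t ((z i)(i := \<xi>))"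
      using mean_value_symmetric[OF has_partial[OF i t z[of i]], of "u i" "u' i"] by blast
    have "(z i)(i := u' i) = z (Suc i)" "(z i)(i := u i) = z i" by (auto simp: z_def fun_eq_iff)
    with \<xi> show ?thesis using z[of i] i
      by (intro exI[of _ "(z i)(i := \<xi>)"]) (auto simp: in_jet_space z_def)
  qed
  then have "\<forall>i\<in>{..r}. \<exists>\<zeta>. \<zeta> \<in> jet_space r \<and> (\<forall>j. \<bar>\<zeta> j - u j\<bar> \<le> \<bar>u' j - u j\<bar>) \<and>
      L t (z (Suc i)) - L t (z i) = (u' i - u i) * partial_u L i t \<zeta>" by simp
  from bchoice[OF this] obtain \<zeta> where \<zeta>: "\<And>i. i \<le> r \<Longrightarrow>
      \<zeta> i \<in> jet_space r \<and> (\<forall>j. \<bar>\<zeta> i j - u j\<bar> \<le> \<bar>u' j - u j\<bar>) \<and>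
      L t (z (Suc i)) - L t (z i) = (u' i - u i) * partial_u L i t (\<zeta> i)" by blast
  have "L t u' - L t u = (\<Sum>i<Suc r. L t (z (Suc i)) - L t (z i))"
    using sum_lessThan_telescope[of "\<lambda>i. L t (z i)" "Suc r"] by (simp only: z0)
  also have "\<dots> = (\<Sum>i\<le>r. (u' i - u i) * partial_u L i t (\<zeta> i))"
    using \<zeta> by (auto simp: lessThan_Suc_atMost intro!: sum.cong)
  finally show ?thesis using \<zeta> by blast
qed

lemma partial_bounded:
  "\<exists>M>0. \<forall>i\<le>r. \<forall>t\<in>X. \<forall>u\<in>jet_space r. (\<forall>j. \<bar>u j\<bar> \<le> B j) \<longrightarrow> \<bar>partial_u L i t u\<bar> \<le> M"
proof -
  let ?K = "{u \<in> jet_space r. \<forall>j. \<bar>u j\<bar> \<le> B j}"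
  have "\<exists>M. \<forall>t\<in>X. \<forall>u\<in>?K. \<bar>partial_u L i t u\<bar> \<le> M" if "i \<le> r" for i
  proof -
    have "continuous_on (X \<times> ?K) (\<lambda>(t, u). partial_u L i t u)"
      by (rule continuous_on_subset[OF continuous_partial[OF that]]) auto
    then have "bounded ((\<lambda>(t, u). partial_u L i t u) ` (X \<times> ?K))"
      by (intro compact_imp_bounded compact_continuous_image compact_Times compact_domain compact_jet_box)
    then obtain M where "\<forall>p\<in>X \<times> ?K. norm (case p of (t, u) \<Rightarrow> partial_u L i t u) \<le> M"
      unfolding bounded_iff ball_simps by blast
    then show ?thesis by (intro exI[of _ M]) auto
  qed
  then have "\<forall>i\<in>{..r}. \<exists>M. \<forall>t\<in>X. \<forall>u\<in>?K. \<bar>partial_u L i t u\<bar> \<le> M" by simp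
  from bchoice[OF this] obtain M where M: "\<forall>i\<in>{..r}. \<forall>t\<in>X. \<forall>u\<in>?K. \<bar>partial_u L i t u\<bar> \<le> M i" by blast
  have "\<bar>partial_u L i t u\<bar> \<le> (\<Sum>i\<le>r. \<bar>M i\<bar>) + 1" if "i \<le> r" "t \<in> X" "u \<in> ?K" for i t u
  proof -
    have "\<bar>M i\<bar> \<le> (\<Sum>i\<le>r. \<bar>M i\<bar>)" using that by (intro member_le_sum) auto
    moreover have "\<bar>partial_u L i t u\<bar> \<le> M i" using M that by blast
    ultimately show ?thesis by linarith
  qed
  moreover have "(\<Sum>i\<le>r. \<bar>M i\<bar>) + 1 > 0" by (intro add_nonneg_pos sum_nonneg) auto
  ultimately show ?thesis by (intro exI[of _ "(\<Sum>i\<le>r. \<bar>M i\<bar>) + 1"]) auto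
qed

text \<open>The change of u at fixed t is controlled, uniformly in t, by bounded partial
  derivatives; the change of t takes place at the fixed argument u0.\<close>

lemma continuous_lagrangian: "continuous_on (X \<times> jet_space r) (\<lambda>(t, u). L t u)"
  unfolding continuous_on_def
proof
  fix p0 assume p0: "p0 \<in> X \<times> jet_space r"
  obtain t0 u0 where p0': "p0 = (t0, u0)" by (cases p0)
  have t0: "t0 \<in> X" "u0 \<in> jet_space r" using p0 p0' by auto
  let ?F = "at p0 within X \<times> jet_space r"
  obtain M where M: "M > 0" "\<And>i t u. i \<le> r \<Longrightarrow> t \<in> X \<Longrightarrow> u \<in> jet_space r \<Longrightarrow> (\<forall>j. \<bar>u j\<bar> \<le> \<bar>u0 j\<bar> + 1)
      \<Longrightarrow> \<bar>partial_u L i t u\<bar> \<le> M"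
    using partial_bounded[of "\<lambda>j. \<bar>u0 j\<bar> + 1"] by blast
  have "continuous_on (X \<times> jet_space r) (\<lambda>p. snd p i)" for i
    by (rule continuous_on_product_then_coordinatewise[OF continuous_on_snd[OF continuous_on_id]])
  then have co: "((\<lambda>p. snd p i) \<longlongrightarrow> u0 i) ?F" for i
    using p0 p0' unfolding continuous_on_def by force
  have co': "((\<lambda>p. \<bar>snd p i - u0 i\<bar>) \<longlongrightarrow> 0) ?F" for i
    using tendsto_rabs[OF tendsto_diff[OF co[of i] tendsto_const[of "u0 i"]]] by simp
  have "\<forall>\<^sub>F p in ?F. \<forall>i\<in>{..r}. \<bar>snd p i - u0 i\<bar> < 1"
    using co' by (intro eventually_ball_finite ballI order_tendstoD(2)[OF co']) auto
  moreover have "\<forall>\<^sub>F p in ?F. p \<in> X \<times> jet_space r" by (auto simp: eventually_at_filter)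
  ultimately have "\<forall>\<^sub>F p in ?F. norm (L (fst p) (snd p) - L (fst p) u0) \<le> (\<Sum>i\<le>r. \<bar>snd p i - u0 i\<bar> * M)"
  proof eventually_elim
    case (elim p)
    obtain t u where p: "p = (t, u)" "t \<in> X" "u \<in> jet_space r" using elim by auto
    have near: "\<bar>u j - u0 j\<bar> \<le> 1" for j
      using elim p t0 by (cases "j \<le> r") (auto simp: in_jet_space intro: less_imp_le)
    obtain \<zeta> where \<zeta>: "\<And>i. i \<le> r \<Longrightarrow> \<zeta> i \<in> jet_space r \<and> (\<forall>j. \<bar>\<zeta> i j - u0 j\<bar> \<le> \<bar>u j - u0 j\<bar>)"
      "L t u - L t u0 = (\<Sum>i\<le>r. (u i - u0 i) * partial_u L i t (\<zeta> i))"
      using telescope[OF p(2) t0(2) p(3)] by blast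
    have "\<bar>\<zeta> i j\<bar> \<le> \<bar>u0 j\<bar> + 1" if "i \<le> r" for i j
      using \<zeta>(1)[OF that, THEN conjunct2, rule_format, of j] near[of j] by linarith
    then have "\<bar>(u i - u0 i) * partial_u L i t (\<zeta> i)\<bar> \<le> \<bar>u i - u0 i\<bar> * M" if "i \<le> r" for i
      unfolding abs_mult using that \<zeta>(1) p by (intro mult_left_mono M) auto
    then have "\<bar>L t u - L t u0\<bar> \<le> (\<Sum>i\<le>r. \<bar>u i - u0 i\<bar> * M)"
      unfolding \<zeta>(2) by (intro order_trans[OF sum_abs] sum_mono) auto
    then show ?case using p by simp
  qed
  moreover have "((\<lambda>p. \<Sum>i\<le>r. \<bar>snd p i - u0 i\<bar> * M) \<longlongrightarrow> 0) ?F"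
  proof (rule tendsto_eq_rhs)
    show "((\<lambda>p. \<Sum>i\<le>r. \<bar>snd p i - u0 i\<bar> * M) \<longlongrightarrow> (\<Sum>i\<le>r. 0 * M)) ?F"
      by (rule tendsto_sum, rule tendsto_mult[OF co' tendsto_const])
  qed simp
  ultimately have 1: "((\<lambda>p. L (fst p) (snd p) - L (fst p) u0) \<longlongrightarrow> 0) ?F"
    by (rule Lim_null_comparison)
  have "continuous_on (X \<times> jet_space r) (\<lambda>p. L (fst p) u0)"
    by (rule continuous_on_compose2[OF continuous_t[OF t0(2)] continuous_on_fst[OF continuous_on_id]]) auto
  then have 2: "((\<lambda>p. L (fst p) u0) \<longlongrightarrow> L t0 u0) ?F"
    using p0 p0' unfolding continuous_on_def by force
  show "((\<lambda>(t, u). L t u) \<longlongrightarrow> (case p0 of (t, u) \<Rightarrow> L t u)) ?F"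
    using tendsto_add[OF 1 2] p0' by (simp add: case_prod_unfold)
qed

lemma partial_equicontinuous:
  assumes "e > 0"
  shows "\<exists>\<delta>>0. \<forall>i\<le>r. \<forall>t\<in>X. \<forall>u\<in>jet_space r. \<forall>u'\<in>jet_space r.
    (\<forall>j. \<bar>u j\<bar> \<le> B) \<longrightarrow> (\<forall>j. \<bar>u' j\<bar> \<le> B) \<longrightarrow> (\<forall>j. \<bar>u' j - u j\<bar> \<le> \<delta>) \<longrightarrow> \<bar>partial_u L i t u' - partial_u L i t u\<bar> \<le> e"
proof -
  let ?K = "{u \<in> jet_space r. \<forall>j. \<bar>u j\<bar> \<le> B}"
  let ?P = "\<lambda>i \<delta>. \<forall>t\<in>X. \<forall>u\<in>?K. \<forall>u'\<in>?K. (\<forall>j. \<bar>u' j - u j\<bar> \<le> \<delta>) \<longrightarrow> \<bar>partial_u L i t u' - partial_u L i t u\<bar> \<le> e"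
  have "\<forall>\<^sub>F \<delta> in at_right 0. \<forall>i\<in>{..r}. ?P i \<delta>"
  proof (rule eventually_ball_finite[OF finite_atMost], rule ballI)
    fix i assume "i \<in> {..r}"
    then have "continuous_on (X \<times> ?K) (\<lambda>(t, u). partial_u L i t u)"
      by (intro continuous_on_subset[OF continuous_partial[of i]]) auto
    then have "uniformly_continuous_on (X \<times> ?K) (\<lambda>(t, u). partial_u L i t u)"
      by (intro compact_uniformly_continuous compact_Times compact_domain compact_jet_box)
    then obtain d where d: "d > 0" "\<And>p p'. p \<in> X \<times> ?K \<Longrightarrow> p' \<in> X \<times> ?K \<Longrightarrow> dist p' p < d \<Longrightarrow>
        dist (case p' of (t, u) \<Rightarrow> partial_u L i t u) (case p of (t, u) \<Rightarrow> partial_u L i t u) < e"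
      using assms unfolding uniformly_continuous_on_def by meson
    \<comment> \<open>The factor 1/2 compensates the factor 2 of \<open>dist_fun_le\<close>.\<close>
    have "?P i \<delta>" if \<delta>: "\<delta> > 0" "\<delta> < d / 2" for \<delta>
    proof (intro ballI impI)
      fix t u u' assume a: "t \<in> X" "u \<in> ?K" "u' \<in> ?K" "\<forall>j. \<bar>u' j - u j\<bar> \<le> \<delta>"
      have "dist (t, u') (t, u) < d"
        using dist_fun_le[of u' u \<delta>] a \<delta> by (simp add: dist_Pair_Pair)
      then show "\<bar>partial_u L i t u' - partial_u L i t u\<bar> \<le> e"
        using d(2)[of "(t, u)" "(t, u')"] a by (simp add: dist_real_def)
    qed
    then show "eventually (?P i) (at_right 0)"
      unfolding eventually_at_right_field using d(1) by (intro exI[of _ "d / 2"]) auto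
  qed
  then obtain c where c: "c > 0" "\<And>\<delta>. 0 < \<delta> \<Longrightarrow> \<delta> < c \<Longrightarrow> \<forall>i\<in>{..r}. ?P i \<delta>"
    unfolding eventually_at_right_field by blast
  show ?thesis using c(1) c(2)[of "c / 2"] by (intro exI[of _ "c / 2"]) auto
qed

text \<open>Uniformity in t is what permits integrating the expansion. The intermediate points of
  \<open>telescope\<close> lie within \<open>\<bar>h\<bar> * B\<close> of \<open>u t\<close>, where
  the partial derivatives hardly vary.\<close>

lemma first_order_expansion:
  assumes S: "S \<subseteq> X" and u: "\<And>t. t \<in> S \<Longrightarrow> u t \<in> jet_space r" and v: "\<And>t. t \<in> S \<Longrightarrow> v t \<in> jet_space r"
    and bu: "\<And>t j. t \<in> S \<Longrightarrow> \<bar>u t j\<bar> \<le> B" and bv: "\<And>t j. t \<in> S \<Longrightarrow> \<bar>v t j\<bar> \<le> B"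
    and B: "B > 0" and e: "e > 0"
  shows "\<exists>\<delta>>0. \<forall>h. \<bar>h\<bar> < \<delta> \<longrightarrow> (\<forall>t\<in>S.
    \<bar>L t (\<lambda>i. u t i + h * v t i) - L t (u t) - h * (\<Sum>i\<le>r. v t i * partial_u L i t (u t))\<bar> \<le> e * \<bar>h\<bar>)"
proof -
  \<comment> \<open>There are r + 1 summands, each of size at most
    \<open>\<bar>h\<bar> * B * e'\<close>.\<close>
  define e' where "e' = e / (B * (real r + 1))"
  have e': "e' > 0" using e B by (simp add: e'_def)
  obtain d where d: "d > 0" "\<And>i t u u'. i \<le> r \<Longrightarrow> t \<in> X \<Longrightarrow> u \<in> jet_space r \<Longrightarrow> u' \<in> jet_space r \<Longrightarrow>
      (\<forall>j. \<bar>u j\<bar> \<le> 2 * B) \<Longrightarrow> (\<forall>j. \<bar>u' j\<bar> \<le> 2 * B) \<Longrightarrow> (\<forall>j. \<bar>u' j - u j\<bar> \<le> d) \<Longrightarrow>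
      \<bar>partial_u L i t u' - partial_u L i t u\<bar> \<le> e'"
    using partial_equicontinuous[OF e', of "2 * B"] by blast
  show ?thesis
  \<comment> \<open>The bound 1 keeps the intermediate points in the box of radius 2 B, and d / B
    keeps them within d of \<open>u t\<close>.\<close>
  proof (intro exI[of _ "min 1 (d / B)"] conjI allI impI ballI)
    show "0 < min 1 (d / B)" using d B by simp
    fix h t assume h: "\<bar>h\<bar> < min 1 (d / B)" and t: "t \<in> S"
    let ?w = "\<lambda>i. u t i + h * v t i"
    have tX: "t \<in> X" using S t by auto
    have w: "?w \<in> jet_space r" using u[OF t] v[OF t] by (auto simp: in_jet_space)
    obtain \<zeta> where \<zeta>: "\<And>i. i \<le> r \<Longrightarrow> \<zeta> i \<in> jet_space r \<and> (\<forall>j. \<bar>\<zeta> i j - u t j\<bar> \<le> \<bar>?w j - u t j\<bar>)"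
      "L t ?w - L t (u t) = (\<Sum>i\<le>r. (?w i - u t i) * partial_u L i t (\<zeta> i))"
      using telescope[OF tX u[OF t] w] by blast
    have hv: "\<bar>?w j - u t j\<bar> \<le> \<bar>h\<bar> * B" for j
      using bv[OF t, of j] by (simp add: abs_mult mult_left_mono)
    have hB: "\<bar>h\<bar> * B \<le> B" "\<bar>h\<bar> * B \<le> d" using h B by (auto simp: field_simps)
    have p: "\<bar>partial_u L i t (\<zeta> i) - partial_u L i t (u t)\<bar> \<le> e'" if i: "i \<le> r" for i
    proof (rule d(2)[OF i tX u[OF t]])
      have z: "\<bar>\<zeta> i j - u t j\<bar> \<le> \<bar>h\<bar> * B" for j using \<zeta>(1)[OF i] hv[of j] order_trans by blast
      show "\<forall>j. \<bar>\<zeta> i j - u t j\<bar> \<le> d" using z hB order_trans by blast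
      show "\<forall>j. \<bar>\<zeta> i j\<bar> \<le> 2 * B"
      proof
        fix j show "\<bar>\<zeta> i j\<bar> \<le> 2 * B" using z[of j] hB bu[OF t, of j] by linarith
      qed
      show "\<forall>j. \<bar>u t j\<bar> \<le> 2 * B"
      proof
        fix j show "\<bar>u t j\<bar> \<le> 2 * B" using bu[OF t, of j] B by linarith
      qed
    qed (use \<zeta>(1)[OF i] in auto)
    have "L t ?w - L t (u t) - h * (\<Sum>i\<le>r. v t i * partial_u L i t (u t))
        = (\<Sum>i\<le>r. h * v t i * (partial_u L i t (\<zeta> i) - partial_u L i t (u t)))"
      unfolding \<zeta>(2) by (simp add: sum_distrib_left sum_subtractf[symmetric] algebra_simps)
    also have "\<bar>\<dots>\<bar> \<le> (\<Sum>i\<le>r. \<bar>h\<bar> * B * e')"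
    proof (intro order_trans[OF sum_abs] sum_mono)
      fix i assume "i \<in> {..r}"
      then show "\<bar>h * v t i * (partial_u L i t (\<zeta> i) - partial_u L i t (u t))\<bar> \<le> \<bar>h\<bar> * B * e'"
        unfolding abs_mult using bv[OF t, of i] p[of i] B by (intro mult_mono) auto
    qed
    also have "\<dots> = (B * (real r + 1) * e') * \<bar>h\<bar>" by (simp add: algebra_simps)
    also have "B * (real r + 1) * e' = e"
    proof -
      have "B * (real r + 1) \<noteq> 0" using B by simp
      then show ?thesis unfolding e'_def by (rule nonzero_mult_div_cancel_left[of _ e, unfolded times_divide_eq_right[symmetric]])
    qed
    finally show "\<bar>L t ?w - L t (u t) - h * (\<Sum>i\<le>r. v t i * partial_u L i t (u t))\<bar> \<le> e * \<bar>h\<bar>" .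
  qed
qed

end

subsection \<open>Linear functionals\<close>

text \<open>Induction on n: an element e killed by all functionals but the last fixes the last
  coefficient as \<open>f e / l n e\<close>; if there is none, the last functional vanishes wherever
  the others do. \<open>W\<close> with \<open>comb\<close> replaces a vector space type, since it
  will be the set of towers of functions.\<close>

lemma linear_functional_span:
  fixes comb :: "'a \<Rightarrow> real \<Rightarrow> 'a \<Rightarrow> 'a" and l :: "nat \<Rightarrow> 'a \<Rightarrow> real" and f :: "'a \<Rightarrow> real"
  assumes W: "\<And>x y c. x \<in> W \<Longrightarrow> y \<in> W \<Longrightarrow> comb x c y \<in> W"
    and l: "\<And>i x y c. i < n \<Longrightarrow> x \<in> W \<Longrightarrow> y \<in> W \<Longrightarrow> l i (comb x c y) = l i x + c * l i y"
    and f: "\<And>x y c. x \<in> W \<Longrightarrow> y \<in> W \<Longrightarrow> f (comb x c y) = f x + c * f y"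
    and z: "\<And>x. x \<in> W \<Longrightarrow> (\<And>i. i < n \<Longrightarrow> l i x = 0) \<Longrightarrow> f x = 0"
  shows "\<exists>c. \<forall>x\<in>W. f x = (\<Sum>i<n. c i * l i x)"
  using l f z
proof (induction n arbitrary: f)
  case 0
  then show ?case by auto
next
  case (Suc n)
  have ex: "\<exists>\<gamma>. \<forall>x\<in>W. (\<forall>i<n. l i x = 0) \<longrightarrow> f x - \<gamma> * l n x = 0"
  proof (cases "\<exists>e\<in>W. (\<forall>i<n. l i e = 0) \<and> l n e \<noteq> 0")
    case True
    then obtain e where e: "e \<in> W" "\<forall>i<n. l i e = 0" "l n e \<noteq> 0" by blast
    have "f x - f e / l n e * l n x = 0" if x: "x \<in> W" "\<forall>i<n. l i x = 0" for x
    proof -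
      define y where "y = comb x (- (l n x / l n e)) e"
      have "y \<in> W" using W x e by (simp add: y_def)
      moreover have "l i y = 0" if "i < Suc n" for i
      proof -
        have "l i y = l i x + - (l n x / l n e) * l i e"
          unfolding y_def using Suc.prems(1) x e that by blast
        then show ?thesis using that x e by (cases "i = n") auto
      qed
      ultimately have "f y = 0" using Suc.prems(3) by blast
      moreover have "f y = f x + - (l n x / l n e) * f e"
        unfolding y_def using Suc.prems(2) x e by blast
      ultimately show ?thesis by (simp add: field_simps)
    qed
    then show ?thesis by blast
  next
    case False
    then have "f x = 0" if "x \<in> W" "\<forall>i<n. l i x = 0" for x
      using that by (intro Suc.prems(3)) (auto simp: less_Suc_eq)
    then show ?thesis by (intro exI[of _ 0]) auto
  qed
  then obtain \<gamma> where \<gamma>: "\<And>x. x \<in> W \<Longrightarrow> (\<forall>i<n. l i x = 0) \<Longrightarrow> f x - \<gamma> * l n x = 0" by blast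
  have "\<exists>c. \<forall>x\<in>W. f x - \<gamma> * l n x = (\<Sum>i<n. c i * l i x)"
  proof (rule Suc.IH)
    fix x y c assume xy: "x \<in> W" "y \<in> W"
    show "f (comb x c y) - \<gamma> * l n (comb x c y) = f x - \<gamma> * l n x + c * (f y - \<gamma> * l n y)"
      using Suc.prems(1)[OF _ xy, of n] Suc.prems(2)[OF xy] by (simp add: algebra_simps)
  qed (use Suc.prems(1) \<gamma> in auto)
  then obtain c where "\<forall>x\<in>W. f x - \<gamma> * l n x = (\<Sum>i<n. c i * l i x)" by blast
  then have "\<forall>x\<in>W. f x = (\<Sum>i<Suc n. (c(n := \<gamma>)) i * l i x)" by (auto simp: algebra_simps)
  then show ?case by blast
qed

subsection \<open>The nabla integral on a chain of shrinking domains\<close>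

text \<open>\<open>s k\<close> models \<sigma>^k(a), and the final segment above it models the k-th
  iterate of \<open>kappa\<close>. A step either drops exactly one point or stalls,
  \<open>s k = s (Suc k)\<close>; stalling is permitted only at a minimum of \<open>X\<close> that
  is a limit point.\<close>

locale nabla_chain =
  fixes X :: "real set" and s :: "nat \<Rightarrow> real" and b :: real and N :: nat
  assumes compact: "compact X" and b_in: "b \<in> X" and b_max: "\<And>t. t \<in> X \<Longrightarrow> t \<le> b"
    and s_in: "\<And>k. k \<le> N \<Longrightarrow> s k \<in> X"
    and s_mono: "\<And>k. k < N \<Longrightarrow> s k \<le> s (Suc k)"
    and s_step: "\<And>k t. k < N \<Longrightarrow> t \<in> X \<Longrightarrow> s k < t \<Longrightarrow> s (Suc k) \<le> t"
    and s_dense: "\<And>k. k < N \<Longrightarrow> s k = s (Suc k) \<Longrightarrow> (\<forall>t\<in>X. s k \<le> t) \<and> s k islimpt X"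
begin

definition D :: "nat \<Rightarrow> real set" where "D k = {t\<in>X. s k \<le> t}"

abbreviation nd :: "(real \<Rightarrow> real) \<Rightarrow> real \<Rightarrow> real \<Rightarrow> bool" where
  "nd \<equiv> has_nabla_derivative X X"

lemma closed: "closed X"
  using compact by (rule compact_imp_closed)

lemma D_subset: "D k \<subseteq> X"
  by (auto simp: D_def)

lemma D_Suc_subset: "k < N \<Longrightarrow> D (Suc k) \<subseteq> D k"
  using s_mono by (fastforce simp: D_def)

lemma D_antimono: "i \<le> k \<Longrightarrow> k \<le> N \<Longrightarrow> D k \<subseteq> D i"
proof (induction k rule: dec_induct)
  case (step n)
  then show ?case using D_Suc_subset[of n] by auto
qed auto

lemma compact_D: "compact (D k)"
proof -
  have "D k = X \<inter> {s k..}" by (auto simp: D_def)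
  then show ?thesis using compact compact_Int_closed by auto
qed

lemma b_in_D: "k \<le> N \<Longrightarrow> b \<in> D k"
  using b_in b_max s_in by (auto simp: D_def)

lemma s_in_D: "k \<le> N \<Longrightarrow> s k \<in> D k"
  using s_in by (auto simp: D_def)

lemma D_bottom:
  assumes "k < N" "t \<in> D k" "t \<notin> D (Suc k)"
  shows "t = s k" "s k < s (Suc k)"
  using assms s_step[of k t] s_mono[of k] by (force simp: D_def)+

lemma rho_in_X: "t \<in> X \<Longrightarrow> rho X t \<in> X"
  using rho_in closed by auto

text \<open>If the step is strict, t lies beyond \<open>s k\<close>, a point of \<open>X\<close>
  that the jump cannot pass; if it stalls, \<open>s k\<close> is the minimum of
  \<open>X\<close>.\<close>

lemma rho_D:
  assumes "k < N" "t \<in> D (Suc k)" shows "rho X t \<in> D k"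
proof (cases "s k = s (Suc k)")
  case True
  then show ?thesis using s_dense[OF assms(1)] assms rho_in_X by (auto simp: D_def)
next
  case False
  then have "s k < t" using s_mono[OF assms(1)] assms by (auto simp: D_def)
  then have "s k \<le> rho X t" using s_in assms(1) by (intro rho_ge) auto
  then show ?thesis using assms rho_in_X by (auto simp: D_def)
qed

lemma rho_pow_D: "k + j \<le> N \<Longrightarrow> t \<in> D (k + j) \<Longrightarrow> (rho X ^^ j) t \<in> D k"
proof (induction j arbitrary: k)
  case (Suc j)
  have "(rho X ^^ j) t \<in> D (Suc k)" using Suc.IH[of "Suc k"] Suc.prems by simp
  then show ?case using rho_D[of k] Suc.prems by auto
qed auto

text \<open>This makes derivatives relative to \<open>D k\<close> and to \<open>X\<close> agree on
  \<open>D (Suc k)\<close>, so that \<open>nd\<close>, with its fixed domain \<open>X\<close>, can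
  be used throughout.\<close>

lemma D_nhd:
  assumes "k < N" "t \<in> D (Suc k)"
  shows "\<exists>\<delta>>0. \<forall>x\<in>X. \<bar>x - t\<bar> < \<delta> \<longrightarrow> x \<in> D k"
proof (cases "s k = s (Suc k)")
  case True
  then show ?thesis using s_dense[OF assms(1)] by (auto simp: D_def intro!: exI[of _ 1])
next
  case False
  then have "s k < t" using s_mono[OF assms(1)] assms by (auto simp: D_def)
  then show ?thesis by (auto simp: D_def intro!: exI[of _ "t - s k"])
qed

lemma at_within_D:
  assumes "k < N" "t \<in> D (Suc k)"
  shows "at t within D k = at t within X"
proof -
  obtain \<delta> where "\<delta> > 0" "\<forall>x\<in>X. \<bar>x - t\<bar> < \<delta> \<longrightarrow> x \<in> D k" using D_nhd[OF assms] by auto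
  then show ?thesis using D_subset
    by (intro at_within_nhd[of t "ball t \<delta>"]) (auto simp: dist_real_def abs_minus_commute)
qed

text \<open>A point with \<open>rho X t = t\<close> is approached from the left or is the minimum of
  \<open>X\<close>; in the latter case t = \<open>s k\<close> = \<open>s (Suc k)\<close> and
  \<open>s_dense\<close> applies. Uniqueness of derivatives on \<open>D (Suc k)\<close> rests on
  this.\<close>

lemma left_dense_limpt:
  assumes "k < N" "t \<in> D (Suc k)" "rho X t = t" shows "t islimpt X"
proof (cases "\<exists>x\<in>X. x < t")
  case True
  then obtain x where x: "x \<in> X" "x < t" by auto
  show ?thesis
    unfolding islimpt_approachable
  proof (intro allI impI)
    fix e :: real assume "e > 0"
    then obtain z where "z \<in> X" "t - e < z" "z < t" using left_dense_approx[OF assms(3) x] by blast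
    then show "\<exists>x'\<in>X. x' \<noteq> t \<and> dist x' t < e" by (intro bexI[of _ z]) (auto simp: dist_real_def)
  qed
next
  case False
  then have "t \<le> s k" "s k \<le> t" using s_in[of k] assms D_Suc_subset[of k] by (force simp: D_def)+
  then have "s k = s (Suc k)" "t = s k" using assms s_mono[of k] by (auto simp: D_def)
  then show ?thesis using s_dense assms by auto
qed

lemma nd_unique:
  assumes "k < N" "t \<in> D (Suc k)" "nd f d t" "nd f d' t" shows "d = d'"
  using has_nabla_unique[OF assms(3,4)] left_dense_limpt assms by blast

lemma nd_cong:
  assumes "k < N" "t \<in> D (Suc k)" "\<And>x. x \<in> D k \<Longrightarrow> f x = g x" "nd f d t"
  shows "nd g d t"
proof -
  obtain \<delta> where \<delta>: "\<delta> > 0" "\<forall>x\<in>X. \<bar>x - t\<bar> < \<delta> \<longrightarrow> x \<in> D k" using D_nhd[OF assms(1,2)] by auto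
  show ?thesis
    using \<delta> assms rho_D[OF assms(1,2)] has_nabla_in[OF assms(4)]
    by (intro has_nabla_local[OF assms(4), of _ \<delta>]) auto
qed

lemma nd_D_iff:
  assumes "k < N" "t \<in> D (Suc k)"
  shows "has_nabla_derivative X (D k) f d t \<longleftrightarrow> nd f d t"
proof -
  obtain \<delta> where \<delta>: "\<delta> > 0" "\<forall>x\<in>X. \<bar>x - t\<bar> < \<delta> \<longrightarrow> x \<in> D k" using D_nhd[OF assms] by auto
  have "t \<in> D k" "rho X t \<in> D k" using rho_D[OF assms] D_Suc_subset assms by auto
  then show ?thesis
    using has_nabla_local[of X "D k" f d t X \<delta> f] has_nabla_local[of X X f d t "D k" \<delta> f] D_subset \<delta>
    by blast
qed

lemma kappa_D:
  assumes k: "k < N" shows "kappa (D k) = D (Suc k)"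
proof (cases "s k = s (Suc k)")
  case True
  note d = s_dense[OF k True]
  have "sigma (D k) (s k) = s k"
  proof (cases "\<exists>t\<in>D k. s k < t")
    case True
    have "Inf {t \<in> D k. s k < t} \<le> s k"
    proof (rule field_le_epsilon)
      fix e :: real assume "e > 0"
      then obtain t where "t \<in> X" "t \<noteq> s k" "dist t (s k) < e"
        using d unfolding islimpt_approachable by blast
      then have "t \<in> D k" "s k < t" "t < s k + e" using d by (force simp: D_def dist_real_def)+
      then show "Inf {t \<in> D k. s k < t} \<le> s k + e"
        by (intro order_trans[OF cInf_lower[of t]]) (auto intro!: bdd_belowI[of _ "s k"])
    qed
    moreover have "s k \<le> Inf {t \<in> D k. s k < t}" using True by (intro cInf_greatest) auto
    ultimately show ?thesis using True by (simp add: sigma_def)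
  qed (simp add: sigma_def)
  then show ?thesis using s_in_D[of k] k True unfolding kappa_def by (force simp: D_def)
next
  case False
  then have lt: "s k < s (Suc k)" using s_mono k by force
  have "s (Suc k) \<in> D k" using s_in[of "Suc k"] k lt by (auto simp: D_def)
  moreover have "s (Suc k) \<le> Inf {t \<in> D k. s k < t}"
    using s_step[OF k] lt calculation by (intro cInf_greatest) (blast, auto simp: D_def)
  moreover have "\<exists>t\<in>D k. s k < t" using calculation(1) lt by blast
  ultimately have sg: "s k < sigma (D k) (s k)" using lt unfolding sigma_def by simp
  show ?thesis
  proof (intro equalityI subsetI)
    fix t assume t: "t \<in> kappa (D k)"
    then have "t \<noteq> s k" using sg by (auto simp: kappa_def D_def)
    then show "t \<in> D (Suc k)" using t s_step[OF k] by (auto simp: kappa_def D_def)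
  next
    fix t assume t: "t \<in> D (Suc k)"
    then have "s k < t" "t \<in> D k" using lt by (auto simp: D_def)
    then show "t \<in> kappa (D k)" using s_in_D[of k] k by (force simp: kappa_def)
  qed
qed

text \<open>A point of \<open>D k\<close> outside \<open>D (Suc k)\<close> is the bottom point
  \<open>s k\<close>, isolated in \<open>D k\<close>, where continuity is automatic.\<close>

lemma nd_continuous_on:
  assumes k: "k < N" and F: "\<And>t. t \<in> D (Suc k) \<Longrightarrow> nd F (f t) t"
  shows "continuous_on (D k) F"
  unfolding continuous_on_eq_continuous_within
proof
  fix t assume t: "t \<in> D k"
  show "continuous (at t within D k) F"
  proof (cases "t \<in> D (Suc k)")
    case True
    then show ?thesis using has_nabla_continuous[OF F] at_within_D[OF k] by auto
  next
    case False
    note bt = D_bottom[OF k t False]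
    show ?thesis unfolding continuous_within_eps_delta
    proof (intro allI impI exI[of _ "s (Suc k) - s k"] conjI ballI)
      fix e :: real and x assume "0 < e" "x \<in> D k" "dist x t < s (Suc k) - s k"
      then have "x = t" using bt s_step[OF k, of x] by (force simp: D_def dist_real_def)
      then show "dist (F x) (F t) < e" using \<open>0 < e\<close> by simp
    qed (use bt in auto)
  qed
qed

text \<open>Real induction from b downwards: an estimate with slope e is propagated to the left, m
  being the infimum of the points from which on it holds; then e tends to 0.\<close>

lemma nd_zero_imp_const:
  assumes k: "k < N" and F: "\<And>t. t \<in> D (Suc k) \<Longrightarrow> nd F 0 t" and t: "t \<in> D k"
  shows "F t = F b"
proof -
  have le: "\<bar>F b - F t\<bar> \<le> e * (b - t)" if e: "e > 0" for e
  proof -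
    define S where "S = {t \<in> D k. \<forall>z\<in>D k. t \<le> z \<longrightarrow> \<bar>F b - F z\<bar> \<le> e * (b - z)}"
    have bS: "b \<in> S" using b_in_D[of k] k b_max by (force simp: S_def D_def)
    have bdd: "bdd_below S" by (auto intro!: bdd_belowI[of _ "s k"] simp: S_def D_def)
    define m where "m = Inf S"
    have m_le: "m \<le> z" if "z \<in> S" for z unfolding m_def using bdd that by (rule cInf_lower[rotated])
    have near: "\<exists>z\<in>S. z < x" if "m < x" for x
      using that bS cInf_lessD[of S x] unfolding m_def by auto
    have mD: "m \<in> D k"
    proof -
      have "m \<in> closure S" unfolding m_def using bS bdd by (intro closure_contains_Inf) auto
      moreover have "closure S \<subseteq> D k"
        using compact_imp_closed[OF compact_D] by (intro closure_minimal) (auto simp: S_def)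
      ultimately show ?thesis by auto
    qed
    have gt: "\<bar>F b - F z\<bar> \<le> e * (b - z)" if "z \<in> D k" "m < z" for z
      using near[OF that(2)] that(1) by (auto simp: S_def)
    have Pm: "\<bar>F b - F m\<bar> \<le> e * (b - m)"
    proof (rule field_le_epsilon)
      fix e' :: real assume e': "e' > 0"
      have "continuous (at m within D k) F"
        using nd_continuous_on[OF k, of F "\<lambda>_. 0"] F mD by (simp add: continuous_on_eq_continuous_within)
      then obtain \<delta> where \<delta>: "\<delta> > 0" "\<And>x. x \<in> D k \<Longrightarrow> dist x m < \<delta> \<Longrightarrow> dist (F x) (F m) < e'"
        using e' unfolding continuous_within_eps_delta by meson
      obtain z where z: "z \<in> S" "z < m + \<delta>" using near[of "m + \<delta>"] \<delta> by auto
      have "dist z m < \<delta>" using z m_le[of z] by (auto simp: dist_real_def)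
      then have "\<bar>F z - F m\<bar> < e'" using \<delta>(2)[of z] z by (auto simp: S_def dist_real_def)
      moreover have "\<bar>F b - F z\<bar> \<le> e * (b - z)" using z by (auto simp: S_def)
      moreover have "e * (b - z) \<le> e * (b - m)" using e m_le[OF z(1)] by simp
      ultimately show "\<bar>F b - F m\<bar> \<le> e * (b - m) + e'" by linarith
    qed
    have min: "m \<le> z" if z: "z \<in> D k" for z
    \<comment> \<open>If m were not the minimum, the estimate would extend below m: over a whole
      stretch if m is left-dense, by the single point \<open>rho X m\<close> otherwise.\<close>
    proof (rule ccontr)
      assume "\<not> m \<le> z"
      then have zm: "z < m" by simp
      have mS: "m \<in> D (Suc k)" using z zm mD s_step[OF k, of m] by (auto simp: D_def)
      obtain w where w: "w \<in> D k" "w < m" "\<And>q. q \<in> D k \<Longrightarrow> w \<le> q \<Longrightarrow> q < m \<Longrightarrow> \<bar>F m - F q\<bar> \<le> e * (m - q)"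
      proof (cases "rho X m = m")
        case True
        obtain \<delta> where \<delta>: "\<delta> > 0" "\<And>x. x \<in> X \<Longrightarrow> \<bar>x - m\<bar> < \<delta> \<Longrightarrow> \<bar>F m - F x\<bar> \<le> e * \<bar>m - x\<bar>"
          using F[OF mS] e True unfolding has_nabla_derivative_def by auto
        obtain w where w: "w \<in> X" "m - min \<delta> (m - z) < w" "w < m"
          using left_dense_approx[OF True, of z "min \<delta> (m - z)"] z zm \<delta> by (auto simp: D_def)
        show ?thesis
        proof (rule that[of w])
          show "w \<in> D k" using w z by (auto simp: D_def)
          show "w < m" by (rule w)
          fix q assume q: "q \<in> D k" "w \<le> q" "q < m"
          then have "\<bar>F m - F q\<bar> \<le> e * \<bar>m - q\<bar>" using w by (intro \<delta>(2)) (auto simp: D_def)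
          then show "\<bar>F m - F q\<bar> \<le> e * (m - q)" using q by simp
        qed
      next
        case False
        have r: "F m = F (rho X m)" using has_nabla_jump[OF F[OF mS]] by simp
        show ?thesis
        proof (rule that[of "rho X m"])
          show "rho X m \<in> D k" using rho_D[OF k mS] .
          show "rho X m < m" using False rho_le[of X m] by simp
          fix q assume q: "q \<in> D k" "rho X m \<le> q" "q < m"
          then have "q = rho X m" using rho_ge[of q X m] by (auto simp: D_def)
          then show "\<bar>F m - F q\<bar> \<le> e * (m - q)" using r e q by simp
        qed
      qed
      have "w \<in> S"
        unfolding S_def
      proof (intro CollectI conjI ballI impI)
        fix q assume q: "q \<in> D k" "w \<le> q"
        consider "m < q" | "m = q" | "q < m" by linarith
        then show "\<bar>F b - F q\<bar> \<le> e * (b - q)"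
        proof cases
          case 3
          then have "\<bar>F m - F q\<bar> \<le> e * (m - q)" using w q by auto
          moreover have "e * (b - q) = e * (b - m) + e * (m - q)" by (simp add: algebra_simps)
          ultimately show ?thesis using Pm by linarith
        qed (use gt Pm q in auto)
      qed (use w in auto)
      then show False using m_le[of w] w by auto
    qed
    show ?thesis using gt[OF t] Pm min[OF t] by (cases "m = t") auto
  qed
  have "\<bar>F b - F t\<bar> \<le> 0"
  proof (rule field_le_epsilon)
    fix e :: real assume e: "e > 0"
    have tb: "t \<le> b" using t b_max by (auto simp: D_def)
    have "\<bar>F b - F t\<bar> \<le> (e / (b - t + 1)) * (b - t)" using e tb by (intro le) auto
    also have "\<dots> \<le> e" using e tb by (simp add: field_simps)
    finally show "\<bar>F b - F t\<bar> \<le> 0 + e" by simp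
  qed
  then show ?thesis by simp
qed

section \<open>The gap-constant extension to the real line\<close>

definition tau :: "real \<Rightarrow> real" where
  "tau x = (if x \<le> b then Inf {t\<in>X. x \<le> t} else b)"

lemma tau_in: "tau x \<in> X"
proof (cases "x \<le> b")
  case True
  have "Inf {t\<in>X. x \<le> t} \<in> {t\<in>X. x \<le> t}"
  proof (rule closed_contains_Inf)
    have "{t\<in>X. x \<le> t} = X \<inter> {x..}" by auto
    then show "closed {t\<in>X. x \<le> t}" using closed by auto
  qed (use True b_in in \<open>auto intro!: bdd_belowI[of _ x]\<close>)
  then show ?thesis using True by (simp add: tau_def)
qed (simp add: tau_def b_in)

lemma tau_ge: "x \<le> b \<Longrightarrow> x \<le> tau x"
  unfolding tau_def using b_in by (auto intro!: cInf_greatest)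

lemma tau_le: "t \<in> X \<Longrightarrow> x \<le> t \<Longrightarrow> tau x \<le> t"
  unfolding tau_def using b_max[of t] by (auto intro!: cInf_lower bdd_belowI[of _ x])

text \<open>Monotonicity is the source of Borel measurability of the extended integrands; continuing
  \<open>tau\<close> by b to the right of b preserves it on the whole line.\<close>

lemma tau_mono: "mono tau"
proof (rule monoI)
  fix x y :: real assume xy: "x \<le> y"
  show "tau x \<le> tau y"
  proof (cases "y \<le> b")
    case True
    then show ?thesis using tau_le[of "tau y" x] tau_ge[of y] tau_in xy by auto
  next
    case False
    then show ?thesis using b_max tau_in by (simp add: tau_def)
  qed
qed

lemma tau_D: "k < N \<Longrightarrow> s k < x \<Longrightarrow> x \<le> b \<Longrightarrow> tau x \<in> D (Suc k)"
  using tau_ge[of x] tau_in[of x] s_step[of k "tau x"] by (auto simp: D_def)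

lemma tau_gap: "t \<in> X \<Longrightarrow> rho X t < x \<Longrightarrow> x \<le> t \<Longrightarrow> tau x = t"
  using tau_le[of t x] tau_ge[of x] b_max[of t] rho_ge[of "tau x" X t] tau_in[of x] by force

section \<open>Admissible integrands\<close>

definition reg :: "nat \<Rightarrow> (real \<Rightarrow> 'a::topological_space) \<Rightarrow> bool" where
  "reg k f \<longleftrightarrow> (\<exists>\<Phi>. continuous_on (D (Suc k) \<times> D k) \<Phi> \<and> (\<forall>t\<in>D (Suc k). f t = \<Phi> (t, rho X t)))"

lemma reg_cong: "reg k f \<Longrightarrow> (\<And>t. t \<in> D (Suc k) \<Longrightarrow> f t = g t) \<Longrightarrow> reg k g"
  unfolding reg_def by auto

lemma reg_continuous:
  assumes "continuous_on (D (Suc k)) f" shows "reg k f"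
proof -
  have "continuous_on (D (Suc k) \<times> D k) (\<lambda>p. f (fst p))"
    by (rule continuous_on_compose2[OF assms continuous_on_fst[OF continuous_on_id]]) auto
  then show ?thesis unfolding reg_def by (intro exI[of _ "\<lambda>p. f (fst p)"]) simp
qed

lemma reg_rho:
  assumes "continuous_on (D k) f" shows "reg k (\<lambda>t. f (rho X t))"
proof -
  have "continuous_on (D (Suc k) \<times> D k) (\<lambda>p. f (snd p))"
    by (rule continuous_on_compose2[OF assms continuous_on_snd[OF continuous_on_id]]) auto
  then show ?thesis unfolding reg_def by (intro exI[of _ "\<lambda>p. f (snd p)"]) simp
qed

lemma reg_const: "reg k (\<lambda>_. c)"
  by (intro reg_continuous continuous_intros)

lemma reg_mult:
  fixes f g :: "real \<Rightarrow> real"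
  assumes "reg k f" "reg k g" shows "reg k (\<lambda>t. f t * g t)"
proof -
  obtain \<Phi> \<Psi> where "continuous_on (D (Suc k) \<times> D k) \<Phi>" "\<forall>t\<in>D (Suc k). f t = \<Phi> (t, rho X t)"
    "continuous_on (D (Suc k) \<times> D k) \<Psi>" "\<forall>t\<in>D (Suc k). g t = \<Psi> (t, rho X t)"
    using assms unfolding reg_def by blast
  then show ?thesis unfolding reg_def
    by (intro exI[of _ "\<lambda>p. \<Phi> p * \<Psi> p"]) (auto intro!: continuous_intros)
qed

lemma reg_add:
  fixes f g :: "real \<Rightarrow> real"
  assumes "reg k f" "reg k g" shows "reg k (\<lambda>t. f t + g t)"
proof -
  obtain \<Phi> \<Psi> where "continuous_on (D (Suc k) \<times> D k) \<Phi>" "\<forall>t\<in>D (Suc k). f t = \<Phi> (t, rho X t)"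
    "continuous_on (D (Suc k) \<times> D k) \<Psi>" "\<forall>t\<in>D (Suc k). g t = \<Psi> (t, rho X t)"
    using assms unfolding reg_def by blast
  then show ?thesis unfolding reg_def
    by (intro exI[of _ "\<lambda>p. \<Phi> p + \<Psi> p"]) (auto intro!: continuous_intros)
qed

lemma reg_cmult: "reg k f \<Longrightarrow> reg k (\<lambda>t. c * f t)" for f :: "real \<Rightarrow> real"
  by (intro reg_mult reg_const)

lemma reg_diff: "reg k f \<Longrightarrow> reg k g \<Longrightarrow> reg k (\<lambda>t. f t - g t)" for f g :: "real \<Rightarrow> real"
  using reg_add[of k f "\<lambda>t. -1 * g t"] reg_cmult[of k g "-1"] by simp

lemma reg_sum: "(\<And>i. i \<in> I \<Longrightarrow> reg k (f i)) \<Longrightarrow> reg k (\<lambda>t. \<Sum>i\<in>I. f i t)" for f :: "'i \<Rightarrow> real \<Rightarrow> real"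
  by (induction I rule: infinite_finite_induct) (auto intro: reg_add reg_const)

lemma reg_bounded:
  fixes f :: "real \<Rightarrow> real"
  assumes k: "k < N" and "reg k f"
  shows "\<exists>M>0. \<forall>t\<in>D (Suc k). \<bar>f t\<bar> \<le> M"
proof -
  obtain \<Phi> where \<Phi>: "continuous_on (D (Suc k) \<times> D k) \<Phi>" "\<forall>t\<in>D (Suc k). f t = \<Phi> (t, rho X t)"
    using assms unfolding reg_def by blast
  have "bounded (\<Phi> ` (D (Suc k) \<times> D k))"
    using \<Phi>(1) compact_D by (intro compact_imp_bounded compact_continuous_image compact_Times)
  then obtain M where "M > 0" "\<forall>p\<in>D (Suc k) \<times> D k. \<bar>\<Phi> p\<bar> \<le> M"
    unfolding bounded_pos by auto
  then show ?thesis using \<Phi>(2) rho_D[OF k] by (intro exI[of _ M]) auto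
qed

text \<open>At a left-dense point \<open>rho X x\<close> tends to t along with x, so
  \<open>\<Phi> (x, rho X x)\<close> tends to \<open>\<Phi> (t, t)\<close> although the jump may be
  discontinuous elsewhere.\<close>

lemma reg_left_dense:
  assumes k: "k < N" and "reg k f" and t: "t \<in> D (Suc k)" "rho X t = t"
  shows "continuous (at t within D (Suc k)) f"
proof -
  obtain \<Phi> where \<Phi>: "continuous_on (D (Suc k) \<times> D k) \<Phi>" "\<And>t. t\<in>D (Suc k) \<Longrightarrow> f t = \<Phi> (t, rho X t)"
    using assms unfolding reg_def by blast
  have "(rho X \<longlongrightarrow> t) (at t within D (Suc k))"
    using rho_tendsto_left_dense[OF t(2)] t(1) D_subset
    by (intro tendsto_within_subset[OF _ D_subset]) auto
  then have "((\<lambda>x. \<Phi> (x, rho X x)) \<longlongrightarrow> \<Phi> (t, t)) (at t within D (Suc k))"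
    using t D_Suc_subset[OF k] rho_D[OF k]
    by (intro continuous_on_tendsto_compose[OF \<Phi>(1)] tendsto_intros)
      (auto simp: eventually_at_filter)
  then have "(f \<longlongrightarrow> \<Phi> (t, t)) (at t within D (Suc k))"
    by (rule Lim_transform_eventually) (use \<Phi>(2) in \<open>auto simp: eventually_at_filter\<close>)
  then show ?thesis using \<Phi>(2)[OF t(1)] t by (simp add: continuous_within)
qed

lemma reg_integrable:
  fixes f :: "real \<Rightarrow> real"
  assumes k: "k < N" and "reg k f"
  shows "(\<lambda>x. f (tau x)) integrable_on {s k..b}"
proof -
  obtain \<Phi> where \<Phi>: "continuous_on (D (Suc k) \<times> D k) \<Phi>" "\<And>t. t\<in>D (Suc k) \<Longrightarrow> f t = \<Phi> (t, rho X t)"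
    using assms unfolding reg_def by blast
  obtain M where M: "\<And>t. t \<in> D (Suc k) \<Longrightarrow> \<bar>f t\<bar> \<le> M" using reg_bounded[OF assms] by auto
  define K where "K = D (Suc k) \<times> D k"
  have "mono (\<lambda>x. rho X (tau x))"
    using rho_mono tau_in tau_mono by (auto simp: mono_def)
  then have m: "(\<lambda>x. (tau x, rho X (tau x))) \<in> borel \<rightarrow>\<^sub>M (borel :: (real \<times> real) measure)"
    using tau_mono borel_measurable_mono by (intro borel_measurable_Pair) auto
  \<comment> \<open>Cutting off with the indicator of a compact set turns \<Phi> into a Borel
    function on the whole plane.\<close>
  have 1: "(\<lambda>p. indicator K p *\<^sub>R \<Phi> p) \<in> borel_measurable borel"
    using \<Phi>(1) compact_D unfolding K_def
    by (intro borel_measurable_continuous_on_indicator borel_closed compact_imp_closed compact_Times)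
  define g where "g = (\<lambda>x. indicator K (tau x, rho X (tau x)) *\<^sub>R \<Phi> (tau x, rho X (tau x)))"
  have g: "g \<in> borel_measurable borel"
    unfolding g_def using measurable_compose[OF m 1] by simp
  have eq: "g x = f (tau x)" if "x \<in> {s k<..b}" for x
    using that tau_D[OF k, of x] rho_D[OF k] \<Phi>(2) by (auto simp: g_def K_def)
  \<comment> \<open>The endpoint \<open>s k\<close> is left out because
    \<open>tau (s k) = s k\<close> need not lie in \<open>D (Suc k)\<close>, where alone f is
    controlled.\<close>
  have "set_integrable lborel {s k<..b} g"
    unfolding set_integrable_def
  proof (rule integrableI_bounded_set_indicator[where B = M])
    show "AE x in lborel. x \<in> {s k<..b} \<longrightarrow> norm (g x) \<le> M"
      using eq M tau_D[OF k] by auto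
  qed (use g s_in[of k] k b_max in \<open>auto\<close>)
  then have "g integrable_on {s k<..b}" by (rule set_borel_integral_eq_integral)
  then have "(\<lambda>x. f (tau x)) integrable_on {s k<..b}" by (rule iffD1[OF integrable_cong[OF eq], rotated])
  then show ?thesis
    by (rule integrable_spike_set) (auto intro: negligible_subset[of "{s k}"])
qed

section \<open>The canonical antiderivative\<close>

definition J :: "nat \<Rightarrow> (real \<Rightarrow> real) \<Rightarrow> real \<Rightarrow> real" where
  "J k f t = integral {s k..t} (\<lambda>x. f (tau x))"

text \<open>The interval of integration is empty or a point. Iterated integrals therefore vanish on
  everything at or left of \<open>s k\<close>, as the variations have to.\<close>

lemma J_low: "t \<le> s k \<Longrightarrow> J k f t = 0"
  unfolding J_def by (cases "t = s k") auto

lemma reg_integrable_sub: "k < N \<Longrightarrow> reg k f \<Longrightarrow> s k \<le> c \<Longrightarrow> d \<le> b \<Longrightarrow> (\<lambda>x. f (tau x)) integrable_on {c..d}"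
  for f :: "real \<Rightarrow> real"
  by (rule integrable_on_subinterval[OF reg_integrable]) auto

lemma J_combine:
  assumes "k < N" "reg k f" "s k \<le> c" "c \<le> d" "d \<le> b"
  shows "J k f d = J k f c + integral {c..d} (\<lambda>x. f (tau x))"
  unfolding J_def using assms reg_integrable_sub[OF assms(1,2)] by (subst Henstock_Kurzweil_Integration.integral_combine) auto

text \<open>Used with B = 0 to evaluate integrals across a gap or where the integrand vanishes, and
  with small B for derivatives. The left end is exempt because \<open>tau c = c\<close> for c in
  \<open>X\<close>, so the value there belongs to the preceding piece.\<close>

lemma J_estimate:
  assumes "k < N" "reg k f" "s k \<le> c" "c \<le> d" "d \<le> b" "B \<ge> 0"
    and "\<And>x. c < x \<Longrightarrow> x \<le> d \<Longrightarrow> \<bar>f (tau x) - v\<bar> \<le> B"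
  shows "\<bar>J k f d - J k f c - v * (d - c)\<bar> \<le> B * (d - c)"
proof -
  have "((\<lambda>x. f (tau x)) has_integral (J k f d - J k f c)) {c..d}"
    using J_combine[OF assms(1-5)] reg_integrable_sub[OF assms(1-3,5)] by (simp add: integrable_integral)
  moreover have "((\<lambda>x. v) has_integral v * (d - c)) {c..d}"
    using has_integral_const_real[of v c d] assms by (simp add: mult.commute)
  ultimately have "((\<lambda>x. f (tau x) - v) has_integral (J k f d - J k f c - v * (d - c))) {c..d}"
    by (rule has_integral_diff)
  from has_integral_bound_real[OF assms(6) _ this, of "{c}"] assms show ?thesis by auto
qed

lemma J_nabla:
  assumes k: "k < N" and f: "reg k f" and t: "t \<in> D (Suc k)"
  shows "nd (J k f) (f t) t"
proof -
  have tX: "t \<in> X" "t \<in> D k" "s k \<le> t" "t \<le> b" using t D_Suc_subset[OF k] b_max by (auto simp: D_def)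
  obtain M where M: "M > 0" "\<And>t. t \<in> D (Suc k) \<Longrightarrow> \<bar>f t\<bar> \<le> M" using reg_bounded[OF k f] by auto
  have lip: "\<bar>J k f d - J k f c\<bar> \<le> M * (d - c)" if "s k \<le> c" "c \<le> d" "d \<le> b" for c d
    using J_estimate[OF k f that, of M 0] M tau_D[OF k] that by auto
  have lip': "\<bar>J k f d - J k f c\<bar> \<le> M * \<bar>d - c\<bar>" if "c \<in> D k" "d \<in> D k" for c d
    using lip[of c d] lip[of d c] that b_max by (cases "c \<le> d") (auto simp: D_def abs_minus_commute)
  show ?thesis
  proof (cases "rho X t = t")
    case False
    have lt: "rho X t < t" using False rho_le[of X t] by simp
    have "continuous (at t within D k) (J k f)"
      unfolding continuous_within_eps_delta
    proof (intro allI impI)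
      fix e :: real assume e: "e > 0"
      show "\<exists>d>0. \<forall>x'\<in>D k. dist x' t < d \<longrightarrow> dist (J k f x') (J k f t) < e"
      proof (intro exI[of _ "e / M"] conjI ballI impI)
        fix x assume x: "x \<in> D k" "dist x t < e / M"
        have "\<bar>J k f x - J k f t\<bar> \<le> M * \<bar>x - t\<bar>" using lip' x tX by auto
        also have "\<dots> < e" using x M(1) by (auto simp: dist_real_def field_simps)
        finally show "dist (J k f x) (J k f t) < e" by (simp add: dist_real_def)
      qed (use e M in auto)
    qed
    then have c: "continuous (at t within X) (J k f)" using at_within_D[OF k t] by simp
    \<comment> \<open>On the gap \<open>tau\<close> is constantly t, so the error bound is
      0.\<close>
    have "\<bar>J k f t - J k f (rho X t) - f t * (t - rho X t)\<bar> \<le> 0 * (t - rho X t)"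
      using rho_D[OF k t] tX lt tau_gap[of t] by (intro J_estimate[OF k f]) (auto simp: D_def)
    then show ?thesis using c has_nabla_scattered[of t X] False tX rho_in_X by auto
  next
    case True
    have "(J k f has_field_derivative f t) (at t within D k)"
      unfolding has_field_derivative_def has_derivative_within_alt
    proof (intro conjI allI impI)
      fix e :: real assume e: "e > 0"
      obtain \<delta> where \<delta>: "\<delta> > 0" "\<And>x. x \<in> D (Suc k) \<Longrightarrow> dist x t < \<delta> \<Longrightarrow> dist (f x) (f t) < e"
        using reg_left_dense[OF k f t True] e unfolding continuous_within_eps_delta by meson
      \<comment> \<open>Between two points p, q of \<open>X\<close> the value of \<open>tau\<close>
        stays between p and q, so it inherits their closeness to t.\<close>
      have tau_near: "\<bar>f (tau x) - f t\<bar> \<le> e"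
        if "s k < x" "p \<le> x" "x \<le> q" "p \<in> X" "q \<in> X" "\<bar>p - t\<bar> < \<delta>" "\<bar>q - t\<bar> < \<delta>" for x p q
      proof -
        have "x \<le> b" using that b_max[of q] by auto
        then have "tau x \<in> D (Suc k)" "p \<le> tau x" "tau x \<le> q"
          using that tau_D[OF k, of x] tau_ge[of x] tau_le[of q x] by auto
        then show ?thesis using \<delta>(2)[of "tau x"] that unfolding dist_real_def by linarith
      qed
      show "\<exists>d>0. \<forall>y\<in>D k. norm (y - t) < d \<longrightarrow> norm (J k f y - J k f t - f t * (y - t)) \<le> e * norm (y - t)"
      proof (intro exI[of _ \<delta>] conjI ballI impI)
        fix y assume y: "y \<in> D k" "norm (y - t) < \<delta>"
        have yb: "y \<le> b" "s k \<le> y" "y \<in> X" using y b_max by (auto simp: D_def)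
        show "norm (J k f y - J k f t - f t * (y - t)) \<le> e * norm (y - t)"
        proof (cases "t \<le> y")
          case True
          have "\<bar>J k f y - J k f t - f t * (y - t)\<bar> \<le> e * (y - t)"
            using tX yb y True e \<delta>(1) by (intro J_estimate[OF k f] tau_near[of _ t y]) auto
          then show ?thesis using True by simp
        next
          case False
          then have "\<bar>J k f t - J k f y - f t * (t - y)\<bar> \<le> e * (t - y)"
            using tX yb y e \<delta>(1) by (intro J_estimate[OF k f] tau_near[of _ y t]) auto
          moreover have "J k f y - J k f t - f t * (y - t) = - (J k f t - J k f y - f t * (t - y))"
            by (simp add: algebra_simps)
          ultimately show ?thesis using False by simp
        qed
      qed (rule \<delta>)
    qed (rule bounded_linear_mult_right)
    then show ?thesis using at_within_D[OF k t] has_nabla_dense[OF tX(1) True] by simp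
  qed
qed

lemma J_continuous_on: "k < N \<Longrightarrow> reg k f \<Longrightarrow> continuous_on (D k) (J k f)"
  using nd_continuous_on J_nabla by blast

lemma nabla_FTC:
  assumes k: "k < N" and f: "reg k f" and F: "\<And>t. t \<in> D (Suc k) \<Longrightarrow> nd F (f t) t" and t: "t \<in> D k"
  shows "F t - F (s k) = J k f t"
proof -
  have z: "nd (\<lambda>x. 1 * F x + (-1) * J k f x) 0 t" if "t \<in> D (Suc k)" for t
    using has_nabla_add_mult[OF closed F[OF that] J_nabla[OF k f that], of 1 "-1"] by simp
  have "F t - J k f t = F b - J k f b" "F (s k) - J k f (s k) = F b - J k f b"
    using nd_zero_imp_const[OF k z t] nd_zero_imp_const[OF k z s_in_D] k by auto
  then show ?thesis using J_low[of "s k" k f] by simp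
qed

text \<open>\<open>J k f\<close> provides an antiderivative and \<open>nabla_FTC\<close> its
  uniqueness up to a constant, so the definite description is well defined.\<close>

lemma nabla_integral_eq_J:
  assumes k: "k < N" and f: "reg k f"
  shows "nabla_integral X (D k) f (s k) b = J k f b"
  unfolding nabla_integral_def kappa_D[OF k]
proof (rule the_equality)
  show "\<exists>F. (\<forall>t\<in>D (Suc k). has_nabla_derivative X (D k) F (f t) t) \<and> J k f b = F b - F (s k)"
    using J_nabla[OF k f] nd_D_iff[OF k] J_low[of "s k" k f] by (intro exI[of _ "J k f"]) auto
next
  fix I assume "\<exists>F. (\<forall>t\<in>D (Suc k). has_nabla_derivative X (D k) F (f t) t) \<and> I = F b - F (s k)"
  then show "I = J k f b"
    using nabla_FTC[OF k f] nd_D_iff[OF k] b_in_D[of k] k by auto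
qed

lemma J_linear:
  assumes k: "k < N" and f: "reg k f" and g: "reg k g" and t: "t \<le> b"
  shows "J k (\<lambda>x. \<alpha> * f x + \<beta> * g x) t = \<alpha> * J k f t + \<beta> * J k g t"
  unfolding J_def using reg_integrable_sub[OF k f order_refl t] reg_integrable_sub[OF k g order_refl t]
  by (subst integral_add) (auto intro: integrable_on_mult_right)

lemma J_cong:
  assumes k: "k < N" and "\<And>t. t \<in> D (Suc k) \<Longrightarrow> f t = g t" "t \<le> b"
  shows "J k f t = J k g t"
  unfolding J_def using assms tau_D[OF k]
  by (intro integral_spike[of "{s k}"]) auto

lemma J_sum:
  assumes k: "k < N" and "finite I" and f: "\<And>i. i \<in> I \<Longrightarrow> reg k (f i)" and t: "t \<le> b"
  shows "J k (\<lambda>x. \<Sum>i\<in>I. \<alpha> i * f i x) t = (\<Sum>i\<in>I. \<alpha> i * J k (f i) t)"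
  using assms(2,3)
proof (induction I)
  case (insert i I)
  have "J k (\<lambda>x. \<alpha> i * f i x + 1 * (\<Sum>i\<in>I. \<alpha> i * f i x)) t = \<alpha> i * J k (f i) t + 1 * J k (\<lambda>x. \<Sum>i\<in>I. \<alpha> i * f i x) t"
    using insert by (intro J_linear[OF k _ _ t] reg_sum reg_cmult) auto
  then show ?case using insert by simp
qed (simp add: J_def)

text \<open>From \<open>s k\<close> to \<open>s (Suc k)\<close> the extended integrand takes the
  single value at \<open>s (Suc k)\<close>.\<close>

lemma J_Suc_start:
  assumes k: "Suc k < N" and f: "reg k f" and z: "f (s (Suc k)) = 0"
  shows "J (Suc k) f b = J k f b"
proof -
  have k': "k < N" and sb: "s k \<le> s (Suc k)" "s (Suc k) \<le> b"
    using k s_mono[of k] s_in b_max by auto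
  have "\<bar>J k f (s (Suc k)) - J k f (s k) - 0 * (s (Suc k) - s k)\<bar> \<le> 0 * (s (Suc k) - s k)"
  proof (rule J_estimate[OF k' f])
    fix x assume x: "s k < x" "x \<le> s (Suc k)"
    have "tau x \<in> D (Suc k)" using tau_D[OF k' x(1)] x sb by auto
    then have "tau x = s (Suc k)" using tau_le[of "s (Suc k)" x] s_in[of "Suc k"] k x by (auto simp: D_def)
    then show "\<bar>f (tau x) - 0\<bar> \<le> 0" using z by simp
  qed (use sb in auto)
  then have "J k f (s (Suc k)) = 0" using J_low[of "s k" k f] by simp
  then show ?thesis using J_combine[OF k' f, of "s (Suc k)" b] sb by (simp add: J_def)
qed

subsection \<open>The du Bois-Reymond lemma of higher order\<close>

text \<open>Carries the successive derivatives as data, \<open>w i\<close> being meaningful on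
  \<open>D (k + i)\<close>; this keeps the analysis free of the definite description in
  \<open>nabla_deriv\<close>.\<close>

definition dtower :: "nat \<Rightarrow> nat \<Rightarrow> (nat \<Rightarrow> real \<Rightarrow> real) \<Rightarrow> bool" where
  "dtower k n w \<longleftrightarrow> (\<forall>i<n. \<forall>t\<in>D (k + Suc i). nd (w i) (w (Suc i) t) t)"

definition tower :: "nat \<Rightarrow> nat \<Rightarrow> (nat \<Rightarrow> real \<Rightarrow> real) \<Rightarrow> bool" where
  "tower k n w \<longleftrightarrow> dtower k n w \<and> continuous_on (D (k + n)) (w n)"

lemma dtower_nd: "dtower k n w \<Longrightarrow> i < n \<Longrightarrow> t \<in> D (k + Suc i) \<Longrightarrow> nd (w i) (w (Suc i) t) t"
  unfolding dtower_def by auto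

lemma tower_nd: "tower k n w \<Longrightarrow> i < n \<Longrightarrow> t \<in> D (k + Suc i) \<Longrightarrow> nd (w i) (w (Suc i) t) t"
  unfolding tower_def using dtower_nd by auto

lemma tower_continuous:
  assumes "tower k n w" "k + n \<le> N" "i \<le> n"
  shows "continuous_on (D (k + i)) (w i)"
proof (cases "i = n")
  case True
  then show ?thesis using assms by (simp add: tower_def)
next
  case False
  then show ?thesis using assms tower_nd[OF assms(1), of i]
    by (intro nd_continuous_on[of "k + i" _ "w (Suc i)"]) auto
qed

lemma dtower_comb:
  "dtower k n v \<Longrightarrow> dtower k n w \<Longrightarrow> dtower k n (\<lambda>i x. \<alpha> * v i x + \<beta> * w i x)"
  unfolding dtower_def by (intro allI ballI impI has_nabla_add_mult[OF closed]) auto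

lemma tower_comb:
  "tower k n v \<Longrightarrow> tower k n w \<Longrightarrow> tower k n (\<lambda>i x. \<alpha> * v i x + \<beta> * w i x)"
  unfolding tower_def by (auto intro!: dtower_comb continuous_intros)

lemma dtower_const: "dtower k n (\<lambda>i x. if i = 0 then c else 0)"
proof -
  have "nd (\<lambda>x. if i = 0 then c else 0) 0 t" if "t \<in> D j" for i j :: nat and t
    using has_nabla_const[of t X "if i = 0 then c else 0"] rho_in_X that D_subset[of j] by (simp add: subset_iff)
  then show ?thesis unfolding dtower_def by auto
qed

lemma tower_const: "tower k n (\<lambda>i x. if i = 0 then c else 0)"
  unfolding tower_def using dtower_const by auto

lemma reg_Suc:
  assumes "reg k f" "Suc k < N" shows "reg (Suc k) f"
proof -
  obtain \<Phi> where \<Phi>: "continuous_on (D (Suc k) \<times> D k) \<Phi>" "\<forall>t\<in>D (Suc k). f t = \<Phi> (t, rho X t)"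
    using assms(1) unfolding reg_def by blast
  have sub: "D (Suc k) \<subseteq> D k" "D (Suc (Suc k)) \<subseteq> D (Suc k)" using D_Suc_subset assms(2) by auto
  have "continuous_on (D (Suc (Suc k)) \<times> D (Suc k)) \<Phi>"
    by (rule continuous_on_subset[OF \<Phi>(1) Sigma_mono[OF sub(2) sub(1)]])
  then show ?thesis unfolding reg_def using \<Phi>(2) sub by blast
qed

lemma reg_continuous_lower: "k < N \<Longrightarrow> continuous_on (D k) f \<Longrightarrow> reg k f"
  using continuous_on_subset D_Suc_subset reg_continuous by blast

lemma reg_J: "k < N \<Longrightarrow> reg k f \<Longrightarrow> reg k (J k f)"
  using J_continuous_on reg_continuous_lower by blast

lemma J_const_imp_zero:
  assumes k: "k < N" and g: "reg k g" and c: "\<And>t. t \<in> D k \<Longrightarrow> J k g t = c" and t: "t \<in> D (Suc k)"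
  shows "g t = 0"
proof -
  have "nd (\<lambda>_. c) (g t) t" by (rule nd_cong[OF k t c J_nabla[OF k g t]])
  moreover have "nd (\<lambda>_. c) 0 t" using has_nabla_const rho_in_X t D_subset by blast
  ultimately show ?thesis using nd_unique[OF k t] by blast
qed

text \<open>Ramps approximate the indicator of \<open>{t1<..}\<close>; so the integral of \<open>g\<close> over every final segment vanishes.\<close>

lemma orthogonal_continuous_imp_zero:
  assumes k: "k < N" and g: "reg k g"
    and ort: "\<And>w. continuous_on (D (Suc k)) w \<Longrightarrow> J k (\<lambda>t. g t * w t) b = 0"
    and t: "t \<in> D (Suc k)"
  shows "g t = 0"
proof (rule J_const_imp_zero[OF k g _ t])
  fix t1 assume t1: "t1 \<in> D k"
  have t1b: "s k \<le> t1" "t1 \<le> b" "t1 \<in> X" using t1 b_max by (auto simp: D_def)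
  obtain M where M: "M > 0" "\<And>t. t \<in> D (Suc k) \<Longrightarrow> \<bar>g t\<bar> \<le> M" using reg_bounded[OF k g] by auto
  have "\<bar>J k g b - J k g t1\<bar> \<le> 0"
  proof (rule field_le_epsilon)
    fix e :: real assume e: "e > 0"
    \<comment> \<open>The ramp differs from the indicator only over length \<delta>, where the
      integrand is at most M, so the error is at most e.\<close>
    define \<delta> where "\<delta> = e / M"
    have \<delta>: "\<delta> > 0" using e M by (simp add: \<delta>_def)
    define v where "v t = min 1 (max 0 ((t - t1) / \<delta>))" for t
    have v01: "0 \<le> v t" "v t \<le> 1" for t by (auto simp: v_def)
    have vc: "continuous_on (D (Suc k)) v" unfolding v_def using \<delta> by (intro continuous_intros) auto
    have rv: "reg k (\<lambda>t. g t * v t)" by (intro reg_mult g reg_continuous vc)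
    define h where "h t = 1 * (g t * v t) + (-1) * g t" for t
    have h: "reg k h" unfolding h_def by (intro reg_add reg_cmult rv g)
    have hb: "\<bar>h t\<bar> \<le> M" if "t \<in> D (Suc k)" for t
    proof -
      have "h t = g t * (v t - 1)" by (simp add: h_def algebra_simps)
      then have "\<bar>h t\<bar> = \<bar>g t\<bar> * \<bar>v t - 1\<bar>" by (simp add: abs_mult)
      also have "\<dots> \<le> M * 1" using M that v01[of t] by (intro mult_mono) auto
      finally show ?thesis by simp
    qed
    have Jh: "J k h t = J k (\<lambda>t. g t * v t) t - J k g t" if "t \<le> b" for t
      using J_linear[OF k rv g that, of 1 "-1"] by (simp add: h_def[abs_def])
    have "\<bar>J k (\<lambda>t. g t * v t) t1 - J k (\<lambda>t. g t * v t) (s k) - 0 * (t1 - s k)\<bar> \<le> 0 * (t1 - s k)"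
    proof (rule J_estimate[OF k rv])
      fix x assume "s k < x" "x \<le> t1"
      then have "v (tau x) = 0" using tau_le[of t1 x] t1b \<delta> by (simp add: v_def divide_le_0_iff)
      then show "\<bar>g (tau x) * v (tau x) - 0\<bar> \<le> 0" by simp
    qed (use t1b in auto)
    then have v1: "J k (\<lambda>t. g t * v t) t1 = 0" by (simp add: J_low)
    define p where "p = min b (t1 + \<delta>)"
    have p: "t1 \<le> p" "p \<le> b" using t1b \<delta> by (auto simp: p_def)
    have 1: "\<bar>J k h p - J k h t1 - 0 * (p - t1)\<bar> \<le> M * (p - t1)"
    proof (rule J_estimate[OF k h])
      fix x assume "t1 < x" "x \<le> p"
      then show "\<bar>h (tau x) - 0\<bar> \<le> M" using hb tau_D[OF k, of x] t1b p by auto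
    qed (use p t1b M in auto)
    have 2: "\<bar>J k h b - J k h p - 0 * (b - p)\<bar> \<le> 0 * (b - p)"
    proof (rule J_estimate[OF k h])
      fix x assume x: "p < x" "x \<le> b"
      then have "t1 + \<delta> \<le> tau x" using tau_ge[of x] by (auto simp: p_def)
      then have "v (tau x) = 1" using \<delta> by (simp add: v_def field_simps)
      then show "\<bar>h (tau x) - 0\<bar> \<le> 0" by (simp add: h_def)
    qed (use p t1b in auto)
    have "M * (p - t1) \<le> M * \<delta>" using M by (simp add: p_def)
    also have "\<dots> = e" using M by (simp add: \<delta>_def)
    finally have "\<bar>J k h b - J k h t1\<bar> \<le> e" using 1 2 by simp
    moreover have "J k h b = - J k g b" using Jh ort[OF vc] by simp
    moreover have "J k h t1 = - J k g t1" using Jh t1b v1 by simp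
    ultimately show "\<bar>J k g b - J k g t1\<bar> \<le> 0 + e" by simp
  qed
  then show "J k g t1 = J k g b" by simp
qed

text \<open>If a gap follows t, then t = \<open>rho X u\<close> for the next point u. Otherwise
  points x of \<open>X\<close> decrease to t, and t \<le> \<open>rho X x\<close> \<le> x lets the
  zeros \<open>rho X x\<close> converge to t. The point b need not be a jump image, hence its
  separate hypothesis.\<close>

lemma zero_of_zero_rho:
  fixes F :: "real \<Rightarrow> real"
  assumes k: "Suc k < N" and F: "continuous_on (D (Suc k)) F" "F b = 0"
    and z: "\<And>t. t \<in> D (Suc (Suc k)) \<Longrightarrow> F (rho X t) = 0" and t: "t \<in> D (Suc k)"
  shows "F t = 0"
proof (cases "t = b")
  case False
  have tX: "t \<in> X" "s (Suc k) \<le> t" using t by (auto simp: D_def)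
  have tb: "t < b" using b_max[OF tX(1)] False by simp
  have up: "x \<in> D (Suc (Suc k))" if "x \<in> X" "t < x" for x
    using s_step[OF k, of x] that tX by (auto simp: D_def)
  show ?thesis
  proof (cases "\<exists>\<delta>>0. \<forall>x\<in>X. t < x \<longrightarrow> t + \<delta> \<le> x")
    case True
    then obtain \<delta> where \<delta>: "\<delta> > 0" "\<And>x. x \<in> X \<Longrightarrow> t < x \<Longrightarrow> t + \<delta> \<le> x" by blast
    \<comment> \<open>A point inside the gap, so that \<open>tau x\<close> is the right neighbour of
      t.\<close>
    define x where "x = min b (t + \<delta> / 2)"
    define u where "u = tau x"
    have x: "t < x" "x \<le> b" "x < t + \<delta>" using \<delta> tb by (auto simp: x_def)
    have u: "u \<in> X" "t < u" using tau_in tau_ge[OF x(2)] x by (auto simp: u_def)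
    have "rho X u \<le> t"
    proof (rule ccontr)
      assume "\<not> rho X u \<le> t"
      then have r: "rho X u \<in> X" "t < rho X u" using rho_in_X u by auto
      then have "x \<le> rho X u" using \<delta>(2)[of "rho X u"] x by simp
      then have "u \<le> rho X u" unfolding u_def using tau_le r(1) u_def by simp
      then have ru: "rho X u = u" using rho_le[of X u] by simp
      \<comment> \<open>If u were left-dense, a point z of \<open>X\<close> between t and u would
        lie beyond x and contradict the minimality of \<open>tau x\<close>.\<close>
      obtain z where "z \<in> X" "u - (u - t) / 2 < z" "z < u" "True"
        using left_dense_approx[OF ru tX(1) u(2), of "(u - t) / 2"] u by auto
      moreover have "x \<le> z"
      proof -
        have "t < z" using \<open>u - (u - t) / 2 < z\<close> u by (simp add: field_simps)
        then show ?thesis using \<delta>(2)[of z] \<open>z \<in> X\<close> x by simp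
      qed
      ultimately show False using tau_le[of z x] by (simp add: u_def)
    qed
    moreover have "t \<le> rho X u" using rho_ge[OF tX(1) u(2)] .
    ultimately show ?thesis using z[OF up[OF u]] by simp
  next
    case False
    have "\<bar>F t\<bar> \<le> 0"
    proof (rule field_le_epsilon)
      fix e :: real assume "e > 0"
      then obtain \<delta> where \<delta>: "\<delta> > 0" "\<And>x. x \<in> D (Suc k) \<Longrightarrow> dist x t < \<delta> \<Longrightarrow> dist (F x) (F t) < e"
        using F(1) t unfolding continuous_on_iff by meson
      obtain x where x: "x \<in> X" "t < x" "x < t + \<delta>" using False \<delta>(1) by force
      have r: "rho X x \<in> D (Suc k)" using rho_D[OF k up] x by auto
      have "t \<le> rho X x" "rho X x \<le> x" using rho_ge tX x rho_le by auto
      then have "dist (F (rho X x)) (F t) < e" using x by (intro \<delta>(2) r) (auto simp: dist_real_def)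
      then show "\<bar>F t\<bar> \<le> 0 + e" using z[OF up] x by (simp add: dist_real_def)
    qed
    then show ?thesis by simp
  qed
qed (use F in simp)

text \<open>Test functions \<open>J (Suc k) (w 0)\<close> gain one derivative. Integrating by parts
  against them shows that G composed with the jump, G being the integral of g, is orthogonal to
  towers of height n. It vanishes by induction; then G vanishes, and so does g.\<close>

lemma orthogonal_tower_imp_zero:
  assumes "k + n < N" and "reg k g"
    and "\<And>w. tower (Suc k) n w \<Longrightarrow> J k (\<lambda>t. g t * w 0 t) b = 0"
    and "t \<in> D (Suc k)"
  shows "g t = 0"
  using assms
proof (induction n arbitrary: k g t)
  case 0
  show ?case
  proof (rule orthogonal_continuous_imp_zero[OF _ "0.prems"(2) _ "0.prems"(4)])
    fix w :: "real \<Rightarrow> real" assume "continuous_on (D (Suc k)) w"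
    then have "tower (Suc k) 0 (\<lambda>_. w)" by (simp add: tower_def dtower_def)
    from "0.prems"(3)[OF this] show "J k (\<lambda>t. g t * w t) b = 0" .
  qed (use 0 in auto)
next
  case (Suc n)
  have k: "k < N" "Suc k < N" and g: "reg k g" using Suc.prems by auto
  define G where "G = J k g"
  have Gc: "continuous_on (D k) G" "continuous_on (D (Suc k)) G"
    unfolding G_def using J_continuous_on[OF k(1) g] D_Suc_subset[OF k(1)] continuous_on_subset by blast+
  \<comment> \<open>The constant 1 is a test function, so no boundary term remains at b.\<close>
  have Gb: "G b = 0" using Suc.prems(3)[OF tower_const, of 1] by (simp add: G_def)
  have z: "G (rho X u) = 0" if u: "u \<in> D (Suc (Suc k))" for u
  proof (rule Suc.IH[of "Suc k" "\<lambda>x. G (rho X x)"])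
    show "reg (Suc k) (\<lambda>x. G (rho X x))" using Gc(2) by (rule reg_rho)
    fix w assume w: "tower (Suc (Suc k)) n w"
    have w0: "continuous_on (D (Suc (Suc k))) (w 0)"
      using tower_continuous[OF w, of 0] Suc.prems(1) by simp
    have rw: "reg (Suc k) (w 0)" using w0 by (rule reg_continuous)
    define W where "W = J (Suc k) (w 0)"
    have "tower (Suc k) (Suc n) (\<lambda>i. case i of 0 \<Rightarrow> W | Suc i \<Rightarrow> w i)"
      using w J_nabla[OF k(2) rw] unfolding tower_def dtower_def W_def
      by (auto split: nat.split)
    from Suc.prems(3)[OF this] have gW: "J k (\<lambda>t. g t * W t) b = 0" by simp
    have Wc: "continuous_on (D (Suc k)) W" unfolding W_def by (rule J_continuous_on[OF k(2) rw])
    have W0: "W (s (Suc k)) = 0" by (simp add: W_def J_low)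
    have rgW: "reg k (\<lambda>t. g t * W t)" by (intro reg_mult g reg_continuous Wc)
    have rGw: "reg (Suc k) (\<lambda>t. G (rho X t) * w 0 t)" by (intro reg_mult rw reg_rho Gc)
    \<comment> \<open>The induction hypothesis lives one level higher; moving the lower limit costs
      nothing because \<open>W\<close> vanishes at \<open>s (Suc k)\<close>.\<close>
    have "J (Suc k) (\<lambda>t. g t * W t) b = 0"
      using J_Suc_start[OF k(2) rgW] W0 gW by simp
    moreover have "W b * G b - W (s (Suc k)) * G (s (Suc k)) = J (Suc k) (\<lambda>t. 1 * (G (rho X t) * w 0 t) + 1 * (g t * W t)) b"
    proof (rule nabla_FTC[OF k(2), where F = "\<lambda>x. W x * G x"])
      fix t assume t: "t \<in> D (Suc (Suc k))"
      have t': "t \<in> D (Suc k)" using t D_Suc_subset[OF k(2)] by auto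
      show "nd (\<lambda>x. W x * G x) (1 * (G (rho X t) * w 0 t) + 1 * (g t * W t)) t"
        using has_nabla_mult[OF closed J_nabla[OF k(2) rw t] J_nabla[OF k(1) g t']]
        unfolding G_def W_def by (simp add: mult.commute)
    qed (use k b_in_D reg_Suc[OF rgW] rGw in \<open>auto intro!: reg_add reg_cmult\<close>)
    moreover have "J (Suc k) (\<lambda>t. 1 * (G (rho X t) * w 0 t) + 1 * (g t * W t)) b
       = 1 * J (Suc k) (\<lambda>t. G (rho X t) * w 0 t) b + 1 * J (Suc k) (\<lambda>t. g t * W t) b"
      by (rule J_linear[OF k(2) rGw reg_Suc[OF rgW k(2)]]) simp
    ultimately show "J (Suc k) (\<lambda>t. G (rho X t) * w 0 t) b = 0" using W0 Gb by simp
  qed (use Suc.prems u in auto)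
  show ?case
  proof (rule J_const_imp_zero[OF k(1) g _ Suc.prems(4), of 0])
    fix u assume u: "u \<in> D k"
    show "J k g u = 0"
    proof (cases "u \<in> D (Suc k)")
      case True
      then show ?thesis using zero_of_zero_rho[OF k(2) Gc(2) Gb z] by (simp add: G_def)
    qed (use D_bottom[OF k(1) u] in \<open>auto simp: J_low\<close>)
  qed
qed

section \<open>Iterated integrals and the functions representing them\<close>

primrec iterJ :: "nat \<Rightarrow> (real \<Rightarrow> real) \<Rightarrow> nat \<Rightarrow> real \<Rightarrow> real" where
  "iterJ k w 0 = w"
| "iterJ k w (Suc i) = J k (iterJ k w i)"

lemma reg_iterJ: "k < N \<Longrightarrow> reg k w \<Longrightarrow> reg k (iterJ k w i)"
  by (induction i) (auto intro: reg_J)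

lemma iterJ_J: "iterJ k (J k w) i = iterJ k w (Suc i)"
  by (induction i) auto

lemma iterJ_linear:
  assumes k: "k < N" and "reg k v" "reg k w" "t \<in> D (Suc k)"
  shows "iterJ k (\<lambda>x. v x + c * w x) i t = iterJ k v i t + c * iterJ k w i t"
  using assms(4)
proof (induction i arbitrary: t)
  case (Suc i)
  have tb: "t \<le> b" using Suc.prems b_max by (auto simp: D_def)
  have "J k (iterJ k (\<lambda>x. v x + c * w x) i) t = J k (\<lambda>x. 1 * iterJ k v i x + c * iterJ k w i x) t"
    using Suc.IH by (intro J_cong[OF k _ tb]) auto
  also have "\<dots> = 1 * J k (iterJ k v i) t + c * J k (iterJ k w i) t"
    by (intro J_linear k reg_iterJ assms tb)
  finally show ?case by simp
qed auto

text \<open>\<open>dual k i\<close> represents the functional \<open>w \<mapsto> iterJ k w (Suc i) b\<close>.\<close>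

primrec dual :: "nat \<Rightarrow> nat \<Rightarrow> real \<Rightarrow> real" where
  "dual k 0 = (\<lambda>_. 1)"
| "dual k (Suc i) = (\<lambda>t. J k (dual k i) b - J k (dual k i) (rho X t))"

lemma reg_dual: "k < N \<Longrightarrow> reg k (dual k i)"
proof (induction i)
  case (Suc i)
  then have "continuous_on (D k) (\<lambda>t. J k (dual k i) b - J k (dual k i) t)"
    by (intro continuous_intros J_continuous_on) auto
  from reg_rho[OF this] show ?case by simp
qed (simp add: reg_const)

text \<open>Integration by parts against \<open>P\<close>, the integral of \<open>dual k i\<close>
  from t to b: \<open>P\<close> vanishes at b and \<open>J k w\<close> at \<open>s k\<close>, so one
  step of the recursion is traded for one more integration of w.\<close>

lemma J_dual:
  assumes k: "k < N" and w: "reg k w"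
  shows "J k (\<lambda>t. dual k i t * w t) b = iterJ k w (Suc i) b"
  using w
proof (induction i arbitrary: w)
  case (Suc i)
  define d where "d = dual k i"
  have d: "reg k d" using reg_dual k by (simp add: d_def)
  define P where "P t = J k d b - J k d t" for t
  have Pc: "continuous_on (D k) P"
    unfolding P_def by (intro continuous_intros J_continuous_on k d)
  have r1: "reg k (\<lambda>t. P (rho X t) * w t)" by (intro reg_mult Suc.prems reg_rho Pc)
  have r2: "reg k (\<lambda>t. d t * J k w t)" by (intro reg_mult d reg_J Suc.prems k)
  have "J k w b * P b - J k w (s k) * P (s k) = J k (\<lambda>t. 1 * (P (rho X t) * w t) + (-1) * (d t * J k w t)) b"
  proof (rule nabla_FTC[OF k, where F = "\<lambda>x. J k w x * P x"])
    fix t assume t: "t \<in> D (Suc k)"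
    have tX: "t \<in> X" using t D_subset by auto
    have "nd P (1 * 0 + (-1) * d t) t"
      using has_nabla_add_mult[OF closed has_nabla_const[OF tX rho_in_X[OF tX], of "J k d b"] J_nabla[OF k d t], of 1 "-1"]
      by (simp add: P_def[abs_def])
    from has_nabla_mult[OF closed J_nabla[OF k Suc.prems t] this]
    show "nd (\<lambda>x. J k w x * P x) (1 * (P (rho X t) * w t) + (-1) * (d t * J k w t)) t"
      by (simp add: mult.commute)
  qed (use r1 r2 k b_in_D in \<open>auto intro!: reg_diff\<close>)
  also have "\<dots> = 1 * J k (\<lambda>t. P (rho X t) * w t) b + (-1) * J k (\<lambda>t. d t * J k w t) b"
    by (intro J_linear k r1 r2 order_refl)
  finally have "J k (\<lambda>t. P (rho X t) * w t) b = J k (\<lambda>t. d t * J k w t) b"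
    by (simp add: J_low P_def)
  also have "\<dots> = iterJ k w (Suc (Suc i)) b"
    using Suc.IH[OF reg_J[OF k Suc.prems]] by (simp add: d_def iterJ_J)
  finally show ?case by (simp add: P_def d_def)
qed simp

text \<open>Only \<open>D 1\<close> is asked for: at a right-scattered left endpoint a, the
  convention \<open>rho X a = a\<close> may violate the affine law of T.\<close>

definition affine_jump :: "real \<Rightarrow> bool" where
  "affine_jump A \<longleftrightarrow> A > 0 \<and> (\<exists>a0. \<forall>t\<in>D 1. rho X t = A * t + a0)"

text \<open>Affinity turns differences of jumps into A times differences of arguments, so the
  defining inequality at \<open>rho X t\<close> with tolerance e / A becomes the one at t with
  tolerance e.\<close>

lemma has_nabla_comp_rho:
  assumes A: "affine_jump A" and k: "Suc k < N" and t: "t \<in> D (Suc (Suc k))" and g: "nd g d (rho X t)"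
  shows "nd (\<lambda>x. g (rho X x)) (A * d) t"
  unfolding has_nabla_derivative_def
proof (intro conjI allI impI)
  obtain a0 where a0: "A > 0" "\<And>t. t \<in> D 1 \<Longrightarrow> rho X t = A * t + a0"
    using A unfolding affine_jump_def by auto
  have sub: "D (Suc k) \<subseteq> D 1" using D_antimono[of 1 "Suc k"] k by auto
  obtain \<delta> where \<delta>: "\<delta> > 0" "\<And>x. x \<in> X \<Longrightarrow> \<bar>x - t\<bar> < \<delta> \<Longrightarrow> x \<in> D (Suc k)"
    using D_nhd[OF k t] by auto
  have rt: "rho X t \<in> D 1" and t1: "t \<in> D 1" using rho_D[OF k t] sub D_Suc_subset[OF k] t by auto
  show "t \<in> X" "rho X t \<in> X" using t1 rt D_subset by auto
  fix e :: real assume "e > 0"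
  then have "e / A > 0" using a0 by simp
  then obtain \<eta> where \<eta>: "\<eta> > 0" "\<And>x. x \<in> X \<Longrightarrow> \<bar>x - rho X t\<bar> < \<eta> \<Longrightarrow>
      \<bar>g (rho X (rho X t)) - g x - d * (rho X (rho X t) - x)\<bar> \<le> e * inverse A * \<bar>rho X (rho X t) - x\<bar>"
    using g unfolding has_nabla_derivative_def divide_inverse by blast
  show "\<exists>\<delta>>0. \<forall>x\<in>X. \<bar>x - t\<bar> < \<delta> \<longrightarrow>
      \<bar>g (rho X (rho X t)) - g (rho X x) - A * d * (rho X t - x)\<bar> \<le> e * \<bar>rho X t - x\<bar>"
  proof (intro exI[of _ "min \<delta> (\<eta> / A)"] conjI ballI impI)
    fix x assume x: "x \<in> X" "\<bar>x - t\<bar> < min \<delta> (\<eta> / A)"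
    then have x1: "x \<in> D 1" using \<delta> sub by auto
    have e1: "rho X x - rho X t = A * (x - t)" using a0(2) x1 t1 by (simp add: algebra_simps)
    have e2: "rho X (rho X t) - rho X x = A * (rho X t - x)" using a0(2)[OF rt] a0(2)[OF x1] by (simp add: algebra_simps)
    have "A * \<bar>x - t\<bar> < \<eta>" using x a0(1) by (simp add: field_simps)
    then have "\<bar>rho X x - rho X t\<bar> < \<eta>" unfolding e1 abs_mult using a0(1) by simp
    then have "\<bar>g (rho X (rho X t)) - g (rho X x) - d * (rho X (rho X t) - rho X x)\<bar>
        \<le> e * inverse A * \<bar>rho X (rho X t) - rho X x\<bar>"
      using \<eta>(2)[of "rho X x"] rho_in_X x by auto
    moreover have "e * inverse A * \<bar>A * (rho X t - x)\<bar> = e * \<bar>rho X t - x\<bar>"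
      "d * (A * (rho X t - x)) = A * d * (rho X t - x)"
      using a0(1) by (simp_all add: abs_mult)
    ultimately show "\<bar>g (rho X (rho X t)) - g (rho X x) - A * d * (rho X t - x)\<bar> \<le> e * \<bar>rho X t - x\<bar>"
      unfolding e2 by simp
  qed (use \<delta> \<eta> a0 in auto)
qed

text \<open>For an affine \<open>\<rho>\<close> the representing functions are polynomials of degree \<open>i\<close>.\<close>

lemma dual_dtower:
  assumes "i = 0 \<or> affine_jump A" "k + n < N"
  shows "\<exists>q. dtower (Suc k) n q \<and> q 0 = dual k i \<and> (\<forall>j t. i < j \<longrightarrow> Suc k + j \<le> N \<longrightarrow> t \<in> D (Suc k + j) \<longrightarrow> q j t = 0)"
  using assms(1)
proof (induction i)
  case 0
  have "dtower (Suc k) n (\<lambda>i x. if i = 0 then 1 else 0)" by (rule dtower_const)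
  then show ?case by (intro exI[of _ "\<lambda>i x. if i = 0 then 1 else 0"]) auto
next
  case (Suc i)
  have A: "affine_jump A" using Suc.prems by simp
  then obtain q where q: "dtower (Suc k) n q" "q 0 = dual k i" "\<And>j t. i < j \<Longrightarrow> Suc k + j \<le> N \<Longrightarrow> t \<in> D (Suc k + j) \<Longrightarrow> q j t = 0"
    using Suc.IH by auto
  have k: "k < N" using assms by simp
  define P where "P t = J k (dual k i) b - J k (dual k i) t" for t
  have P: "nd P (- dual k i t) t" if t: "t \<in> D (Suc k)" for t
  proof -
    have tX: "t \<in> X" using t D_subset by auto
    show ?thesis
      using has_nabla_add_mult[OF closed has_nabla_const[OF tX rho_in_X[OF tX], of "J k (dual k i) b"] J_nabla[OF k reg_dual[OF k] t], of 1 "-1" i]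
      by (simp add: P_def[abs_def])
  qed
  \<comment> \<open>The sign comes from differentiating the lower limit in \<open>P\<close>; every
    derivative taken through the jump contributes a factor A.\<close>
  define q' where "q' j = (case j of 0 \<Rightarrow> (\<lambda>t. P (rho X t)) | Suc j \<Rightarrow> (\<lambda>t. - (A ^ Suc j) * q j (rho X t)))" for j
  have "dtower (Suc k) n q'"
    unfolding dtower_def
  proof (intro allI impI ballI)
    fix j t assume j: "j < n" and t: "t \<in> D (Suc k + Suc j)"
    have lt: "Suc (k + j) < N" using j assms by simp
    have t': "t \<in> D (Suc (Suc (k + j)))" using t by simp
    have r: "rho X t \<in> D (Suc (k + j))" using rho_D[OF lt t'] .
    show "nd (q' j) (q' (Suc j) t) t"
    proof (cases j)
      case 0
      have "nd (\<lambda>x. P (rho X x)) (A * - dual k i (rho X t)) t"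
        using 0 r by (intro has_nabla_comp_rho[OF A lt t'] P) auto
      then show ?thesis using 0 q(2) by (simp add: q'_def)
    next
      case (Suc j')
      have "nd (q j') (q (Suc j') (rho X t)) (rho X t)"
        using r Suc j by (intro dtower_nd[OF q(1)]) auto
      then have n: "nd (\<lambda>x. q j' (rho X x)) (A * q (Suc j') (rho X t)) t"
        by (rule has_nabla_comp_rho[OF A lt t'])
      show ?thesis
        using has_nabla_add_mult[OF closed n n, of "- (A ^ Suc j')" 0] Suc by (simp add: q'_def mult_ac)
    qed
  qed
  moreover have "q' 0 = dual k (Suc i)" by (simp add: q'_def P_def)
  moreover have "q' j t = 0" if "j > Suc i" "t \<in> D (Suc k + j)" "Suc k + j \<le> N" for j t
  proof -
    obtain j' where j': "j = Suc j'" using \<open>j > Suc i\<close> by (cases j) auto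
    have "rho X t \<in> D (Suc k + j')" using rho_D[of "Suc k + j'" t] that j' by auto
    then show ?thesis using q(3)[of j' "rho X t"] that j' by (simp add: q'_def)
  qed
  ultimately show ?case by blast
qed

text \<open>Integration against g vanishes where the n iterated integrals at b do, so it is a
  combination of them. The functions \<open>dual k i\<close> turn this combination into integration
  against some p, and \<open>orthogonal_tower_imp_zero\<close> gives g = p. As p has degree less
  than n, its n-th derivative is 0. For n \<le> 1 at most the constant \<open>dual k 0\<close>
  occurs, whence the weaker condition on the jump.\<close>

theorem du_bois_reymond:
  assumes kn: "k + n < N" and A: "n \<le> 1 \<or> affine_jump A" and g: "reg k g"
    and ort: "\<And>w. tower (Suc k) n w \<Longrightarrow> (\<And>i. i < n \<Longrightarrow> iterJ k (w 0) (Suc i) b = 0)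
      \<Longrightarrow> J k (\<lambda>t. g t * w 0 t) b = 0"
  shows "\<exists>q. dtower (Suc k) n q \<and> (\<forall>t\<in>D (Suc k). q 0 t = g t) \<and> (\<forall>t\<in>D (Suc k + n). q n t = 0)"
proof -
  have k: "k < N" using kn by simp
  define W where "W = {w. tower (Suc k) n w}"
  have rw: "reg k (w 0)" if "w \<in> W" for w
    using tower_continuous[of "Suc k" n w 0] that kn by (auto simp: W_def intro: reg_continuous)
  have bD: "b \<in> D (Suc k)" using k b_in_D by auto
  define comb where "comb v c w = (\<lambda>i x. v i x + c * w i x)" for v w :: "nat \<Rightarrow> real \<Rightarrow> real" and c :: real
  have "\<exists>c. \<forall>w\<in>W. J k (\<lambda>t. g t * w 0 t) b = (\<Sum>i<n. c i * iterJ k (w 0) (Suc i) b)"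
  proof (rule linear_functional_span[where comb = comb])
    fix v w :: "nat \<Rightarrow> real \<Rightarrow> real" and c :: real assume vw: "v \<in> W" "w \<in> W"
    show "comb v c w \<in> W"
      using tower_comb[of "Suc k" n v w 1 c] vw by (simp add: W_def comb_def)
    show "iterJ k (comb v c w 0) (Suc i) b = iterJ k (v 0) (Suc i) b + c * iterJ k (w 0) (Suc i) b" for i
      unfolding comb_def by (intro iterJ_linear k rw vw bD)
    have "J k (\<lambda>t. g t * comb v c w 0 t) b = J k (\<lambda>t. 1 * (g t * v 0 t) + c * (g t * w 0 t)) b"
      by (simp add: comb_def algebra_simps)
    also have "\<dots> = 1 * J k (\<lambda>t. g t * v 0 t) b + c * J k (\<lambda>t. g t * w 0 t) b"
      by (intro J_linear k reg_mult g rw vw order_refl)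
    finally show "J k (\<lambda>t. g t * comb v c w 0 t) b = J k (\<lambda>t. g t * v 0 t) b + c * J k (\<lambda>t. g t * w 0 t) b"
      by simp
  next
    fix w assume "w \<in> W" "\<And>i. i < n \<Longrightarrow> iterJ k (w 0) (Suc i) b = 0"
    then show "J k (\<lambda>t. g t * w 0 t) b = 0" using ort by (simp add: W_def)
  qed
  then obtain c where c: "\<And>w. w \<in> W \<Longrightarrow> J k (\<lambda>t. g t * w 0 t) b = (\<Sum>i<n. c i * iterJ k (w 0) (Suc i) b)"
    by blast
  define p where "p t = (\<Sum>i<n. c i * dual k i t)" for t
  have p: "reg k p" unfolding p_def by (intro reg_sum reg_cmult reg_dual k)
  have gp: "g t - p t = 0" if t: "t \<in> D (Suc k)" for t
  proof (rule orthogonal_tower_imp_zero[OF kn _ _ t])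
    show "reg k (\<lambda>t. g t - p t)" by (intro reg_diff g p)
    fix w assume "tower (Suc k) n w"
    then have w: "w \<in> W" by (simp add: W_def)
    have "J k (\<lambda>t. p t * w 0 t) b = J k (\<lambda>t. \<Sum>i<n. c i * (dual k i t * w 0 t)) b"
      by (simp add: p_def sum_distrib_right mult.assoc)
    also have "\<dots> = (\<Sum>i<n. c i * J k (\<lambda>t. dual k i t * w 0 t) b)"
      by (intro J_sum k reg_mult reg_dual rw w) auto
    also have "\<dots> = J k (\<lambda>t. g t * w 0 t) b"
      using J_dual[OF k rw[OF w]] c[OF w] by simp
    finally have e: "J k (\<lambda>t. p t * w 0 t) b = J k (\<lambda>t. g t * w 0 t) b" .
    have "J k (\<lambda>t. (g t - p t) * w 0 t) b = J k (\<lambda>t. 1 * (g t * w 0 t) + (-1) * (p t * w 0 t)) b"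
      by (simp add: algebra_simps)
    also have "\<dots> = 1 * J k (\<lambda>t. g t * w 0 t) b + (-1) * J k (\<lambda>t. p t * w 0 t) b"
      by (intro J_linear k reg_mult g p rw w order_refl)
    finally show "J k (\<lambda>t. (g t - p t) * w 0 t) b = 0" using e by simp
  qed
  have "\<forall>i\<in>{..<n}. \<exists>q. dtower (Suc k) n q \<and> q 0 = dual k i \<and>
      (\<forall>j t. i < j \<longrightarrow> Suc k + j \<le> N \<longrightarrow> t \<in> D (Suc k + j) \<longrightarrow> q j t = 0)"
    using A kn by (intro ballI dual_dtower) auto
  from bchoice[OF this] obtain q where q: "\<And>i. i < n \<Longrightarrow> dtower (Suc k) n (q i) \<and> q i 0 = dual k i \<and>
      (\<forall>j t. i < j \<longrightarrow> Suc k + j \<le> N \<longrightarrow> t \<in> D (Suc k + j) \<longrightarrow> q i j t = 0)"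
    by blast
  define Q where "Q j t = (\<Sum>i<n. c i * q i j t)" for j t
  have "dtower (Suc k) n (\<lambda>j t. \<Sum>i<m. c i * q i j t)" if "m \<le> n" for m
    using that
  proof (induction m)
    case 0
    then show ?case using dtower_const[of "Suc k" n 0] by (simp cong: if_cong)
  next
    case (Suc m)
    then show ?case
      using dtower_comb[of "Suc k" n "\<lambda>j t. \<Sum>i<m. c i * q i j t" "q m" 1 "c m"] q[of m] by simp
  qed
  then have "dtower (Suc k) n Q" unfolding Q_def[abs_def] by simp
  moreover have "Q 0 t = g t" if "t \<in> D (Suc k)" for t
    using gp[OF that] q by (simp add: Q_def p_def)
  moreover have "Q n t = 0" if "t \<in> D (Suc k + n)" for t
    using q kn that by (auto simp: Q_def intro!: sum.neutral)
  ultimately show ?thesis by blast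
qed

subsection \<open>Jets and the first variation\<close>

lemma kappa_pow_D: "k + i \<le> N \<Longrightarrow> (kappa ^^ i) (D k) = D (k + i)"
  by (induction i) (auto simp: kappa_D)

lemma THE_nabla:
  assumes k: "k < N" and t: "t \<in> D (Suc k)" and f: "nd f d t"
  shows "(THE d. has_nabla_derivative X (D k) f d t) = d"
  unfolding nd_D_iff[OF k t] using f nd_unique[OF k t _ f] by (rule the_equality)

text \<open>Passage from explicit derivatives to the definite description of
  \<open>nabla_deriv\<close>, valid because derivatives are unique on the sets
  \<open>D (k + i)\<close> with i > 0.\<close>

lemma nabla_deriv_dtower:
  assumes "dtower k n w" "k + n \<le> N" "\<And>t. t \<in> D k \<Longrightarrow> w 0 t = f t" "i \<le> n" "t \<in> D (k + i)"
  shows "nabla_deriv X (D k) i f t = w i t"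
  using assms(4,5)
proof (induction i arbitrary: t)
  case 0
  then show ?case using assms by simp
next
  case (Suc i)
  have lt: "k + i < N" and t: "t \<in> D (Suc (k + i))" using Suc.prems assms by auto
  have "nd (w i) (w (Suc i) t) t" using assms(1) Suc.prems by (intro dtower_nd) auto
  then have n: "nd (nabla_deriv X (D k) i f) (w (Suc i) t) t"
    by (rule nd_cong[OF lt t, rotated]) (use Suc.IH Suc.prems in auto)
  have "(kappa ^^ i) (D k) = D (k + i)" using lt by (intro kappa_pow_D) auto
  then show ?case using THE_nabla[OF lt t n] by simp
qed

lemma nabla_differentiable_dtower:
  assumes "dtower k n w" "k + n \<le> N" "\<And>t. t \<in> D k \<Longrightarrow> w 0 t = f t"
  shows "nabla_differentiable X (D k) n f"
  unfolding nabla_differentiable_def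
proof (intro allI impI ballI)
  fix i t assume i: "i < n" and t: "t \<in> (kappa ^^ Suc i) (D k)"
  have lt: "k + i < N" using i assms by simp
  have t: "t \<in> D (Suc (k + i))" using t kappa_pow_D[of k "Suc i"] lt by simp
  have "nd (w i) (w (Suc i) t) t" using assms(1) i t by (intro dtower_nd) auto
  then have "nd (nabla_deriv X (D k) i f) (w (Suc i) t) t"
    by (rule nd_cong[OF lt t, rotated]) (use nabla_deriv_dtower[OF assms] i in auto)
  then show "\<exists>d. has_nabla_derivative X ((kappa ^^ i) (D k)) (nabla_deriv X (D k) i f) d t"
    using kappa_pow_D[of k i] lt nd_D_iff[OF lt t] by auto
qed

lemma dtower_nabla_deriv:
  assumes "nabla_differentiable X (D k) n f" "k + n \<le> N"
  shows "dtower k n (\<lambda>i. nabla_deriv X (D k) i f)"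
  unfolding dtower_def
proof (intro allI impI ballI)
  fix i t assume i: "i < n" and t: "t \<in> D (k + Suc i)"
  have lt: "k + i < N" and t': "t \<in> D (Suc (k + i))" using i t assms by auto
  have kp: "(kappa ^^ i) (D k) = D (k + i)" "(kappa ^^ Suc i) (D k) = D (Suc (k + i))"
    using kappa_pow_D[of k i] kappa_pow_D[of k "Suc i"] lt by auto
  have "t \<in> (kappa ^^ Suc i) (D k)" unfolding kp(2) by (rule t')
  then obtain d where d: "has_nabla_derivative X (D (k + i)) (nabla_deriv X (D k) i f) d t"
    using assms(1) i unfolding nabla_differentiable_def kp(1)[symmetric] by blast
  then have "nd (nabla_deriv X (D k) i f) d t" using nd_D_iff[OF lt t'] by simp
  moreover have "nabla_deriv X (D k) (Suc i) f t = d"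
    using THE_nabla[OF lt t' calculation] kp(1) by simp
  ultimately show "nd (nabla_deriv X (D k) i f) (nabla_deriv X (D k) (Suc i) f t) t" by simp
qed

lemma has_nabla_comp_rho_pow:
  assumes "affine_jump A \<or> j = 0" "j < N" "t \<in> D (Suc j)" "nd g d ((rho X ^^ j) t)"
  shows "nd (\<lambda>x. g ((rho X ^^ j) x)) (A ^ j * d) t"
  using assms
proof (induction j arbitrary: t)
  case (Suc j)
  have "rho X t \<in> D (Suc j)" using rho_D[of "Suc j"] Suc.prems by auto
  moreover have "nd g d ((rho X ^^ j) (rho X t))" using Suc.prems(4) by (simp add: funpow_swap1)
  ultimately have "nd (\<lambda>x. g ((rho X ^^ j) x)) (A ^ j * d) (rho X t)"
    using Suc.prems by (intro Suc.IH) auto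
  then have "nd (\<lambda>x. g ((rho X ^^ j) (rho X x))) (A * (A ^ j * d)) t"
    using Suc.prems by (intro has_nabla_comp_rho[of A j]) auto
  then show ?case by (simp add: funpow_swap1 mult.assoc)
qed simp

text \<open>Each of the i differentiations passes through j jumps and contributes
  \<open>A ^ j\<close>. With i = 0 or j = 0 no jump is differentiated through.\<close>

lemma nabla_deriv_comp_rho_pow:
  assumes w: "dtower 0 n w" "n \<le> N" and X0: "D 0 = X"
    and A: "affine_jump A \<or> i = 0 \<or> j = 0" and "i \<le> n" "i + j \<le> N" "t \<in> D (i + j)"
  shows "nabla_deriv X X i (\<lambda>x. w 0 ((rho X ^^ j) x)) t = A ^ (i * j) * w i ((rho X ^^ j) t)"
  using A assms(5-)
proof (induction i arbitrary: t)
  case (Suc i)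
  have A: "affine_jump A \<or> j = 0" using Suc.prems by auto
  have lt: "i + j < N" "i < N" "j < N" using Suc.prems by auto
  have t: "t \<in> D (Suc (i + j))" "t \<in> D (Suc i)" "t \<in> D (Suc j)"
    using Suc.prems D_antimono[of "Suc i" "Suc (i + j)"] D_antimono[of "Suc j" "Suc (i + j)"] by auto
  have "(rho X ^^ j) t \<in> D (Suc i)" using rho_pow_D[of "Suc i" j] Suc.prems by simp
  then have "nd (w i) (w (Suc i) ((rho X ^^ j) t)) ((rho X ^^ j) t)"
    using Suc.prems by (intro dtower_nd[OF w(1)]) auto
  then have n: "nd (\<lambda>x. w i ((rho X ^^ j) x)) (A ^ j * w (Suc i) ((rho X ^^ j) t)) t"
    by (rule has_nabla_comp_rho_pow[OF A lt(3) t(3)])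
  let ?d = "A ^ (Suc i * j) * w (Suc i) ((rho X ^^ j) t)"
  have "nd (\<lambda>x. A ^ (i * j) * w i ((rho X ^^ j) x)) ?d t"
    using has_nabla_add_mult[OF closed n n, of "A ^ (i * j)" 0] by (simp add: power_add mult_ac)
  then have n: "nd (nabla_deriv X X i (\<lambda>x. w 0 ((rho X ^^ j) x))) ?d t"
    by (rule nd_cong[OF lt(1) t(1), rotated]) (use Suc.IH A Suc.prems in auto)
  have "(kappa ^^ i) X = D i" using kappa_pow_D[of 0 i] lt X0 by simp
  then show ?case using THE_nabla[OF lt(2) t(2) n] by simp
qed simp

text \<open>Closed form of the jet in terms of explicit derivatives; unlike \<open>jet\<close> it is
  visibly linear in w.\<close>

definition tower_jet :: "real \<Rightarrow> nat \<Rightarrow> (nat \<Rightarrow> real \<Rightarrow> real) \<Rightarrow> real \<Rightarrow> nat \<Rightarrow> real" where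
  "tower_jet A r w t i = (if i \<le> r then A ^ (i * (r - i)) * w i ((rho X ^^ (r - i)) t) else 0)"

lemma rho_nabla_tower:
  assumes "dtower 0 r w" "r \<le> N" "D 0 = X" "affine_jump A \<or> r = 1" "t \<in> D r" "i \<le> r"
  shows "rho_nabla X (r - i) i (w 0) t = tower_jet A r w t i"
proof -
  have "affine_jump A \<or> i = 0 \<or> r - i = 0" using assms by auto
  then show ?thesis
    unfolding rho_nabla_def tower_jet_def comp_def
    using nabla_deriv_comp_rho_pow[OF assms(1-3), of A i "r - i" t] assms by simp
qed

lemma jet_tower:
  assumes "dtower 0 r w" "r \<le> N" "D 0 = X" "affine_jump A \<or> r = 1" "t \<in> D r"
  shows "jet X r (w 0) t = tower_jet A r w t"
  using rho_nabla_tower[OF assms] by (auto simp: jet_def tower_jet_def)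

lemma tower_jet_comb:
  "tower_jet A r (\<lambda>i x. v i x + h * w i x) t = (\<lambda>i. tower_jet A r v t i + h * tower_jet A r w t i)"
  by (auto simp: tower_jet_def algebra_simps)

lemma continuous_on_rho_pow:
  assumes "affine_jump A \<or> j = 0" "j \<le> N"
  shows "continuous_on (D j) (rho X ^^ j)"
  using assms
proof (induction j)
  case (Suc j)
  obtain a0 where a0: "\<And>t. t \<in> D 1 \<Longrightarrow> rho X t = A * t + a0" using Suc.prems unfolding affine_jump_def by auto
  have "continuous_on (D (Suc j)) (\<lambda>t. A * t + a0)" by (intro continuous_intros)
  then have 1: "continuous_on (D (Suc j)) (rho X)"
    using a0 D_antimono[of 1 "Suc j"] Suc.prems by (auto elim!: continuous_on_eq)
  have "continuous_on (D j) (rho X ^^ j)" using Suc by auto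
  then have "continuous_on (D (Suc j)) (\<lambda>t. (rho X ^^ j) (rho X t))"
    using rho_D[of j] Suc.prems by (intro continuous_on_compose2[OF _ 1]) auto
  then show ?case by (simp add: comp_def funpow_swap1)
qed (simp add: continuous_on_id[unfolded id_def[symmetric]] id_def)

text \<open>For i < r the component contains j + 1 jumps. The outer j are continuous by affinity
  (there are none if r = 1), and the innermost is the one that \<open>reg\<close> tolerates.\<close>

lemma reg_tower_jet:
  assumes w: "tower 0 r w" and r: "Suc k = r" "r \<le> N" and A: "affine_jump A \<or> r = 1" and i: "i \<le> r"
  shows "reg k (\<lambda>t. tower_jet A r w t i)"
proof (cases "i = r")
  case True
  then show ?thesis using tower_continuous[OF w, of r] r
    by (auto simp: tower_jet_def intro!: reg_continuous)
next
  case False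
  define j where "j = r - Suc i"
  have j: "r - i = Suc j" "i + j = k" using False i r by (auto simp: j_def)
  have ij: "affine_jump A \<or> j = 0" "j \<le> k" using A j r by auto
  have 1: "continuous_on (D k) (rho X ^^ j)"
    using continuous_on_rho_pow[OF ij(1)] ij r D_antimono[of j k] continuous_on_subset by force
  have "continuous_on (D k) (\<lambda>x. w i ((rho X ^^ j) x))"
    using tower_continuous[OF w, of i] rho_pow_D[of i j] i r j
    by (intro continuous_on_compose2[OF _ 1]) auto
  from reg_rho[OF this] have "reg k (\<lambda>t. w i ((rho X ^^ Suc j) t))" by (simp add: funpow_swap1)
  then show ?thesis using i j by (auto simp: tower_jet_def intro: reg_cmult)
qed

lemma reg_family_bounded:
  assumes k: "k < N" and "\<And>i. i \<le> r \<Longrightarrow> reg k (\<lambda>t. u t i)" and z: "\<And>t. u t \<in> jet_space r"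
  shows "\<exists>B>0. \<forall>t\<in>D (Suc k). \<forall>i. \<bar>u t i\<bar> \<le> B"
proof -
  have "\<forall>i\<in>{..r}. \<exists>M. M > 0 \<and> (\<forall>t\<in>D (Suc k). \<bar>u t i\<bar> \<le> M)" using reg_bounded[OF k assms(2)] by auto
  from bchoice[OF this] obtain M where M: "\<forall>i\<in>{..r}. M i > 0 \<and> (\<forall>t\<in>D (Suc k). \<bar>u t i\<bar> \<le> M i)" by blast
  have pos: "(\<Sum>i\<le>r. M i) > 0" using M by (intro sum_pos) auto
  have "\<bar>u t i\<bar> \<le> (\<Sum>i\<le>r. M i)" if t: "t \<in> D (Suc k)" for t i
  proof (cases "i \<le> r")
    case True
    have "M i \<le> (\<Sum>i\<le>r. M i)" using True M by (intro member_le_sum) (auto intro: less_imp_le)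
    moreover have "\<bar>u t i\<bar> \<le> M i" using M t True by auto
    ultimately show ?thesis by linarith
  next
    case False
    then show ?thesis using z[of t] pos by (simp add: in_jet_space)
  qed
  with pos show ?thesis by blast
qed

lemma reg_lagrangian:
  fixes F :: "real \<Rightarrow> (nat \<Rightarrow> real) \<Rightarrow> real"
  assumes k: "k < N" and u: "\<And>i. i \<le> r \<Longrightarrow> reg k (\<lambda>t. u t i)" and z: "\<And>t. u t \<in> jet_space r"
    and F: "continuous_on (X \<times> jet_space r) (\<lambda>(t, u). F t u)"
  shows "reg k (\<lambda>t. F t (u t))"
proof -
  have "\<forall>i\<in>{..r}. \<exists>\<Phi>. continuous_on (D (Suc k) \<times> D k) \<Phi> \<and> (\<forall>t\<in>D (Suc k). u t i = \<Phi> (t, rho X t))"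
    using u unfolding reg_def by auto
  from bchoice[OF this] obtain \<Phi> where \<Phi>: "\<forall>i\<in>{..r}. continuous_on (D (Suc k) \<times> D k) (\<Phi> i) \<and>
      (\<forall>t\<in>D (Suc k). u t i = \<Phi> i (t, rho X t))" by blast
  define \<Psi> where "\<Psi> p = (\<lambda>i. if i \<le> r then \<Phi> i p else 0)" for p
  have c1: "continuous_on (D (Suc k) \<times> D k) (\<lambda>p. \<Psi> p i)" for i
    using \<Phi> by (cases "i \<le> r") (auto simp: \<Psi>_def)
  have c: "continuous_on (D (Suc k) \<times> D k) (\<lambda>p. (fst p, \<Psi> p))"
    by (intro continuous_on_Pair continuous_on_fst continuous_on_id continuous_on_coordinatewise_then_product c1)
  have im: "(\<lambda>p. (fst p, \<Psi> p)) ` (D (Suc k) \<times> D k) \<subseteq> X \<times> jet_space r"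
    using D_subset[of "Suc k"] by (auto simp: \<Psi>_def in_jet_space)
  have "continuous_on (D (Suc k) \<times> D k) (\<lambda>p. case (fst p, \<Psi> p) of (t, u) \<Rightarrow> F t u)"
    by (rule continuous_on_compose2[OF F c im])
  moreover have "u t = \<Psi> (t, rho X t)" if "t \<in> D (Suc k)" for t
    using \<Phi> that z[of t] by (auto simp: \<Psi>_def in_jet_space)
  ultimately show ?thesis unfolding reg_def
    by (intro exI[of _ "\<lambda>p. case (fst p, \<Psi> p) of (t, u) \<Rightarrow> F t u"]) auto
qed

text \<open>A nonzero first variation I would dominate the remainder: for small h the change of the
  functional differs from h I by at most half of its size, so it would take both signs.\<close>

lemma first_variation:
  assumes k: "k < N" and lag: "lagrangian X r L"
    and u: "\<And>i. i \<le> r \<Longrightarrow> reg k (\<lambda>t. u t i)" "\<And>t. u t \<in> jet_space r"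
    and v: "\<And>i. i \<le> r \<Longrightarrow> reg k (\<lambda>t. v t i)" "\<And>t. v t \<in> jet_space r"
    and \<delta>: "\<delta> > 0"
    and extr: "(\<forall>h. \<bar>h\<bar> < \<delta> \<longrightarrow> J k (\<lambda>t. L t (u t)) b \<le> J k (\<lambda>t. L t (\<lambda>i. u t i + h * v t i)) b) \<or>
      (\<forall>h. \<bar>h\<bar> < \<delta> \<longrightarrow> J k (\<lambda>t. L t (u t)) b \<ge> J k (\<lambda>t. L t (\<lambda>i. u t i + h * v t i)) b)"
  shows "J k (\<lambda>t. \<Sum>i\<le>r. v t i * partial_u L i t (u t)) b = 0"
proof (rule ccontr)
  define S where "S t = (\<Sum>i\<le>r. v t i * partial_u L i t (u t))" for t
  define Q where "Q h t = L t (\<lambda>i. u t i + h * v t i)" for h t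
  assume "J k (\<lambda>t. \<Sum>i\<le>r. v t i * partial_u L i t (u t)) b \<noteq> 0"
  then have I: "J k S b \<noteq> 0" by (simp add: S_def[abs_def])
  define I where "I = J k S b"
  have sb: "s k \<le> b" using s_in b_max k by auto
  \<comment> \<open>The pointwise error \<open>e * \<bar>h\<bar>\<close>, integrated over length b -
    \<open>s k\<close>, is at most half of \<open>\<bar>h\<bar> * \<bar>I\<bar>\<close>; the summand
    1 avoids a zero denominator.\<close>
  define e where "e = \<bar>I\<bar> / (2 * (b - s k + 1))"
  have e: "e > 0" using I sb by (simp add: e_def I_def)
  have p: "reg k (\<lambda>t. partial_u L i t (u t))" if "i \<le> r" for i
    by (rule reg_lagrangian[OF k u lagrangian.continuous_partial[OF lag that]])
  have S: "reg k S"
    unfolding S_def by (rule reg_sum, rule reg_mult[OF v(1) p]) auto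
  have Q: "reg k (Q h)" for h
    unfolding Q_def
  proof (rule reg_lagrangian[OF k _ _ lagrangian.continuous_lagrangian[OF lag]])
    show "reg k (\<lambda>t. u t i + h * v t i)" if "i \<le> r" for i
      by (rule reg_add[OF u(1)[OF that] reg_cmult[OF v(1)[OF that]]])
    show "(\<lambda>i. u t i + h * v t i) \<in> jet_space r" for t
      using u(2)[of t] v(2)[of t] by (simp add: in_jet_space)
  qed
  obtain B1 B2 where B: "B1 > 0" "\<And>t i. t \<in> D (Suc k) \<Longrightarrow> \<bar>u t i\<bar> \<le> B1"
      "B2 > 0" "\<And>t i. t \<in> D (Suc k) \<Longrightarrow> \<bar>v t i\<bar> \<le> B2"
    using reg_family_bounded[OF k u] reg_family_bounded[OF k v] by blast
  have "\<bar>u t i\<bar> \<le> B1 + B2" "\<bar>v t i\<bar> \<le> B1 + B2" if "t \<in> D (Suc k)" for t i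
    using B(1,3) B(2)[OF that, of i] B(4)[OF that, of i] by auto
  then obtain \<eta> where \<eta>: "\<eta> > 0" "\<And>h t. \<bar>h\<bar> < \<eta> \<Longrightarrow> t \<in> D (Suc k) \<Longrightarrow>
      \<bar>L t (\<lambda>i. u t i + h * v t i) - L t (u t) - h * (\<Sum>i\<le>r. v t i * partial_u L i t (u t))\<bar> \<le> e * \<bar>h\<bar>"
    using lagrangian.first_order_expansion[OF lag D_subset[of "Suc k"], of u v "B1 + B2" e] u(2) v(2) B(1,3) e by force
  have est: "\<bar>J k (Q h) b - J k (Q 0) b - h * I\<bar> \<le> \<bar>h\<bar> * \<bar>I\<bar> / 2" if h: "\<bar>h\<bar> < \<eta>" for h
  proof -
    define R where "R t = 1 * Q h t + (-1) * (1 * Q 0 t + h * S t)" for t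
    have R: "reg k R" unfolding R_def by (intro reg_add reg_cmult Q S)
    have "\<bar>J k R b - J k R (s k) - 0 * (b - s k)\<bar> \<le> (e * \<bar>h\<bar>) * (b - s k)"
    proof (rule J_estimate[OF k R])
      fix x assume "s k < x" "x \<le> b"
      then have "tau x \<in> D (Suc k)" using tau_D k by auto
      from \<eta>(2)[OF h this] show "\<bar>R (tau x) - 0\<bar> \<le> e * \<bar>h\<bar>"
        by (simp add: R_def Q_def S_def algebra_simps)
    qed (use sb e in auto)
    moreover have "J k R b = 1 * J k (Q h) b + (-1) * J k (\<lambda>t. 1 * Q 0 t + h * S t) b"
      unfolding R_def by (intro J_linear k Q reg_add reg_cmult S order_refl)
    moreover have "J k (\<lambda>t. 1 * Q 0 t + h * S t) b = 1 * J k (Q 0) b + h * J k S b"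
      by (intro J_linear k Q S order_refl)
    ultimately have 1: "\<bar>J k (Q h) b - J k (Q 0) b - h * I\<bar> \<le> \<bar>h\<bar> * (e * (b - s k))"
      by (simp add: J_low I_def algebra_simps)
    have "e * (b - s k) \<le> \<bar>I\<bar> / 2" using sb by (simp add: e_def field_simps)
    then have "\<bar>h\<bar> * (e * (b - s k)) \<le> \<bar>h\<bar> * (\<bar>I\<bar> / 2)" by (intro mult_left_mono) auto
    with 1 show ?thesis by simp
  qed
  \<comment> \<open>The sign makes \<open>h * I\<close> positive: -h then refutes a minimum and h a
    maximum.\<close>
  define h where "h = min \<eta> \<delta> / 2 * sgn I"
  have I0: "I \<noteq> 0" using I by (simp add: I_def)
  have h: "\<bar>h\<bar> < \<eta>" "\<bar>h\<bar> < \<delta>" "h * I = \<bar>h\<bar> * \<bar>I\<bar>" "\<bar>h\<bar> * \<bar>I\<bar> > 0"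
    using \<eta>(1) \<delta> I0 by (auto simp: h_def abs_mult sgn_if min_def)
  have Q0: "Q 0 = (\<lambda>t. L t (u t))" by (simp add: Q_def fun_eq_iff)
  have h': "\<bar>- h\<bar> < \<eta>" "\<bar>- h\<bar> < \<delta>" using h by auto
  have e1: "\<bar>J k (Q h) b - J k (Q 0) b - \<bar>h\<bar> * \<bar>I\<bar>\<bar> \<le> \<bar>h\<bar> * \<bar>I\<bar> / 2"
    using est[OF h(1)] h(3) by simp
  have e2: "\<bar>J k (Q (- h)) b - J k (Q 0) b + \<bar>h\<bar> * \<bar>I\<bar>\<bar> \<le> \<bar>h\<bar> * \<bar>I\<bar> / 2"
    using est[OF h'(1)] h(3) by simp
  from extr show False
  proof
    assume "\<forall>h. \<bar>h\<bar> < \<delta> \<longrightarrow> J k (\<lambda>t. L t (u t)) b \<le> J k (\<lambda>t. L t (\<lambda>i. u t i + h * v t i)) b"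
    from this[rule_format, OF h'(2)] have "J k (Q 0) b \<le> J k (Q (- h)) b"
      unfolding Q0 unfolding Q_def .
    then show False using e2 h(4) by linarith
  next
    assume "\<forall>h. \<bar>h\<bar> < \<delta> \<longrightarrow> J k (\<lambda>t. L t (u t)) b \<ge> J k (\<lambda>t. L t (\<lambda>i. u t i + h * v t i)) b"
    from this[rule_format, OF h(2)] have "J k (Q 0) b \<ge> J k (Q h) b"
      unfolding Q0 unfolding Q_def .
    then show False using e1 h(4) by linarith
  qed
qed

subsection \<open>Integration by parts\<close>

text \<open>\<open>h i t - h i (rho X t)\<close> is \<open>h (Suc i) t\<close> times the gap length,
  so the zeros at b move back along the jumps, losing one order per step.\<close>

lemma vanish_near_b:
  assumes h: "dtower 0 r h" and r: "r \<le> N" and z: "\<And>i. i < r \<Longrightarrow> h i b = 0"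
    and ij: "i + j < r"
  shows "h i ((rho X ^^ j) b) = 0"
  using ij
proof (induction j arbitrary: i)
  case (Suc j)
  define t where "t = (rho X ^^ j) b"
  have "t \<in> D (Suc i)"
    unfolding t_def using Suc.prems r by (intro rho_pow_D b_in_D) auto
  then have "nd (h i) (h (Suc i) t) t" using Suc.prems by (intro dtower_nd[OF h]) auto
  from has_nabla_jump[OF this] show ?case
    using Suc.IH[of i] Suc.IH[of "Suc i"] Suc.prems by (simp add: t_def)
qed (use z in auto)

text \<open>The coefficient of the highest derivative after \<open>i\<close> integrations by parts.\<close>

primrec bulk :: "real \<Rightarrow> nat \<Rightarrow> (nat \<Rightarrow> real \<Rightarrow> real) \<Rightarrow> nat \<Rightarrow> real \<Rightarrow> real" where
  "bulk A r f 0 = f 0"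
| "bulk A r f (Suc i) = (\<lambda>t. A ^ (Suc i * (r - Suc i)) * f (Suc i) t - A ^ (r - Suc i) * J (r - 1) (bulk A r f i) t)"

lemma reg_bulk:
  assumes "r = Suc k" "k < N" "\<And>i. i \<le> r \<Longrightarrow> reg k (f i)" "i \<le> r"
  shows "reg k (bulk A r f i)"
  using assms(4)
proof (induction i)
  case (Suc i)
  have "reg k (\<lambda>t. A ^ (Suc i * (r - Suc i)) * f (Suc i) t - A ^ (r - Suc i) * J k (bulk A r f i) t)"
    using Suc assms by (intro reg_diff reg_cmult reg_J) auto
  then show ?case using assms(1) by simp
qed (use assms in auto)

text \<open>Each step integrates by parts with the antiderivative of the current coefficient. The
  sign and the chain rule factor \<open>A ^ (r - Suc i)\<close> enter the second term of
  \<open>bulk\<close>; its first term is the jet weight of the next coefficient.\<close>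

lemma J_bulk:
  assumes r: "r = Suc k" "k < N" and f: "\<And>i. i \<le> r \<Longrightarrow> reg k (f i)"
    and h: "tower 0 r h" and A: "affine_jump A \<or> r = 1"
    and low: "\<And>i t. i < r \<Longrightarrow> t \<le> s k \<Longrightarrow> h i t = 0" and hb: "\<And>i. i < r \<Longrightarrow> h i b = 0"
    and i: "i \<le> r"
  shows "J k (\<lambda>t. \<Sum>j\<le>i. tower_jet A r h t j * f j t) b = J k (\<lambda>t. bulk A r f i t * h i ((rho X ^^ (r - i)) t)) b"
  using i
proof (induction i)
  case 0
  then show ?case by (simp add: tower_jet_def mult.commute)
next
  case (Suc i)
  have hd: "dtower 0 r h" using h by (simp add: tower_def)
  have k: "k < N" and rN: "r \<le> N" using r by auto
  \<comment> \<open>One of the r - i jumps is supplied by the product rule; the other c stay inside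
    \<open>H\<close>.\<close>
  define c where "c = r - Suc i"
  have c: "r - i = Suc c" "i + c = k" using Suc.prems r by (auto simp: c_def)
  have Ac: "affine_jump A \<or> c = 0" using A c r by auto
  define B where "B = bulk A r f i"
  have B: "reg k B" unfolding B_def using Suc.prems f r by (intro reg_bulk) auto
  define H where "H t = h i ((rho X ^^ c) t)" for t
  define H' where "H' t = A ^ c * h (Suc i) ((rho X ^^ c) t)" for t
  have nH: "nd H (H' t) t" if t: "t \<in> D (Suc k)" for t
    unfolding H_def H'_def
  proof (rule has_nabla_comp_rho_pow[OF Ac])
    show "c < N" using c r by auto
    show "t \<in> D (Suc c)" using t D_antimono[of "Suc c" "Suc k"] c r by auto
    have "(rho X ^^ c) t \<in> D (0 + Suc i)" using rho_pow_D[of "Suc i" c t] t c r by simp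
    then show "nd (h i) (h (Suc i) ((rho X ^^ c) t)) ((rho X ^^ c) t)"
      using Suc.prems by (intro dtower_nd[OF hd]) auto
  qed
  have rH: "reg k (\<lambda>t. H (rho X t))"
    using nd_continuous_on[OF k, of H H'] nH by (intro reg_rho) auto
  have "reg k (\<lambda>t. tower_jet A r h t (Suc i))" using Suc.prems r A by (intro reg_tower_jet[OF h]) auto
  then have rj: "reg k (\<lambda>t. tower_jet A r h t (Suc i) * f (Suc i) t)" using f Suc.prems by (intro reg_mult) auto
  have rH': "reg k H'"
  proof -
    have "continuous_on (D c) (rho X ^^ c)" using Ac c r by (intro continuous_on_rho_pow) auto
    then have 1: "continuous_on (D (Suc k)) (rho X ^^ c)"
      using D_antimono[of c "Suc k"] c r continuous_on_subset by force
    have "continuous_on (D (Suc k)) (\<lambda>t. h (Suc i) ((rho X ^^ c) t))"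
      by (rule continuous_on_compose2[OF tower_continuous[OF h, of "Suc i"] 1])
        (use Suc.prems rN rho_pow_D[of "Suc i" c] c r in auto)
    then show ?thesis unfolding H'_def by (intro reg_cmult reg_continuous)
  qed
  have r1: "reg k (\<lambda>t. B t * H (rho X t))" "reg k (\<lambda>t. J k B t * H' t)"
    using B rH rH' k by (auto intro!: reg_mult reg_J)
  have ends: "H b = 0" "H (s k) = 0"
  proof -
    show "H b = 0" unfolding H_def using c r Suc.prems by (intro vanish_near_b[OF hd rN hb]) auto
    \<comment> \<open>The c jumps may move \<open>s k\<close> further left, which is why
      \<open>low\<close> covers all t \<le> \<open>s k\<close>.\<close>
    show "H (s k) = 0" unfolding H_def using Suc.prems rho_pow_le by (intro low) auto
  qed
  have "J k B b * H b - J k B (s k) * H (s k) = J k (\<lambda>t. 1 * (B t * H (rho X t)) + 1 * (J k B t * H' t)) b"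
  proof (rule nabla_FTC[OF k, where F = "\<lambda>x. J k B x * H x"])
    fix t assume t: "t \<in> D (Suc k)"
    from has_nabla_mult[OF closed J_nabla[OF k B t] nH[OF t]]
    show "nd (\<lambda>x. J k B x * H x) (1 * (B t * H (rho X t)) + 1 * (J k B t * H' t)) t" by simp
  qed (use r1 k b_in_D in \<open>auto intro!: reg_add\<close>)
  also have "\<dots> = 1 * J k (\<lambda>t. B t * H (rho X t)) b + 1 * J k (\<lambda>t. J k B t * H' t) b"
    by (intro J_linear k r1 order_refl)
  finally have ibp: "J k (\<lambda>t. B t * H (rho X t)) b = - J k (\<lambda>t. J k B t * H' t) b"
    using ends by simp
  have Hrho: "H (rho X t) = h i ((rho X ^^ (r - i)) t)" for t
    unfolding H_def c(1) by (simp add: funpow_swap1)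
  have rs: "reg k (\<lambda>t. \<Sum>j\<le>i. tower_jet A r h t j * f j t)"
    using Suc.prems r A by (intro reg_sum reg_mult f reg_tower_jet[OF h]) auto
  have "J k (\<lambda>t. \<Sum>j\<le>Suc i. tower_jet A r h t j * f j t) b
      = J k (\<lambda>t. 1 * (\<Sum>j\<le>i. tower_jet A r h t j * f j t) + 1 * (tower_jet A r h t (Suc i) * f (Suc i) t)) b"
    by simp
  also have "\<dots> = 1 * J k (\<lambda>t. \<Sum>j\<le>i. tower_jet A r h t j * f j t) b + 1 * J k (\<lambda>t. tower_jet A r h t (Suc i) * f (Suc i) t) b"
    by (rule J_linear[OF k rs rj order_refl])
  also have "J k (\<lambda>t. \<Sum>j\<le>i. tower_jet A r h t j * f j t) b = J k (\<lambda>t. B t * H (rho X t)) b"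
    using Suc.IH Suc.prems by (simp add: B_def Hrho)
  also have "1 * J k (\<lambda>t. B t * H (rho X t)) b + 1 * J k (\<lambda>t. tower_jet A r h t (Suc i) * f (Suc i) t) b
      = J k (\<lambda>t. 1 * (tower_jet A r h t (Suc i) * f (Suc i) t) + (-1) * (J k B t * H' t)) b"
    unfolding ibp J_linear[OF k rj r1(2) order_refl] by simp
  also have "\<dots> = J k (\<lambda>t. bulk A r f (Suc i) t * h (Suc i) ((rho X ^^ (r - Suc i)) t)) b"
    using Suc.prems r by (simp add: tower_jet_def B_def H'_def c_def algebra_simps)
  finally show ?case .
qed

text \<open>A tower over \<open>D r\<close> is integrated r times from \<open>s (r - 1)\<close>:
  \<open>w 0\<close> becomes the r-th derivative, and the left boundary conditions hold
  automatically.\<close>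

definition test_family :: "nat \<Rightarrow> (nat \<Rightarrow> real \<Rightarrow> real) \<Rightarrow> nat \<Rightarrow> real \<Rightarrow> real" where
  "test_family r w i = (if i < r then iterJ (r - 1) (w 0) (r - i) else w (i - r))"

lemma test_family_low: "i < r \<Longrightarrow> t \<le> s (r - 1) \<Longrightarrow> test_family r w i t = 0"
  by (cases "r - i") (auto simp: test_family_def J_low)

lemma tower_test_family:
  assumes r: "r = Suc k" and N: "N = 2 * r" and w: "tower r r w"
  shows "tower 0 (2 * r) (test_family r w)"
proof -
  have k: "k < N" using r N by simp
  have rw: "reg k (w 0)" using tower_continuous[OF w, of 0] r N by (auto intro: reg_continuous)
  have eq: "test_family r w i = iterJ k (w 0) (r - i)" if "i \<le> r" for i
    using that r by (auto simp: test_family_def)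
  have "nd (test_family r w i) (test_family r w (Suc i) t) t" if i: "i < 2 * r" and t: "t \<in> D (Suc i)" for i t
  proof (cases "i < r")
    case False
    then have "i - r < r" "t \<in> D (r + Suc (i - r))" using i t by auto
    then have "nd (w (i - r)) (w (Suc (i - r)) t) t" by (rule tower_nd[OF w])
    then show ?thesis using False by (simp add: test_family_def Suc_diff_le)
  next
    case True
    then have ri: "r - i = Suc (r - Suc i)" by simp
    show ?thesis
    proof (cases "t \<in> D r")
      case True
      then show ?thesis
        using J_nabla[OF k reg_iterJ[OF k rw], of t "r - Suc i"] \<open>i < r\<close> r eq[of i] eq[of "Suc i"] ri by simp
    next
      \<comment> \<open>Here t precedes \<open>s r\<close> and hence is at most \<open>s k\<close>;
        the members of index below r vanish identically near t.\<close>
      case False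
      have tX: "t \<in> X" using t D_subset by auto
      have lt: "t < s r" using False tX by (auto simp: D_def)
      have low: "x \<le> s k" if "x \<in> X" "x < s r" for x
        using s_step[OF k that(1)] that(2) r by (cases "s k < x") auto
      have "Suc i < r" using False t \<open>i < r\<close> by (cases "Suc i = r") auto
      then have 0: "test_family r w (Suc i) t = 0" using low[OF tX lt] r by (intro test_family_low) auto
      have z: "test_family r w i x = 0" if "x \<in> X" "x < s r" for x
        using low[OF that] r \<open>i < r\<close> by (intro test_family_low) auto
      have "nd (test_family r w i) 0 t"
      proof (rule has_nabla_local[OF has_nabla_const[OF tX rho_in_X[OF tX], of 0]])
        show "0 < s r - t" using lt by simp
        show "x \<in> X \<and> test_family r w i x = 0" if "x \<in> X" "\<bar>x - t\<bar> < s r - t" for x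
          using z that by auto
        show "test_family r w i (rho X t) = 0" using z rho_in_X[OF tX] rho_le[of X t] lt by auto
      qed (use tX rho_in_X in auto)
      with 0 show ?thesis by simp
    qed
  qed
  moreover have "continuous_on (D (2 * r)) (test_family r w (2 * r))"
    using w by (simp add: tower_def test_family_def mult_2)
  ultimately show ?thesis by (simp add: tower_def dtower_def)
qed

text \<open>The recursion of \<open>bulk\<close> with the integrals cancelled: with
  \<open>F j\<close> the j-th derivative of the j-th coefficient at a point, it is the i-th
  derivative of \<open>bulk A r f i\<close> there.\<close>

primrec bulk_deriv :: "real \<Rightarrow> nat \<Rightarrow> (nat \<Rightarrow> real) \<Rightarrow> nat \<Rightarrow> real" where
  "bulk_deriv A r F 0 = F 0"
| "bulk_deriv A r F (Suc i) = A ^ (Suc i * (r - Suc i)) * F (Suc i) - A ^ (r - Suc i) * bulk_deriv A r F i"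

lemma dtower_Suc_case:
  assumes "\<And>t. t \<in> D (Suc k) \<Longrightarrow> nd g (q 0 t) t" and q: "dtower k n q" and "k + Suc n \<le> N"
  shows "dtower k (Suc n) (\<lambda>j. case j of 0 \<Rightarrow> g | Suc j \<Rightarrow> q j)"
  unfolding dtower_def
proof (intro allI impI ballI)
  fix j t assume j: "j < Suc n" and t: "t \<in> D (k + Suc j)"
  show "nd (case j of 0 \<Rightarrow> g | Suc j \<Rightarrow> q j) ((case Suc j of 0 \<Rightarrow> g | Suc j \<Rightarrow> q j) t) t"
  proof (cases j)
    case 0
    then show ?thesis using assms(1) t by simp
  next
    case (Suc i)
    then have "t \<in> D (k + Suc i)" using t D_antimono[of "k + Suc i" "k + Suc j"] j assms(3) by auto
    then show ?thesis using dtower_nd[OF q, of i t] j Suc by simp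
  qed
qed

text \<open>By induction the integral of \<open>bulk A r f i\<close> has i + 1 derivatives, and
  \<open>f (Suc i)\<close> has them by hypothesis. For i = r the argument is later reversed, to
  obtain the derivatives of \<open>f r\<close>.\<close>

lemma dtower_bulk:
  assumes r: "r = Suc k" and N: "N = 2 * r" and f: "\<And>i. i \<le> r \<Longrightarrow> reg k (f i)"
    and df: "\<And>i. 1 \<le> i \<Longrightarrow> i < r \<Longrightarrow> nabla_differentiable X (D r) i (f i)" and i: "i < r"
  shows "\<exists>q. dtower r i q \<and> (\<forall>t\<in>D r. q 0 t = bulk A r f i t) \<and>
    (\<forall>t\<in>D (r + i). q i t = bulk_deriv A r (\<lambda>j. nabla_deriv X (D r) j (f j) t) i)"
  using i
proof (induction i)
  case 0
  have "dtower r 0 (\<lambda>_. f 0)" by (simp add: dtower_def)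
  then show ?case by (intro exI[of _ "\<lambda>_. f 0"]) auto
next
  case (Suc i)
  then obtain q where q: "dtower r i q" "\<And>t. t \<in> D r \<Longrightarrow> q 0 t = bulk A r f i t"
    "\<And>t. t \<in> D (r + i) \<Longrightarrow> q i t = bulk_deriv A r (\<lambda>j. nabla_deriv X (D r) j (f j) t) i" by auto
  have k: "k < N" using r N by simp
  have B: "reg k (bulk A r f i)" using Suc.prems by (intro reg_bulk[OF r k f]) auto
  define Q where "Q j = (case j of 0 \<Rightarrow> J k (bulk A r f i) | Suc j \<Rightarrow> q j)" for j
  have "nd (J k (bulk A r f i)) (q 0 t) t" if "t \<in> D (Suc r)" for t
  proof -
    have "t \<in> D r" using that D_Suc_subset[of r] N r by auto
    then show ?thesis using J_nabla[OF k B, of t] q(2) r by simp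
  qed
  then have Q: "dtower r (Suc i) Q"
    unfolding Q_def[abs_def] using q(1) Suc.prems N by (intro dtower_Suc_case) auto
  define G where "G j = nabla_deriv X (D r) j (f (Suc i))" for j
  have G: "dtower r (Suc i) G"
    unfolding G_def using Suc.prems N by (intro dtower_nabla_deriv df) auto
  let ?Q = "\<lambda>j t. A ^ (Suc i * (r - Suc i)) * G j t + (- (A ^ (r - Suc i))) * Q j t"
  have "dtower r (Suc i) ?Q" using G Q by (rule dtower_comb)
  moreover have "?Q 0 t = bulk A r f (Suc i) t" for t using r by (simp add: G_def Q_def)
  moreover have "?Q (Suc i) t = bulk_deriv A r (\<lambda>j. nabla_deriv X (D r) j (f j) t) (Suc i)" if "t \<in> D (r + Suc i)" for t
  proof -
    have "t \<in> D (r + i)" using that D_antimono[of "r + i" "r + Suc i"] Suc.prems N by auto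
    then show ?thesis using q(3) by (simp add: G_def Q_def del: nabla_deriv.simps)
  qed
  ultimately show ?case by (intro exI[of _ ?Q]) auto
qed

text \<open>With d = r - i - 1 and T i = i (i - 1) / 2 the exponents satisfy
  \<open>Suc i * d + T (Suc i) = d + (i * Suc d + T i)\<close>. So the powers of A collect into one
  common factor, and the j-th summand keeps the weight \<open>(1 / A) ^ T j\<close>.\<close>

lemma bulk_deriv_closed:
  assumes A: "A > 0" and i: "i < r"
  shows "bulk_deriv A r F i = (-1) ^ i * A ^ (i * (r - i) + i * (i - 1) div 2) *
    (\<Sum>j\<le>i. (-1) ^ j * (1 / A) ^ (j * (j - 1) div 2) * F j)"
  using i
proof (induction i)
  case (Suc i)
  define T where "T i = i * (i - 1) div 2" for i :: nat
  have TS: "T (Suc i) = T i + i"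
  proof -
    have "Suc i * (Suc i - 1) = i * (i - 1) + i * 2" by (cases i) auto
    then show ?thesis unfolding T_def by simp
  qed
  define d where "d = r - Suc i"
  have rd: "r = i + Suc d" "r - i = Suc d" using Suc.prems by (auto simp: d_def)
  define P where "P = (\<Sum>j\<le>i. (-1) ^ j * (1 / A) ^ T j * F j)"
  have IH: "bulk_deriv A r F i = (-1) ^ i * A ^ (i * Suc d + T i) * P"
    using Suc by (simp add: T_def P_def rd)
  have e: "Suc i * d + T (Suc i) = d + (i * Suc d + T i)" by (simp add: TS algebra_simps)
  have e2: "Suc i * d + T (Suc i) = T (Suc i) + Suc i * d" by simp
  have "bulk_deriv A r F (Suc i) = A ^ (Suc i * d) * F (Suc i) - A ^ d * ((-1) ^ i * A ^ (i * Suc d + T i) * P)"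
    by (simp add: IH d_def)
  also have "A ^ d * ((-1) ^ i * A ^ (i * Suc d + T i) * P) = (-1) ^ i * A ^ (Suc i * d + T (Suc i)) * P"
    unfolding e by (simp add: power_add mult_ac)
  also have "A ^ (Suc i * d) * F (Suc i) = (-1) ^ Suc i * A ^ (Suc i * d + T (Suc i)) * ((-1) ^ Suc i * (1 / A) ^ T (Suc i) * F (Suc i))"
  proof -
    have 1: "(-1::real) ^ Suc i * (-1) ^ Suc i = 1" by (simp flip: power_mult_distrib)
    have 2: "A ^ T (Suc i) * (1 / A) ^ T (Suc i) = 1" using A by (simp flip: power_mult_distrib)
    have "x * A ^ (p + q) * (x * c * y) = A ^ p * ((x * x) * (A ^ q * c)) * y" for x y c and p q :: nat
      unfolding power_add by (simp only: mult_ac)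
    then show ?thesis by (simp only: 1 2 mult_1_right)
  qed
  finally have "bulk_deriv A r F (Suc i) = (-1) ^ Suc i * A ^ (Suc i * d + T (Suc i)) *
      (P + (-1) ^ Suc i * (1 / A) ^ T (Suc i) * F (Suc i))"
    by (simp add: algebra_simps)
  then show ?case by (simp only: P_def T_def d_def sum.atMost_Suc)
qed simp

text \<open>\<open>f i\<close> plays the role of \<open>L\<^bsub>u\<^sub>i\<^esub>\<close> along the extremal.\<close>

theorem euler_lagrange_of_orthogonal:
  assumes r: "r \<ge> 1" and N: "N = 2 * r" and A: "A > 0" "affine_jump A \<or> r = 1"
    and f: "\<And>i. i \<le> r \<Longrightarrow> reg (r - 1) (f i)"
    and df: "\<And>i. 1 \<le> i \<Longrightarrow> i < r \<Longrightarrow> nabla_differentiable X (D r) i (f i)"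
    and ort: "\<And>h. tower 0 (2 * r) h \<Longrightarrow> (\<And>i t. i < r \<Longrightarrow> t \<le> s (r - 1) \<Longrightarrow> h i t = 0) \<Longrightarrow>
      (\<And>i. i < r \<Longrightarrow> h i b = 0) \<Longrightarrow> J (r - 1) (\<lambda>t. \<Sum>i\<le>r. tower_jet A r h t i * f i t) b = 0"
  shows "nabla_differentiable X (D r) r (f r) \<and>
    (\<forall>t\<in>D (2 * r). (\<Sum>i\<le>r. (-1) ^ i * (1 / A) ^ (i * (i - 1) div 2) * nabla_deriv X (D r) i (f i) t) = 0)"
proof -
  obtain k where rk: "r = Suc k" using r by (cases r) auto
  have k: "k < N" "k + r < N" using rk N by auto
  have fk: "reg k (f i)" if "i \<le> r" for i using f[OF that] rk by simp
  have "\<exists>q. dtower (Suc k) r q \<and> (\<forall>t\<in>D (Suc k). q 0 t = bulk A r f r t) \<and> (\<forall>t\<in>D (Suc k + r). q r t = 0)"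
  proof (rule du_bois_reymond[OF k(2)])
    show "r \<le> 1 \<or> affine_jump A" using A by auto
    show "reg k (bulk A r f r)" by (rule reg_bulk[OF rk k(1) fk order_refl])
    fix w assume w: "tower (Suc k) r w" and z: "\<And>i. i < r \<Longrightarrow> iterJ k (w 0) (Suc i) b = 0"
    define h where "h = test_family r w"
    have h: "tower 0 (2 * r) h" unfolding h_def using w rk by (intro tower_test_family[OF rk N]) auto
    have low: "h i t = 0" if "i < r" "t \<le> s k" for i t
      unfolding h_def using that rk by (intro test_family_low) auto
    \<comment> \<open>The iterated integrals at b are exactly the boundary data of the variation at
      b.\<close>
    have hb: "h i b = 0" if "i < r" for i
      using z[of "r - Suc i"] that rk by (simp add: h_def test_family_def Suc_diff_le)
    have h': "tower 0 r h"
      using h tower_continuous[OF h, of r] N by (auto simp: tower_def dtower_def)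
    have "J k (\<lambda>t. bulk A r f r t * h r ((rho X ^^ (r - r)) t)) b = 0"
      using J_bulk[where f = f, OF rk k(1) fk h' A(2) low hb order_refl] ort[OF h] low hb rk by simp
    then show "J k (\<lambda>t. bulk A r f r t * w 0 t) b = 0" by (simp add: h_def test_family_def)
  qed
  then obtain p where p: "dtower r r p" "\<And>t. t \<in> D r \<Longrightarrow> p 0 t = bulk A r f r t" "\<And>t. t \<in> D (r + r) \<Longrightarrow> p r t = 0"
    using rk by auto
  define F where "F t j = nabla_deriv X (D r) j (f j) t" for t j
  obtain q where q: "dtower r k q" "\<And>t. t \<in> D r \<Longrightarrow> q 0 t = bulk A r f k t"
    "\<And>t. t \<in> D (r + k) \<Longrightarrow> q k t = bulk_deriv A r (F t) k"
    using dtower_bulk[OF rk N fk df, of k A] rk unfolding F_def by auto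
  define Q where "Q j = (case j of 0 \<Rightarrow> J k (bulk A r f k) | Suc j \<Rightarrow> q j)" for j
  have B: "reg k (bulk A r f k)" using rk by (intro reg_bulk[OF rk k(1) fk]) auto
  have "nd (J k (bulk A r f k)) (q 0 t) t" if "t \<in> D (Suc r)" for t
  proof -
    have "t \<in> D r" using that D_Suc_subset[of r] N rk by auto
    then show ?thesis using J_nabla[OF k(1) B, of t] q(2) rk by simp
  qed
  then have Q: "dtower r r Q"
    unfolding Q_def[abs_def] using dtower_Suc_case[of r _ q k] q(1) N rk by simp
  \<comment> \<open>For i = r both powers of A in \<open>bulk\<close> are 1, so \<open>f r\<close>
    is the polynomial \<open>p 0\<close> plus the integral of \<open>bulk A r f k\<close>.\<close>
  define R where "R j t = 1 * p j t + 1 * Q j t" for j t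
  have R: "dtower r r R" unfolding R_def[abs_def] using p(1) Q by (rule dtower_comb)
  have R0: "R 0 t = f r t" if "t \<in> D r" for t
    using p(2)[OF that] rk by (simp add: R_def Q_def)
  have diff: "nabla_differentiable X (D r) r (f r)"
    using N by (intro nabla_differentiable_dtower[OF R _ R0]) auto
  have "(\<Sum>i\<le>r. (-1) ^ i * (1 / A) ^ (i * (i - 1) div 2) * F t i) = 0" if t: "t \<in> D (2 * r)" for t
  proof -
    have t': "t \<in> D (r + r)" using t by (simp add: mult_2)
    have "t \<in> D (r + k)" using t' D_antimono[of "r + k" "r + r"] rk N by auto
    then have "R r t = bulk_deriv A r (F t) k" using p(3)[OF t'] q(3) rk by (simp add: R_def Q_def)
    moreover have "F t r = R r t"
      unfolding F_def using N t' by (intro nabla_deriv_dtower[OF R _ R0]) auto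
    ultimately have Fr: "F t r = bulk_deriv A r (F t) k" by simp
    define e where "e = r * (r - 1) div 2"
    \<comment> \<open>As r - k = 1, the common factor in \<open>bulk_deriv_closed\<close> is
      \<open>A ^ e\<close>, which cancels the weight of the last summand.\<close>
    have e: "k * (r - k) + k * (k - 1) div 2 = e"
    proof -
      have "r * (r - 1) = k * (k - 1) + k * 2" using rk by (cases k) auto
      then show ?thesis using rk by (simp add: e_def)
    qed
    define P where "P = (\<Sum>j\<le>k. (-1) ^ j * (1 / A) ^ (j * (j - 1) div 2) * F t j)"
    have "F t r = (-1) ^ k * A ^ e * P"
      unfolding Fr P_def using bulk_deriv_closed[OF A(1), of k r "F t"] rk e by simp
    moreover have "(\<Sum>i\<le>r. (-1) ^ i * (1 / A) ^ (i * (i - 1) div 2) * F t i) = P + (-1) ^ r * (1 / A) ^ e * F t r"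
      unfolding rk e_def P_def by simp
    moreover have "(-1) ^ r * (1 / A) ^ e * ((-1) ^ k * A ^ e * P) = - P"
    proof -
      have 1: "(-1::real) ^ r * (-1) ^ k = -1" using rk by (simp flip: power_mult_distrib)
      have 2: "(1 / A) ^ e * A ^ e = 1" using A(1) by (simp flip: power_mult_distrib)
      have "(-1) ^ r * (1 / A) ^ e * ((-1) ^ k * A ^ e * P) = ((-1) ^ r * (-1) ^ k) * ((1 / A) ^ e * A ^ e) * P"
        by (simp only: mult_ac)
      then show ?thesis unfolding 1 2 by simp
    qed
    ultimately show ?thesis by simp
  qed
  with diff show ?thesis by (simp add: F_def)
qed

text \<open>For t > a the jumps of \<open>X\<close> and T agree. The endpoint a belongs to
  \<open>D 1\<close> only if it is a limit point of \<open>X\<close>, and then the law reaches it by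
  letting x decrease to a in a \<le> \<open>A * x + a0\<close> \<le> x.\<close>

lemma affine_interval:
  assumes T: "closed T" and X: "X = ts_interval T a b" and a: "a \<in> T" "s 0 = a"
    and N: "N > 0" and A: "A > 0" and aff: "\<And>t. t \<in> T \<Longrightarrow> rho T t = A * t + a0"
  shows "affine_jump A"
  unfolding affine_jump_def
proof (intro conjI exI[of _ a0] ballI)
  fix t assume t: "t \<in> D 1"
  have tX: "t \<in> X" using t by (simp add: D_def)
  then have tX: "t \<in> X" "t \<in> T" "a \<le> t" by (auto simp: X ts_interval_def)
  have gt: "rho X x = A * x + a0" if "x \<in> X" "a < x" for x
    using rho_interval[OF T X a(1) that] aff that by (auto simp: X ts_interval_def)
  show "rho X t = A * t + a0"
  proof (cases "t = a")
    case False
    then show ?thesis using gt tX by auto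
  next
    case True
    have "s 0 = s 1" using t True a s_mono[of 0] N by (auto simp: D_def)
    then have lim: "a islimpt X" using s_dense[of 0] N a by auto
    have "\<bar>A * a + a0 - a\<bar> \<le> 0"
    proof (rule field_le_epsilon)
      fix e :: real assume e: "e > 0"
      then have "e / (A + 1) > 0" using A by simp
      then obtain x where x: "x \<in> X" "x \<noteq> a" "dist x a < e / (A + 1)"
        using lim unfolding islimpt_approachable by blast
      then have ax: "a < x" by (auto simp: X ts_interval_def)
      have "a \<le> rho X x" using a tX True ax by (intro rho_ge) auto
      then have 1: "a \<le> A * x + a0" "A * x + a0 \<le> x" using gt[OF x(1) ax] rho_le[of X x] by auto
      have "(A + 1) * (x - a) \<le> e" using x(3) ax A by (simp add: dist_real_def field_simps)
      then have 2: "A * x - A * a + x - a \<le> e" by (simp add: algebra_simps)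
      have "A * a \<le> A * x" using A ax by simp
      then show "\<bar>A * a + a0 - a\<bar> \<le> 0 + e" using 1 2 ax by linarith
    qed
    moreover have "rho X a = a" using rho_le[of X a] rho_in_X[of a] tX True by (auto simp: X ts_interval_def)
    ultimately show ?thesis using True by simp
  qed
qed (rule A)

lemma weak_norm_tower:
  assumes h: "dtower 0 r h" and r: "r \<le> N" "D 0 = X" "affine_jump A \<or> r = 1"
    and M: "\<And>t i. t \<in> D r \<Longrightarrow> \<bar>tower_jet A r h t i\<bar> \<le> M"
  shows "weak_norm X r (\<lambda>t. \<eta> * h 0 t) \<le> (real r + 1) * (\<bar>\<eta>\<bar> * M)"
proof -
  have h': "dtower 0 r (\<lambda>i x. \<eta> * h i x)" using dtower_comb[OF h h, of \<eta> 0] by simp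
  have "(SUP t\<in>D r. \<bar>rho_nabla X (r - i) i (\<lambda>t. \<eta> * h 0 t) t\<bar>) \<le> \<bar>\<eta>\<bar> * M" if i: "i \<le> r" for i
  proof (rule cSUP_least)
    show "D r \<noteq> {}" using b_in_D r by auto
    fix t assume t: "t \<in> D r"
    have "rho_nabla X (r - i) i (\<lambda>t. \<eta> * h 0 t) t = tower_jet A r (\<lambda>i x. \<eta> * h i x) t i"
      by (rule rho_nabla_tower[OF h' r t i])
    also have "\<dots> = \<eta> * tower_jet A r h t i" by (simp add: tower_jet_def)
    finally show "\<bar>rho_nabla X (r - i) i (\<lambda>t. \<eta> * h 0 t) t\<bar> \<le> \<bar>\<eta>\<bar> * M"
      using M[OF t, of i] by (simp add: abs_mult mult_left_mono)
  qed
  moreover have "(kappa ^^ r) X = D r" using kappa_pow_D[of 0 r] r by simp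
  ultimately have "weak_norm X r (\<lambda>t. \<eta> * h 0 t) \<le> (\<Sum>i\<le>r. \<bar>\<eta>\<bar> * M)"
    unfolding weak_norm_def by (intro sum_mono) auto
  then show ?thesis by (simp add: algebra_simps)
qed

end

subsection \<open>The Euler-Lagrange equation\<close>

text \<open>The rank condition \<open>rho X t \<in> (kappa ^^ k) X\<close> excludes that \<open>\<sigma>\<^bsup>k\<^esup>(a)\<close> is right-dense but
  left-scattered: either \<open>a\<close> is right-dense or the first \<open>N\<close> points \<open>a, \<sigma>(a), \<dots>\<close> are all right-scattered.\<close>

lemma nabla_chain_interval:
  assumes T: "closed T" and X: "X = ts_interval T a b" and ab: "a \<in> T" "b \<in> T" "a < b"
    and card: "infinite X \<or> card X \<ge> N + 1"
    and rank: "\<And>k t. k < N \<Longrightarrow> t \<in> (kappa ^^ Suc k) X \<Longrightarrow> rho X t \<in> (kappa ^^ k) X"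
  shows "nabla_chain X (\<lambda>k. (sigma T ^^ k) a) b N"
proof -
  define s where "s k = (sigma T ^^ k) a" for k
  have Xi: "X = T \<inter> {a..b}" by (auto simp: X ts_interval_def)
  have cX: "compact X" unfolding Xi using T compact_Icc[of a b] closed_Int_compact by blast
  have aX: "a \<in> X" "b \<in> X" using ab by (auto simp: Xi)
  have max: "t \<le> b" and XT: "t \<in> T" and min: "a \<le> t" if "t \<in> X" for t using that by (auto simp: Xi)
  have sS: "s (Suc k) = sigma T (s k)" and s0: "s 0 = a" for k by (simp_all add: s_def)
  have "nabla_chain X s b N"
  proof (cases "sigma T a = a")
    case True
    have s: "s k = a" for k by (induction k) (simp_all add: s0 sS True)
    show ?thesis
      using cX aX max min sigma_fixed_imp_islimpt[OF T X aX(1) ab(3,2) True]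
      by unfold_locales (auto simp: s)
  next
    case False
    \<comment> \<open>The count of points below \<open>s k\<close> serves twice: with the
      cardinality of \<open>X\<close> it keeps \<open>s k\<close> below b, and its finiteness
      prevents a later \<open>s k\<close> from being left-dense.\<close>
    define P where "P k \<longleftrightarrow> s k \<in> X \<and> (kappa ^^ k) X = {t\<in>X. s k \<le> t} \<and>
      finite {t\<in>X. t < s k} \<and> card {t\<in>X. t < s k} = k" for k
    have lt_b: "s k < b" if "P k" "k < N" for k
    proof (rule ccontr)
      assume "\<not> s k < b"
      then have eq: "X = insert (s k) {t\<in>X. t < s k}" using that max[of "s k"] max by (force simp: P_def)
      have fin: "finite {t\<in>X. t < s k}" "card {t\<in>X. t < s k} = k" using that by (simp_all add: P_def)
      have "finite X" by (rule finite_subset[OF eq_refl[OF eq] finite.insertI[OF fin(1)]])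
      moreover have "card X \<le> Suc k"
        using card_insert_le_m1[of "Suc k" "{t\<in>X. t < s k}" "s k"] fin eq by simp
      ultimately show False using card that by auto
    qed
    have next_gt: "s k < s (Suc k)" if P: "P k" and k: "k < N" for k
    proof (rule ccontr)
      have sk: "s k \<in> X" "s k < b" using P lt_b[OF P k] by (auto simp: P_def)
      note sp = sigma_properties[OF T XT[OF sk(1)] sk(2) ab(2)]
      assume "\<not> s k < s (Suc k)"
      then have fx: "sigma T (s k) = s k" using sp(2) by (simp add: sS)
      then have k0: "k \<noteq> 0" using False s0 by (cases k) auto
      define S where "S = {t\<in>X. t < s k}"
      have "finite S" "card S = k" using P by (simp_all add: P_def S_def)
      then have S: "finite S" "S \<noteq> {}" using k0 by auto
      have sg: "sigma {t\<in>X. s k \<le> t} (s k) = s k" using sigma_interval[OF T X sk ab(2) refl] fx by simp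
      \<comment> \<open>A right-dense \<open>s k\<close> survives \<open>kappa\<close>, so the rank
        condition forces \<open>rho X (s k) = s k\<close>, against the finitely many points below
        it.\<close>
      have "kappa {t\<in>X. s k \<le> t} = {t\<in>X. s k \<le> t}"
        by (subst kappa_min[of "s k"]) (use sk sg in simp_all)
      then have "s k \<in> kappa {t\<in>X. s k \<le> t}" using sk by simp
      then have "s k \<in> (kappa ^^ Suc k) X" using P by (simp add: P_def)
      then have "rho X (s k) \<in> {t\<in>X. s k \<le> t}" using rank[OF k] P by (simp add: P_def)
      then have rd: "rho X (s k) = s k" using rho_le[of X "s k"] by auto
      define x where "x = Max S"
      have x: "x \<in> X" "x < s k" using Max_in[OF S] by (auto simp: x_def S_def)
      obtain z where z: "z \<in> X" "s k - (s k - x) < z" "z < s k"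
        using left_dense_approx[OF rd x, of "s k - x"] x by auto
      then have "z \<le> x" using S unfolding x_def by (intro Max_ge) (auto simp: S_def)
      then show False using z by simp
    qed
    have P: "P k" if "k \<le> N" for k
      using that
    proof (induction k)
      case 0
      have e: "{t\<in>X. t < a} = {}" using min by force
      show ?case unfolding P_def s0 e using aX min by auto
    next
      case (Suc k)
      then have Pk: "P k" and k: "k < N" by auto
      have sk: "s k \<in> X" "s k < b" using Pk lt_b[OF Pk k] by (auto simp: P_def)
      note sp = sigma_properties[OF T XT[OF sk(1)] sk(2) ab(2)]
      note gt = next_gt[OF Pk k]
      have sg: "s k < sigma {t\<in>X. s k \<le> t} (s k)" using sigma_interval[OF T X sk ab(2) refl] gt by (simp add: sS)
      have in_X: "s (Suc k) \<in> X" using sp min[OF sk(1)] by (auto simp: Xi sS)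
      have "kappa {t\<in>X. s k \<le> t} = {t\<in>X. s k \<le> t} - {s k}"
        by (subst kappa_min[of "s k"]) (use sk sg in simp_all)
      also have "\<dots> = {t\<in>X. s (Suc k) \<le> t}"
        using sp(4) gt XT by (fastforce simp: sS)
      finally have 1: "(kappa ^^ Suc k) X = {t\<in>X. s (Suc k) \<le> t}" using Pk by (simp add: P_def)
      have 2: "{t\<in>X. t < s (Suc k)} = insert (s k) {t\<in>X. t < s k}"
        using sp(4) gt XT sk by (fastforce simp: sS not_le[symmetric])
      show ?case using in_X 1 2 Pk by (auto simp: P_def)
    qed
    show ?thesis
    proof
      show "s k \<le> s (Suc k)" if "k < N" for k using next_gt[OF P that] that by auto
      show "s (Suc k) \<le> t" if "k < N" "t \<in> X" "s k < t" for k t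
      proof -
        have Pk: "P k" using P that by auto
        have sk: "s k \<in> X" "s k < b" using Pk lt_b[OF Pk that(1)] by (auto simp: P_def)
        show ?thesis unfolding sS
          using sigma_properties(4)[OF T XT[OF sk(1)] sk(2) ab(2) XT[OF that(2)] that(3)] .
      qed
      show "(\<forall>t\<in>X. s k \<le> t) \<and> s k islimpt X" if "k < N" "s k = s (Suc k)" for k
        using next_gt[OF P that(1)] that by auto
    qed (use cX aX max P in \<open>auto simp: P_def\<close>)
  qed
  then show ?thesis by (simp add: s_def[abs_def])
qed

text \<open>The terms with 0 < i < r are genuine derivatives by hypothesis; the first conjunct
  establishes the same for i = r, so that no definite description in the sum is void.\<close>

theorem theorem17:
  fixes T X :: "real set" and r :: nat and a b a1 a0 :: real
    and \<alpha> \<beta> :: "nat \<Rightarrow> real"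
    and L :: "real \<Rightarrow> (nat \<Rightarrow> real) \<Rightarrow> real"
    and y :: "real \<Rightarrow> real"
  defines "X \<equiv> ts_interval T a b"
  assumes "r \<ge> 1"
    and "time_scale T"
    and "r = 1 \<or> (a1 > 0 \<and> (\<forall>t\<in>T. rho T t = a1 * t + a0))"
    and "a \<in> T" and "b \<in> T" and "a < b"
    and "infinite X \<or> card X \<ge> 2 * r + 1"
    and "\<And>i t u. i \<le> r \<Longrightarrow> t \<in> X \<Longrightarrow> u \<in> topspace (Euclidean_space (Suc r)) \<Longrightarrow>
           (\<lambda>x. L t (u(i := x))) differentiable (at (u i))"
    and "\<And>i. i \<le> r \<Longrightarrow>
           continuous_on (X \<times> topspace (Euclidean_space (Suc r))) (\<lambda>(t, u). partial_u L i t u)"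
    and "\<And>u. u \<in> topspace (Euclidean_space (Suc r)) \<Longrightarrow>
           nabla_differentiable X X (r + 1) (\<lambda>t. L t u)"
    and "weak_local_extremum T a b r L \<alpha> \<beta> y"
    and "\<And>i. 1 \<le> i \<Longrightarrow> i < r \<Longrightarrow>
           nabla_differentiable X ((kappa ^^ r) X) i (\<lambda>t. partial_u L i t (jet X r y t))"
  shows "nabla_differentiable X ((kappa ^^ r) X) r (\<lambda>t. partial_u L r t (jet X r y t)) \<and>
    (\<forall>t\<in>(kappa ^^ (2 * r)) X.
       (\<Sum>i\<le>r. (-1) ^ i * (1 / a1) ^ (i * (i - 1) div 2) *
          nabla_deriv X ((kappa ^^ r) X) i (\<lambda>s. partial_u L i s (jet X r y s)) t) = 0)"
proof -
  have T: "closed T" using assms(3) by (simp add: time_scale_def)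
  have Xe: "X = ts_interval T a b" by (simp add: X_def)
  note ext = assms(12)
  have adm_y: "admissible T a b r \<alpha> \<beta> y"
    using ext by (auto simp: weak_local_extremum_def weak_local_minimizer_def weak_local_maximizer_def)
  have y_diff: "nabla_differentiable X X (2 * r) y"
    and y_cont: "continuous_on ((kappa ^^ (2 * r)) X) (nabla_deriv X X (2 * r) y)"
    using adm_y by (auto simp: admissible_def Let_def C_nabla_def X_def)
  define s where "s k = (sigma T ^^ k) a" for k
  interpret nabla_chain X s b "2 * r"
    unfolding s_def
  proof (rule nabla_chain_interval[OF T Xe assms(5-7)])
    show "infinite X \<or> card X \<ge> 2 * r + 1" by (rule assms(8))
    \<comment> \<open>The rank condition is read off from y: differentiability at t includes that
      \<open>rho X t\<close> lies in the current domain.\<close>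
    show "rho X t \<in> (kappa ^^ k) X" if "k < 2 * r" "t \<in> (kappa ^^ Suc k) X" for k t
      using y_diff that has_nabla_in unfolding nabla_differentiable_def by blast
  qed
  define k where "k = r - 1"
  have rk: "Suc k = r" "k < 2 * r" "r \<le> 2 * r" using assms(2) by (auto simp: k_def)
  have "a \<le> t" if "t \<in> X" for t using that by (simp add: Xe ts_interval_def)
  then have X0: "D 0 = X" by (auto simp: D_def s_def)
  have kp: "(kappa ^^ i) X = D i" if "i \<le> 2 * r" for i
    using kappa_pow_D[of 0 i] that X0 by simp
  \<comment> \<open>For r = 1 not even the sign of a1 is known; all exponents of the weights are
    then 0, so 1 may replace it.\<close>
  define A where "A = (if r = 1 then 1 else a1)"
  have A: "A > 0" "affine_jump A \<or> r = 1"
  proof -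
    show "A > 0" using assms(4) by (auto simp: A_def)
    have "affine_jump a1" if "r \<noteq> 1"
      using assms(2,4) that by (intro affine_interval[OF T Xe assms(5), of _ a0]) (auto simp: s_def)
    then show "affine_jump A \<or> r = 1" by (auto simp: A_def)
  qed
  have lag: "lagrangian X r L"
  proof
    fix u :: "nat \<Rightarrow> real" assume u: "u \<in> topspace (Euclidean_space (Suc r))"
    have "nabla_differentiable X (D 0) 1 (\<lambda>t. L t u)"
      using nabla_differentiable_mono[OF assms(11)[OF u], of 1] X0 by simp
    then have "dtower 0 1 (\<lambda>i. nabla_deriv X (D 0) i (\<lambda>t. L t u))" using rk by (intro dtower_nabla_deriv) auto
    from dtower_nd[OF this, of 0] have "continuous_on (D 0) (\<lambda>t. L t u)"
      using rk by (intro nd_continuous_on[of 0 _ "nabla_deriv X (D 0) 1 (\<lambda>t. L t u)"]) auto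
    then show "continuous_on X (\<lambda>t. L t u)" by (simp add: X0)
  qed (use compact assms(9,10) in auto)
  define hy where "hy i = nabla_deriv X X i y" for i
  have hy: "tower 0 (2 * r) hy"
    using dtower_nabla_deriv[of 0 "2 * r" y] y_diff y_cont kp[of "2 * r"] X0 unfolding tower_def hy_def[abs_def] by simp
  have hy0: "hy 0 = y" by (simp add: hy_def)
  have low_tower: "tower 0 r h" if "tower 0 (2 * r) h" for h
    using that tower_continuous[OF that, of r] by (auto simp: tower_def dtower_def)
  have low_dtower: "dtower 0 r h" if "tower 0 (2 * r) h" for h
    using low_tower[OF that] by (simp add: tower_def)
  have js: "tower_jet A r h t \<in> jet_space r" for h t by (simp add: in_jet_space tower_jet_def)
  have rj: "reg k (\<lambda>t. tower_jet A r h t i)" if "tower 0 (2 * r) h" "i \<le> r" for h i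
    by (rule reg_tower_jet[OF low_tower[OF that(1)] rk(1,3) A(2) that(2)])
  have jet: "jet X r (h 0) t = tower_jet A r h t" if "tower 0 (2 * r) h" "t \<in> D r" for h t
    by (rule jet_tower[OF low_dtower[OF that(1)] rk(3) X0 A(2) that(2)])
  have functional: "variational_functional T a b r L (h 0) = J k (\<lambda>t. L t (tower_jet A r h t)) b"
    if h: "tower 0 (2 * r) h" for h
  proof -
    have 1: "reg k (\<lambda>t. L t (tower_jet A r h t))"
      by (rule reg_lagrangian[OF rk(2) rj[OF h] js lagrangian.continuous_lagrangian[OF lag]])
    have eq: "L t (tower_jet A r h t) = L t (jet X r (h 0) t)" if "t \<in> D (Suc k)" for t
      using jet[OF h] that rk by simp
    have "variational_functional T a b r L (h 0) = nabla_integral X (D k) (\<lambda>t. L t (jet X r (h 0) t)) (s k) b"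
      using kp[of k] rk unfolding variational_functional_def Let_def X_def[symmetric] by (simp add: k_def s_def)
    also have "\<dots> = J k (\<lambda>t. L t (jet X r (h 0) t)) b"
      by (rule nabla_integral_eq_J[OF rk(2) reg_cong[OF 1 eq]])
    also have "\<dots> = J k (\<lambda>t. L t (tower_jet A r h t)) b"
      by (rule J_cong[OF rk(2) eq[symmetric] order_refl])
    finally show ?thesis .
  qed
  define f where "f i t = partial_u L i t (jet X r y t)" for i t
  have eq_f: "partial_u L i t (tower_jet A r hy t) = f i t" if "t \<in> D (Suc k)" for i t
    using jet[OF hy] that rk by (simp add: f_def hy0)
  have main: "nabla_differentiable X (D r) r (f r) \<and>
    (\<forall>t\<in>D (2 * r). (\<Sum>i\<le>r. (-1) ^ i * (1 / A) ^ (i * (i - 1) div 2) * nabla_deriv X (D r) i (f i) t) = 0)"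
  proof (rule euler_lagrange_of_orthogonal[OF assms(2) refl A])
    fix i assume i: "i \<le> r"
    have "reg k (\<lambda>t. partial_u L i t (tower_jet A r hy t))"
      by (rule reg_lagrangian[OF rk(2) rj[OF hy] js assms(10)[OF i]])
    then show "reg (r - 1) (f i)" unfolding k_def[symmetric] by (rule reg_cong) (rule eq_f)
  next
    fix i assume "1 \<le> i" "i < r"
    from assms(13)[OF this] show "nabla_differentiable X (D r) i (f i)"
      using kp[OF rk(3)] by (simp add: f_def[abs_def])
  next
    fix h assume h: "tower 0 (2 * r) h" and hlow: "\<And>i t. i < r \<Longrightarrow> t \<le> s (r - 1) \<Longrightarrow> h i t = 0"
      and hb: "\<And>i. i < r \<Longrightarrow> h i b = 0"
    define w where "w \<eta> = (\<lambda>i x. hy i x + \<eta> * h i x)" for \<eta>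
    have w: "tower 0 (2 * r) (w \<eta>)" for \<eta>
      using tower_comb[OF hy h, of 1 \<eta>] by (simp add: w_def)
    have adm: "admissible T a b r \<alpha> \<beta> (w \<eta> 0)" for \<eta>
    proof -
      have wd: "dtower 0 (2 * r) (w \<eta>)" using w by (simp add: tower_def)
      have d: "nabla_deriv X X i (w \<eta> 0) t = w \<eta> i t" if "i \<le> 2 * r" "t \<in> D i" for i t
        using nabla_deriv_dtower[OF wd, of "w \<eta> 0" i t] that X0 by simp
      have "nabla_differentiable X X (2 * r) (w \<eta> 0)"
        using nabla_differentiable_dtower[OF wd, of "w \<eta> 0"] X0 by simp
      moreover have "continuous_on (D (2 * r)) (nabla_deriv X X (2 * r) (w \<eta> 0))"
        using w[of \<eta>] d[of "2 * r"] by (auto simp: tower_def cong: continuous_on_cong_simp)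
      ultimately have C: "w \<eta> 0 \<in> C_nabla (2 * r) X" using kp[of "2 * r"] by (simp add: C_nabla_def)
      have "nabla_deriv X X i (w \<eta> 0) (s k) = nabla_deriv X X i y (s k) \<and>
          nabla_deriv X X i (w \<eta> 0) b = nabla_deriv X X i y b" if i: "i < r" for i
      proof -
        have "s k \<in> D i" "b \<in> D i" using s_in_D[of k] b_in_D[of i] D_antimono[of i k] i rk by auto
        then show ?thesis using d i hlow[OF i, of "s k"] hb[OF i] by (simp add: w_def hy_def k_def)
      qed
      then show ?thesis using adm_y C
        unfolding admissible_def Let_def X_def[symmetric] by (simp add: k_def s_def)
    qed
    have wjet: "tower_jet A r (w \<eta>) t = (\<lambda>i. tower_jet A r hy t i + \<eta> * tower_jet A r h t i)" for \<eta> t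
      unfolding w_def by (rule tower_jet_comb)
    obtain M where M: "M > 0" "\<And>t i. t \<in> D r \<Longrightarrow> \<bar>tower_jet A r h t i\<bar> \<le> M"
      using reg_family_bounded[OF rk(2) rj[OF h] js] rk(1) by auto
    have norm: "weak_norm X r (\<lambda>t. w \<eta> 0 t - y t) \<le> (real r + 1) * (\<bar>\<eta>\<bar> * M)" for \<eta>
      using weak_norm_tower[OF low_dtower[OF h] rk(3) X0 A(2) M(2), of \<eta>] by (simp add: w_def hy0)
    have small: "weak_norm X r (\<lambda>t. w \<eta> 0 t - y t) < \<delta>" if "\<bar>\<eta>\<bar> < \<delta> / ((real r + 1) * M)" for \<eta> \<delta>
    proof -
      have "(real r + 1) * M > 0" using M(1) by simp
      from that[unfolded pos_less_divide_eq[OF this]]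
      have "(real r + 1) * (\<bar>\<eta>\<bar> * M) < \<delta>" by (simp only: mult_ac)
      then show ?thesis using norm[of \<eta>] by simp
    qed
    have Fw: "variational_functional T a b r L (w \<eta> 0) =
        J k (\<lambda>t. L t (\<lambda>i. tower_jet A r hy t i + \<eta> * tower_jet A r h t i)) b" for \<eta>
      unfolding functional[OF w] wjet ..
    have Fy: "variational_functional T a b r L y = J k (\<lambda>t. L t (tower_jet A r hy t)) b"
      using functional[OF hy] by (simp add: hy0)
    have "\<exists>\<delta>>0. (\<forall>\<eta>. \<bar>\<eta>\<bar> < \<delta> \<longrightarrow> variational_functional T a b r L y \<le> variational_functional T a b r L (w \<eta> 0)) \<or>
        (\<forall>\<eta>. \<bar>\<eta>\<bar> < \<delta> \<longrightarrow> variational_functional T a b r L y \<ge> variational_functional T a b r L (w \<eta> 0))"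
      using ext unfolding weak_local_extremum_def
    proof
      assume "weak_local_minimizer T a b r L \<alpha> \<beta> y"
      then obtain \<delta> where "\<delta> > 0" "\<And>z. admissible T a b r \<alpha> \<beta> z \<Longrightarrow> weak_norm X r (\<lambda>t. z t - y t) < \<delta> \<Longrightarrow>
          variational_functional T a b r L y \<le> variational_functional T a b r L z"
        unfolding weak_local_minimizer_def X_def by blast
      then show ?thesis using adm small M(1) by (intro exI[of _ "\<delta> / ((real r + 1) * M)"]) auto
    next
      assume "weak_local_maximizer T a b r L \<alpha> \<beta> y"
      then obtain \<delta> where "\<delta> > 0" "\<And>z. admissible T a b r \<alpha> \<beta> z \<Longrightarrow> weak_norm X r (\<lambda>t. z t - y t) < \<delta> \<Longrightarrow>
          variational_functional T a b r L y \<ge> variational_functional T a b r L z"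
        unfolding weak_local_maximizer_def X_def by blast
      then show ?thesis using adm small M(1) by (intro exI[of _ "\<delta> / ((real r + 1) * M)"]) auto
    qed
    then obtain \<delta> where \<delta>: "\<delta> > 0"
        "(\<forall>\<eta>. \<bar>\<eta>\<bar> < \<delta> \<longrightarrow> variational_functional T a b r L y \<le> variational_functional T a b r L (w \<eta> 0)) \<or>
        (\<forall>\<eta>. \<bar>\<eta>\<bar> < \<delta> \<longrightarrow> variational_functional T a b r L y \<ge> variational_functional T a b r L (w \<eta> 0))" by blast
    have "J k (\<lambda>t. \<Sum>i\<le>r. tower_jet A r h t i * partial_u L i t (tower_jet A r hy t)) b = 0"
      by (rule first_variation[OF rk(2) lag rj[OF hy] js rj[OF h] js \<delta>(1) \<delta>(2)[unfolded Fw Fy]])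
    moreover have "J k (\<lambda>t. \<Sum>i\<le>r. tower_jet A r h t i * partial_u L i t (tower_jet A r hy t)) b
        = J k (\<lambda>t. \<Sum>i\<le>r. tower_jet A r h t i * f i t) b"
      by (rule J_cong[OF rk(2)]) (simp_all add: eq_f)
    ultimately show "J (r - 1) (\<lambda>t. \<Sum>i\<le>r. tower_jet A r h t i * f i t) b = 0" by (simp add: k_def)
  qed
  have coeff: "(1 / a1) ^ (i * (i - 1) div 2) = (1 / A) ^ (i * (i - 1) div 2)" if "i \<le> r" for i
    using that by (cases "r = 1"; cases i) (auto simp: A_def)
  have "(\<Sum>i\<le>r. (-1) ^ i * (1 / a1) ^ (i * (i - 1) div 2) * G i)
      = (\<Sum>i\<le>r. (-1) ^ i * (1 / A) ^ (i * (i - 1) div 2) * G i)" for G :: "nat \<Rightarrow> real"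
    by (rule sum.cong[OF refl]) (simp only: coeff atMost_iff)
  then show ?thesis
    using main unfolding kp[OF rk(3)] kp[OF order_refl] f_def[abs_def] by simp
qed

end
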